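(* Suppose $\mathcal{A}$ is an almost disjoint family of countable sets. Then the following are equivalent: (1) $\mathcal{A}$ is disjointifiable; (2) $K_{\mathcal{A}}$ is an Eberlein compact; (3) $C(K_{\mathcal{A}})$ is isomorphic (as a Banach space) to $c_0(\kappa)$ for $\kappa=|\mathcal{A}|+\omega$; (4) $C(K_{\mathcal{A}})$ has an unconditional basis; (5) $C(K_{\mathcal{A}})$ has a projectional skeleton.
   Context: A family $\mathcal{A}$ of infinite sets is almost disjoint if $A\cap B$ is finite for all distinct $A,B\in\mathcal{A}$; "countable sets" means that all its members are countably infinite. Put $X=\bigcup\mathcal{A}$. The compact Hausdorff space $K_{\mathcal{A}}$ has underlying set $X\cup\{l_A: A\in\mathcal{A}\}\cup\{\infty\}$ (the points $l_A$ and $\infty$ being new and distinct); each point of $X$ is isolated, basic neighborhoods of $l_A$ are $\{l_A\}\cup(A\setminus F)$ with $F$ finite, and basic neighborhoods of $\infty$ are $K_{\mathcal{A}}\setminus\bigcup_{i<n}(\{l_{A_i}\}\cup A_i)$ with $\{A_i: i<n\}\subseteq\mathcal{A}$. $C(K)$ is the Banach space of real-valued continuous functions on $K$ with the supremum norm. Two almost disjoint families $\mathcal{A}$ and $\mathcal{B}$ of countable sets are equivalent if the Boolean algebra generated by $\mathcal{A}$ and the finite subsets of $\bigcup\mathcal{A}$ is isomorphic to the Boolean algebra generated by $\mathcal{B}$ and the finite subsets of $\bigcup\mathcal{B}$. $\mathcal{A}$ is disjointifiable if it is equivalent to a pairwise disjoint family. An Eberlein compact is a compact space homeomorphic to a weakly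 compact subset of a Banach space. An unconditional basis may be uncountable: a family $(e_i)_{i\in I}$ such that each $x$ has a unique expansion $x=\sum_{i\in I}a_ie_i$, converging unconditionally. A projection on a Banach space $E$ is a bounded linear operator $P:E\to E$ with $P^2=P$; a subspace is complemented if it is the image of a projection. A Banach space $E$ has a projectional skeleton if there are a family $\mathcal{F}$ of separable complemented subspaces of $E$ with $E=\bigcup\mathcal{F}$, $\mathcal{F}$ up-directed by inclusion, and the closure of $\bigcup_n F_n$ in $\mathcal{F}$ for every sequence $F_0\subseteq F_1\subseteq\cdots$ in $\mathcal{F}$, together with projections $P_F$ of $E$ onto $F$ ($F\in\mathcal{F}$) satisfying $P_F\circ P_G=P_G\circ P_F=P_F$ whenever $F\subseteq G$, $F,G\in\mathcal{F}$.
   Formalization: The family $\mathcal{A}$ is assumed nonempty: for the empty family (1) holds, but $C(K_{\mathcal{A}})=\mathbb{R}$ is not isomorphic to $c_0(\omega)$, so (3) fails and the equivalence is false. *)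

theory Defs
  imports "HOL-Analysis.Analysis" "HOL-Probability.Discrete_Topology"
begin

section \<open>Almost disjoint families\<close>

definition almost_disjoint_countable :: "'a set set \<Rightarrow> bool" where
  "almost_disjoint_countable \<A> \<longleftrightarrow>
     (\<forall>A\<in>\<A>. countable A \<and> infinite A) \<and> pairwise (\<lambda>A B. finite (A \<inter> B)) \<A>"

definition family_algebra :: "'a set set \<Rightarrow> 'a set set" where
  "family_algebra \<A> = algebra (\<Union>\<A>) hull (\<A> \<union> {F. finite F \<and> F \<subseteq> \<Union>\<A>})"

definition isomorphic_algebras :: "'a set \<Rightarrow> 'a set set \<Rightarrow> 'b set \<Rightarrow> 'b set set \<Rightarrow> bool" where
  "isomorphic_algebras X M Y N \<longleftrightarrow>
     (\<exists>f. bij_betw f M N \<and>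
          (\<forall>S\<in>M. \<forall>T\<in>M. f (S \<union> T) = f S \<union> f T \<and> f (S \<inter> T) = f S \<inter> f T) \<and>
          (\<forall>S\<in>M. f (X - S) = Y - f S))"

definition equivalent_families :: "'a set set \<Rightarrow> 'b set set \<Rightarrow> bool" where
  "equivalent_families \<A> \<B> \<longleftrightarrow>
     isomorphic_algebras (\<Union>\<A>) (family_algebra \<A>) (\<Union>\<B>) (family_algebra \<B>)"

definition disjoint_countable :: "'a set set \<Rightarrow> bool" where
  "disjoint_countable \<B> \<longleftrightarrow> (\<forall>B\<in>\<B>. countable B \<and> infinite B) \<and> pairwise disjnt \<B>"

text \<open>The witnessing disjoint family is sought over the type of the points of \<open>\<A>\<close>; by
  \<open>disjointifiableI\<close> below, a witness over any other type yields one over this type.\<close>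

definition disjointifiable :: "'a set set \<Rightarrow> bool" where
  "disjointifiable \<A> \<longleftrightarrow> (\<exists>\<B> :: 'a set set. disjoint_countable \<B> \<and> equivalent_families \<A> \<B>)"

section \<open>The compact space of an almost disjoint family\<close>

datatype 'a kpoint = Point 'a | Limit "'a set" | Infinity

definition K_points :: "'a set set \<Rightarrow> 'a kpoint set" where
  "K_points \<A> = Point ` \<Union>\<A> \<union> Limit ` \<A> \<union> {Infinity}"

primrec K_basic_nhds :: "'a set set \<Rightarrow> 'a kpoint \<Rightarrow> 'a kpoint set set" where
  "K_basic_nhds \<A> (Point x) = {{Point x}}"
| "K_basic_nhds \<A> (Limit A) = {insert (Limit A) (Point ` (A - F)) | F. finite F}"
| "K_basic_nhds \<A> Infinity =
     {K_points \<A> - (\<Union>A\<in>\<F>. insert (Limit A) (Point ` A)) | \<F>. finite \<F> \<and> \<F> \<subseteq> \<A>}"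

definition K_space :: "'a set set \<Rightarrow> 'a kpoint topology" where
  "K_space \<A> = topology (\<lambda>U. U \<subseteq> K_points \<A> \<and> (\<forall>p\<in>U. \<exists>N\<in>K_basic_nhds \<A> p. N \<subseteq> U))"

section \<open>Eberlein compacta\<close>

instance bcontfun :: (metric_space, banach) banach ..

definition weak_topology :: "'e::real_normed_vector topology" where
  "weak_topology =
     topology_generated_by {\<phi> -` U | (\<phi> :: 'e \<Rightarrow> real) U. bounded_linear \<phi> \<and> open U}"

definition eberlein_in :: "'e::banach itself \<Rightarrow> 'p topology \<Rightarrow> bool" where
  "eberlein_in _ X \<longleftrightarrow>
     compact_space X \<and>
     (\<exists>W :: 'e set. compactin weak_topology W \<and>
                    X homeomorphic_space subtopology weak_topology W)"

text \<open>A formula cannot quantify over types, so the Banach space is fixed to be a sufficiently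
  large one, the bounded real functions on \<open>'p \<times> 'p\<close>. By \<open>eberlein_compactI\<close> below, a compact
  Hausdorff space that is \<open>eberlein_in\<close> some Banach space of whatever type is
  \<open>eberlein_compact\<close>, so there is no loss of generality.\<close>

definition eberlein_compact :: "'p topology \<Rightarrow> bool" where
  "eberlein_compact X \<longleftrightarrow> eberlein_in TYPE(('p \<times> 'p) discrete \<Rightarrow>\<^sub>C real) X"

section \<open>Banach spaces as closed subspaces\<close>

text \<open>The Banach spaces depending on \<open>\<A>\<close> are closed linear subspaces \<open>E\<close> of an ambient space
  \<open>'i discrete \<Rightarrow>\<^sub>C real\<close>, which is the space of all bounded functions on \<open>'i\<close> with the supremum
  norm. Only the values of an operator on \<open>E\<close> are relevant.\<close>

definition bounded_linear_on ::
  "'v::real_normed_vector set \<Rightarrow> 'w::real_normed_vector set \<Rightarrow> ('v \<Rightarrow> 'w) \<Rightarrow> bool" where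
  "bounded_linear_on E F T \<longleftrightarrow>
     T ` E \<subseteq> F \<and>
     (\<forall>x\<in>E. \<forall>y\<in>E. T (x + y) = T x + T y) \<and>
     (\<forall>x\<in>E. \<forall>c. T (c *\<^sub>R x) = c *\<^sub>R T x) \<and>
     (\<exists>C. \<forall>x\<in>E. norm (T x) \<le> C * norm x)"

definition isomorphic_banach ::
  "'v::real_normed_vector set \<Rightarrow> 'w::real_normed_vector set \<Rightarrow> bool" where
  "isomorphic_banach E F \<longleftrightarrow>
     (\<exists>T S. bounded_linear_on E F T \<and> bounded_linear_on F E S \<and>
            (\<forall>x\<in>E. S (T x) = x) \<and> (\<forall>y\<in>F. T (S y) = y))"

text \<open>Functions in \<open>C_space K\<close> are extended by \<open>0\<close> outside \<open>K\<close>, so that the ambient norm is the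
  supremum over \<open>K\<close>. For compact \<open>K\<close> every continuous function on \<open>K\<close> is bounded, hence arises
  in this way.\<close>

definition C_space :: "'p topology \<Rightarrow> ('p discrete \<Rightarrow>\<^sub>C real) set" where
  "C_space K = {f. continuous_map K euclideanreal (\<lambda>p. apply_bcontfun f (discrete p)) \<and>
                   (\<forall>p. p \<notin> topspace K \<longrightarrow> apply_bcontfun f (discrete p) = 0)}"

definition c0_space :: "'i set \<Rightarrow> ('i discrete \<Rightarrow>\<^sub>C real) set" where
  "c0_space \<Gamma> = {f. (\<forall>i. i \<notin> \<Gamma> \<longrightarrow> apply_bcontfun f (discrete i) = 0) \<and>
                    (\<forall>\<epsilon>>0. finite {i. \<epsilon> \<le> \<bar>apply_bcontfun f (discrete i)\<bar>})}"

text \<open>For series in a Banach space, \<open>has_sum\<close> is unconditional convergence. Coefficient families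
  are functions on \<open>I\<close>, made unique by the value \<open>0\<close> outside \<open>I\<close>.\<close>

definition unconditional_basis ::
  "'v::real_normed_vector set \<Rightarrow> 'i set \<Rightarrow> ('i \<Rightarrow> 'v) \<Rightarrow> bool" where
  "unconditional_basis E I e \<longleftrightarrow>
     e ` I \<subseteq> E \<and>
     (\<forall>x\<in>E. \<exists>!a :: 'i \<Rightarrow> real.
        (\<forall>i. i \<notin> I \<longrightarrow> a i = 0) \<and> ((\<lambda>i. a i *\<^sub>R e i) has_sum x) I)"

text \<open>By uniqueness of expansions the members of a basis are pairwise distinct, so a basis can be
  indexed by a set of vectors.\<close>

definition has_unconditional_basis :: "'v::real_normed_vector set \<Rightarrow> bool" where
  "has_unconditional_basis E \<longleftrightarrow> (\<exists>(I :: 'v set) e. unconditional_basis E I e)"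

definition projection_on :: "'v::real_normed_vector set \<Rightarrow> ('v \<Rightarrow> 'v) \<Rightarrow> bool" where
  "projection_on E P \<longleftrightarrow> bounded_linear_on E E P \<and> (\<forall>x\<in>E. P (P x) = P x)"

definition complemented_in :: "'v::real_normed_vector set \<Rightarrow> 'v set \<Rightarrow> bool" where
  "complemented_in E F \<longleftrightarrow> (\<exists>P. projection_on E P \<and> P ` E = F)"

definition has_projectional_skeleton :: "'v::real_normed_vector set \<Rightarrow> bool" where
  "has_projectional_skeleton E \<longleftrightarrow>
     (\<exists>(\<F> :: 'v set set) (P :: 'v set \<Rightarrow> 'v \<Rightarrow> 'v).
        (\<forall>F\<in>\<F>. complemented_in E F \<and> separable_space (top_of_set F)) \<and>
        E = \<Union>\<F> \<and>
        (\<forall>F\<in>\<F>. \<forall>G\<in>\<F>. \<exists>H\<in>\<F>. F \<subseteq> H \<and> G \<subseteq> H) \<and>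
        (\<forall>S :: nat \<Rightarrow> 'v set.
           (\<forall>n. S n \<in> \<F>) \<and> (\<forall>n. S n \<subseteq> S (Suc n)) \<longrightarrow> closure (\<Union>n. S n) \<in> \<F>) \<and>
        (\<forall>F\<in>\<F>. projection_on E (P F) \<and> P F ` E = F) \<and>
        (\<forall>F\<in>\<F>. \<forall>G\<in>\<F>. F \<subseteq> G \<longrightarrow>
           (\<forall>x\<in>E. P F (P G x) = P F x \<and> P G (P F x) = P F x)))"

section \<open>Adequacy of the definitions\<close>

lemma K_nhd_Int:
  assumes "N \<in> K_basic_nhds \<A> p" "N' \<in> K_basic_nhds \<A> p"
  shows "\<exists>N''\<in>K_basic_nhds \<A> p. N'' \<subseteq> N \<inter> N'"
proof (cases p)
  case (Point x) then show ?thesis using assms by auto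
next
  case (Limit A)
  with assms obtain F G where "finite F" "finite G"
    "N = insert (Limit A) (Point ` (A - F))" "N' = insert (Limit A) (Point ` (A - G))"
    by auto
  then show ?thesis using Limit
    by (intro bexI[of _ "insert (Limit A) (Point ` (A - (F \<union> G)))"]) auto
next
  case Infinity
  with assms obtain F G where "finite F" "finite G" "F \<subseteq> \<A>" "G \<subseteq> \<A>"
    "N = K_points \<A> - (\<Union>A\<in>F. insert (Limit A) (Point ` A))"
    "N' = K_points \<A> - (\<Union>A\<in>G. insert (Limit A) (Point ` A))"
    by auto
  then show ?thesis using Infinity
    by (intro bexI[of _ "K_points \<A> - (\<Union>A\<in>F \<union> G. insert (Limit A) (Point ` A))"])
       (blast, auto intro!: exI[of _ "F \<union> G"])
qed

lemma openin_K_space: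
  "openin (K_space \<A>) U \<longleftrightarrow>
     U \<subseteq> K_points \<A> \<and> (\<forall>p\<in>U. \<exists>N\<in>K_basic_nhds \<A> p. N \<subseteq> U)"
proof -
  let ?P = "\<lambda>U. U \<subseteq> K_points \<A> \<and> (\<forall>p\<in>U. \<exists>N\<in>K_basic_nhds \<A> p. N \<subseteq> U)"
  have "?P (S \<inter> T)" if S: "?P S" and T: "?P T" for S T
  proof (intro conjI ballI)
    show "S \<inter> T \<subseteq> K_points \<A>" using S by blast
    fix p assume "p \<in> S \<inter> T"
    then obtain N N' where N: "N \<in> K_basic_nhds \<A> p" "N \<subseteq> S" "N' \<in> K_basic_nhds \<A> p" "N' \<subseteq> T"
      using S T by blast
    then show "\<exists>N\<in>K_basic_nhds \<A> p. N \<subseteq> S \<inter> T"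
      using K_nhd_Int[OF N(1,3)] by blast
  qed
  moreover have "?P (\<Union>\<U>)" if "\<forall>U\<in>\<U>. ?P U" for \<U>
    using that by (meson Sup_least Union_iff Union_upper order_trans)
  ultimately have "istopology ?P"
    unfolding istopology_def by blast
  then show ?thesis
    by (simp add: K_space_def topology_inverse')
qed

lemma topspace_K_space: "topspace (K_space \<A>) = K_points \<A>"
proof -
  have "openin (K_space \<A>) (K_points \<A>)"
    unfolding openin_K_space
  proof (intro conjI ballI subset_refl)
    fix p assume p: "p \<in> K_points \<A>"
    show "\<exists>N\<in>K_basic_nhds \<A> p. N \<subseteq> K_points \<A>"
    proof (cases p)
      case (Point x) then show ?thesis using p by auto
    next
      case (Limit A)
      then show ?thesis using p
        by (intro bexI[of _ "insert (Limit A) (Point ` (A - {}))"]) (auto simp: K_points_def)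
    next
      case Infinity
      then show ?thesis by auto
    qed
  qed
  then show ?thesis
    using openin_K_space openin_topspace openin_subset by (metis subset_antisym)
qed

lemma weakly_open_iff_of_functionals_eq:
  fixes x y :: "'e::real_normed_vector"
  assumes "openin weak_topology U" "\<And>\<phi> :: 'e \<Rightarrow> real. bounded_linear \<phi> \<Longrightarrow> \<phi> x = \<phi> y"
  shows "x \<in> U \<longleftrightarrow> y \<in> U"
proof -
  have "generate_topology_on {\<phi> -` U | (\<phi> :: 'e \<Rightarrow> real) U. bounded_linear \<phi> \<and> open U} U"
    using assms(1) unfolding weak_topology_def by (simp add: openin_topology_generated_by_iff)
  then show ?thesis
    by induction (auto dest: assms(2))
qed

lemma openin_weak_topology_vimage:
  fixes \<phi> :: "'e::real_normed_vector \<Rightarrow> real"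
  assumes "bounded_linear \<phi>" "open U"
  shows "openin weak_topology (\<phi> -` U)"
  unfolding weak_topology_def by (rule topology_generated_by_Basis) (use assms in blast)

lemma topspace_weak_topology [simp]: "topspace weak_topology = (UNIV :: 'e::real_normed_vector set)"
  using openin_subset[OF openin_weak_topology_vimage[OF bounded_linear_zero open_UNIV]] by auto

lemma continuous_map_weak_topology:
  fixes T :: "'e::real_normed_vector \<Rightarrow> 'f::real_normed_vector"
  assumes "bounded_linear T"
  shows "continuous_map weak_topology weak_topology T"
  unfolding weak_topology_def[where 'e = 'f]
proof (rule continuous_on_generated_topo)
  fix V assume "V \<in> {\<phi> -` U | (\<phi> :: 'f \<Rightarrow> real) U. bounded_linear \<phi> \<and> open U}"
  then obtain \<phi> :: "'f \<Rightarrow> real" and U where V: "bounded_linear \<phi>" "open U" "V = \<phi> -` U" by auto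
  have "openin weak_topology ((\<lambda>x. \<phi> (T x)) -` U)"
    by (rule openin_weak_topology_vimage[OF bounded_linear_compose[OF V(1) assms] V(2)])
  then show "openin weak_topology (T -` V \<inter> topspace weak_topology)"
    by (simp add: V(3) vimage_def)
next
  have "UNIV = (\<lambda>x::'f. 0::real) -` UNIV" by simp
  then show "T ` topspace weak_topology
             \<subseteq> \<Union> {\<phi> -` U | (\<phi> :: 'f \<Rightarrow> real) U. bounded_linear \<phi> \<and> open U}"
    using bounded_linear_zero open_UNIV by blast
qed

lemma bounded_linear_eval_bcontfun:
  "bounded_linear (\<lambda>f :: 'i::topological_space \<Rightarrow>\<^sub>C real. apply_bcontfun f i)"
proof (rule bounded_linear_intro[where K = 1])
  show "norm (apply_bcontfun f i) \<le> norm f * 1" for f :: "'i \<Rightarrow>\<^sub>C real"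
    using norm_bounded[of f i] by simp
qed auto

lemma Hausdorff_weak_topology_bcontfun:
  "Hausdorff_space (weak_topology :: ('i::topological_space \<Rightarrow>\<^sub>C real) topology)"
  unfolding Hausdorff_space_def
proof (intro allI impI)
  fix f g :: "'i \<Rightarrow>\<^sub>C real"
  assume "f \<in> topspace weak_topology \<and> g \<in> topspace weak_topology \<and> f \<noteq> g"
  then obtain i where "apply_bcontfun f i \<noteq> apply_bcontfun g i"
    using bcontfun_eqI by blast
  then obtain U V where UV: "open U" "open V" "apply_bcontfun f i \<in> U" "apply_bcontfun g i \<in> V"
    "U \<inter> V = {}"
    by (meson hausdorff)
  let ?\<phi> = "\<lambda>h :: 'i \<Rightarrow>\<^sub>C real. apply_bcontfun h i"
  show "\<exists>U V. openin weak_topology U \<and> openin weak_topology V \<and> f \<in> U \<and> g \<in> V \<and> disjnt U V"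
  proof (intro exI conjI)
    show "openin weak_topology (?\<phi> -` U)" "openin weak_topology (?\<phi> -` V)"
      using UV bounded_linear_eval_bcontfun by (auto intro: openin_weak_topology_vimage)
    show "f \<in> ?\<phi> -` U" "g \<in> ?\<phi> -` V" using UV by auto
    show "disjnt (?\<phi> -` U) (?\<phi> -` V)" using UV by (auto simp: disjnt_def)
  qed
qed

theorem eberlein_compactI:
  fixes X :: "'p topology"
  assumes X: "Hausdorff_space X" and e: "eberlein_in TYPE('e::banach) X"
  shows "eberlein_compact X"
proof -
  from e obtain W :: "'e set" where comp: "compact_space X" and W: "compactin weak_topology W"
    and hom: "X homeomorphic_space subtopology weak_topology W"
    unfolding eberlein_in_def by blast
  from hom obtain h where h: "homeomorphic_map X (subtopology weak_topology W) h"
    unfolding homeomorphic_space by blast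
  have HW: "Hausdorff_space (subtopology weak_topology W)"
    using X hom homeomorphic_Hausdorff_space by blast
  have hW: "h ` topspace X = W" and hinj: "inj_on h (topspace X)"
    using h by (auto simp: homeomorphic_eq_everything_map)
  have hcont: "continuous_map X weak_topology h"
    using h homeomorphic_imp_continuous_map continuous_map_in_subtopology by blast
  have sep: "\<exists>\<phi> :: 'e \<Rightarrow> real. bounded_linear \<phi> \<and> \<phi> x \<noteq> \<phi> y" if "x \<in> W" "y \<in> W" "x \<noteq> y" for x y
  proof (rule ccontr)
    assume con: "\<not> ?thesis"
    have "x \<in> topspace (subtopology weak_topology W)" "y \<in> topspace (subtopology weak_topology W)"
      using that by simp_all
    then obtain U V where "openin (subtopology weak_topology W) U"
      "openin (subtopology weak_topology W) V" "x \<in> U" "y \<in> V" "disjnt U V"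
      using HW[unfolded Hausdorff_space_def, rule_format, of x y] \<open>x \<noteq> y\<close> by metis
    then obtain U' where "openin weak_topology U'" "x \<in> U'" "y \<notin> U'"
      using \<open>y \<in> W\<close> by (auto simp: openin_subtopology disjnt_iff)
    then show False using weakly_open_iff_of_functionals_eq[of U' x y] con by blast
  qed
  have "\<exists>\<phi> :: 'e \<Rightarrow> real. bounded_linear \<phi> \<and> (\<forall>v. norm (\<phi> v) \<le> norm v) \<and>
          (a \<in> topspace X \<and> b \<in> topspace X \<and> a \<noteq> b \<longrightarrow> \<phi> (h a) \<noteq> \<phi> (h b))" for a b
  proof (cases "a \<in> topspace X \<and> b \<in> topspace X \<and> a \<noteq> b")
    case True
    then have "h a \<in> W" "h b \<in> W" "h a \<noteq> h b" using hW hinj by (auto dest: inj_onD)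
    then obtain \<phi> :: "'e \<Rightarrow> real" where \<phi>: "bounded_linear \<phi>" "\<phi> (h a) \<noteq> \<phi> (h b)"
      using sep by blast
    obtain C where C: "C > 0" "\<And>v. norm (\<phi> v) \<le> norm v * C"
      using bounded_linear.pos_bounded[OF \<phi>(1)] by blast
    have "bounded_linear (\<lambda>v. \<phi> v / C)"
      using bounded_linear_compose[OF bounded_linear_divide \<phi>(1)] by simp
    moreover have "norm (\<phi> v / C) \<le> norm v" for v
      using C(1) C(2)[of v] by (simp add: divide_le_eq)
    moreover have "\<phi> (h a) / C \<noteq> \<phi> (h b) / C" using \<phi>(2) C(1) by simp
    ultimately show ?thesis by blast
  next
    case False
    then show ?thesis by (intro exI[of _ "\<lambda>_. 0"]) auto
  qed
  then obtain \<phi> :: "'p \<Rightarrow> 'p \<Rightarrow> 'e \<Rightarrow> real" where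
    lin: "\<And>a b. bounded_linear (\<phi> a b)" and bd: "\<And>a b v. norm (\<phi> a b v) \<le> norm v" and
    ne: "\<And>a b. \<lbrakk>a \<in> topspace X; b \<in> topspace X; a \<noteq> b\<rbrakk> \<Longrightarrow> \<phi> a b (h a) \<noteq> \<phi> a b (h b)"
    by metis
  define T :: "'e \<Rightarrow> (('p \<times> 'p) discrete \<Rightarrow>\<^sub>C real)"
    where "T v = Bcontfun (\<lambda>d. case_prod \<phi> (of_discrete d) v)" for v
  have "(\<lambda>d. case_prod \<phi> (of_discrete d) v) \<in> bcontfun" for v
    by (rule bcontfun_normI[where b = "norm v"])
       (auto simp: continuous_on_open_vimage open_discrete bd[unfolded real_norm_def] split: prod.split)
  then have T: "apply_bcontfun (T v) d = case_prod \<phi> (of_discrete d) v" for v d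
    by (simp add: T_def Bcontfun_inverse)
  have "bounded_linear T"
  proof (rule bounded_linear_intro[where K = 1])
    show "T (x + y) = T x + T y" for x y
      by (rule bcontfun_eqI) (auto simp: T linear_simps[OF lin] split: prod.split)
    show "T (r *\<^sub>R x) = r *\<^sub>R T x" for r x
      by (rule bcontfun_eqI) (auto simp: T linear_simps[OF lin] split: prod.split)
    show "norm (T x) \<le> norm x * 1" for x
      by (auto intro!: norm_bound simp: T bd[unfolded real_norm_def] split: prod.split)
  qed
  then have Tc: "continuous_map weak_topology weak_topology T"
    by (rule continuous_map_weak_topology)
  have cW: "compactin weak_topology (T ` W)"
    using W Tc image_compactin by blast
  have "homeomorphic_map X (subtopology weak_topology (T ` W)) (T \<circ> h)"
  proof (rule continuous_imp_homeomorphic_map)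
    show "continuous_map X (subtopology weak_topology (T ` W)) (T \<circ> h)"
      using continuous_map_compose[OF hcont Tc] hW
      by (auto simp: continuous_map_in_subtopology)
    show "compact_space X" by (rule comp)
    show "Hausdorff_space (subtopology weak_topology (T ` W))"
      by (rule Hausdorff_space_subtopology[OF Hausdorff_weak_topology_bcontfun])
    show "(T \<circ> h) ` topspace X = topspace (subtopology weak_topology (T ` W))"
      using hW by auto
    show "inj_on (T \<circ> h) (topspace X)"
    proof (rule inj_onI, rule ccontr)
      fix a b assume ab: "a \<in> topspace X" "b \<in> topspace X" "(T \<circ> h) a = (T \<circ> h) b" "a \<noteq> b"
      then have "\<phi> a b (h a) = \<phi> a b (h b)"
        using T[of "h a" "discrete (a, b)"] T[of "h b" "discrete (a, b)"]
        by (simp add: discrete_inverse)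
      with ne ab show False by blast
    qed
  qed
  then show ?thesis
    unfolding eberlein_compact_def eberlein_in_def
    using comp cW homeomorphic_map_imp_homeomorphic_space by blast
qed

lemma algebra_family_algebra: "algebra (\<Union>\<A>) (family_algebra \<A>)"
proof -
  let ?G = "\<A> \<union> {F. finite F \<and> F \<subseteq> \<Union>\<A>}"
  have P: "algebra (\<Union>\<A>) (Pow (\<Union>\<A>))" "?G \<subseteq> Pow (\<Union>\<A>)"
    by (auto simp: algebra_iff_Un)
  have "family_algebra \<A> \<subseteq> Pow (\<Union>\<A>)"
    unfolding family_algebra_def using P by (intro hull_minimal) auto
  then show ?thesis
    unfolding algebra_iff_Un family_algebra_def hull_def by (auto simp: algebra_iff_Un)
qed

lemma family_algebra_superset:
  "\<A> \<subseteq> family_algebra \<A>" "finite F \<Longrightarrow> F \<subseteq> \<Union>\<A> \<Longrightarrow> F \<in> family_algebra \<A>"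
  using hull_subset[of "\<A> \<union> {F. finite F \<and> F \<subseteq> \<Union>\<A>}" "algebra (\<Union>\<A>)"]
  unfolding family_algebra_def by auto

theorem disjointifiableI:
  fixes \<A> :: "'a set set" and \<B> :: "'b set set"
  assumes disj: "disjoint_countable \<B>" and equiv: "equivalent_families \<A> \<B>"
  shows "disjointifiable \<A>"
proof -
  define X M Y N where defs: "X = \<Union>\<A>" "M = family_algebra \<A>" "Y = \<Union>\<B>" "N = family_algebra \<B>"
  have algM: "algebra X M" and algN: "algebra Y N"
    unfolding defs by (rule algebra_family_algebra)+
  have M: "M \<subseteq> Pow X" "{} \<in> M" "\<And>S. S \<in> M \<Longrightarrow> X - S \<in> M"
    and N: "N \<subseteq> Pow Y" "{} \<in> N"
    using algM algN by (auto simp: algebra_iff_Un)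
  have MI: "S \<inter> T \<in> M" if "S \<in> M" "T \<in> M" for S T
    using algM that by (auto simp: algebra_iff_Int)
  have Msing: "{x} \<in> M" if "x \<in> X" for x
    using that family_algebra_superset(2)[of "{x}" \<A>] by (simp add: defs)
  have Nsing: "{y} \<in> N" if "y \<in> Y" for y
    using that family_algebra_superset(2)[of "{y}" \<B>] by (simp add: defs)
  have "isomorphic_algebras X M Y N"
    using equiv by (simp add: equivalent_families_def defs)
  then obtain f where f: "bij_betw f M N"
    and f': "\<forall>S\<in>M. \<forall>T\<in>M. f (S \<union> T) = f S \<union> f T \<and> f (S \<inter> T) = f S \<inter> f T"
      "\<forall>S\<in>M. f (X - S) = Y - f S"
    unfolding isomorphic_algebras_def by (elim exE conjE)
  have fI: "f (S \<inter> T) = f S \<inter> f T" if "S \<in> M" "T \<in> M" for S T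
    using f'(1) that by simp
  have fC: "f (X - S) = Y - f S" if "S \<in> M" for S
    using f'(2) that by simp
  have fN: "f S \<in> N" if "S \<in> M" for S
    using f that by (auto simp: bij_betw_def)
  have fsurj: "\<exists>S\<in>M. f S = T" if "T \<in> N" for T
    using f that unfolding bij_betw_def by (metis imageE)
  have finj: "S = T" if "S \<in> M" "T \<in> M" "f S = f T" for S T
    using f that by (auto simp: bij_betw_def dest: inj_onD)
  have f0: "f {} = {}"
  proof -
    obtain S where "S \<in> M" "f S = {}" using fsurj N(2) by blast
    then show ?thesis using fI[of "{}" S] M(2) by simp
  qed
  have point: "\<exists>x\<in>X. S \<inter> {x} = {x} \<and> f {x} = {y}" if "S \<in> M" "y \<in> f S" for S y
  proof -
    have "y \<in> Y" using that fN N(1) by blast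
    then obtain T where T: "T \<in> M" "f T = {y}" using fsurj Nsing by blast
    then have "T \<noteq> {}" using f0 by auto
    then obtain x where x: "x \<in> T" by blast
    then have xX: "x \<in> X" using T M(1) by blast
    have "f (T \<inter> S) = f T" using fI[OF T(1) that(1)] T(2) that(2) by auto
    then have "T \<inter> S = T" using finj MI T(1) that(1) by blast
    then have "S \<inter> {x} = {x}" using x by blast
    moreover have "f {x} = {y}"
    proof -
      have "{x} \<inter> T = {x}" using x by blast
      then have "f {x} \<subseteq> {y}" using fI[OF Msing[OF xX] T(1)] T(2) by auto
      moreover have "f {x} \<noteq> {}" using finj[OF Msing[OF xX] M(2)] f0 by auto
      ultimately show ?thesis by blast
    qed
    ultimately show ?thesis using xX by blast
  qed
  have "\<exists>y. f {x} = {y}" if x: "x \<in> X" for x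
  proof -
    have "f {x} \<noteq> {}" using finj[OF Msing[OF x] M(2)] f0 by auto
    then obtain y where "y \<in> f {x}" by blast
    then obtain x' where x': "{x} \<inter> {x'} = {x'}" "f {x'} = {y}" using point Msing x by blast
    then have "x' = x" by blast
    then show ?thesis using x'(2) by blast
  qed
  then obtain h where h: "\<And>x. x \<in> X \<Longrightarrow> f {x} = {h x}" by metis
  have f_image: "f S = h ` S" if S: "S \<in> M" for S
  proof (intro set_eqI iffI)
    fix y assume "y \<in> f S"
    then obtain x where "x \<in> X" "S \<inter> {x} = {x}" "f {x} = {y}" using point S by blast
    then show "y \<in> h ` S" using h by auto
  next
    fix y assume "y \<in> h ` S"
    then obtain x where x: "x \<in> S" "y = h x" by blast
    then have xX: "x \<in> X" using S M(1) by blast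
    have "{x} \<inter> S = {x}" using x by blast
    then show "y \<in> f S" using fI[OF Msing[OF xX] S] h[OF xX] x by auto
  qed
  have hinj: "inj_on h X"
    by (rule inj_onI) (metis Msing finj h singleton_inject)
  have XM: "X \<in> M" using M(3)[OF M(2)] by simp
  have hY: "h ` X = Y"
    using fC[OF M(2)] f0 f_image[OF XM] by simp
  define g where "g = inv_into X h"
  have gh: "g ` h ` S = S" if "S \<subseteq> X" for S
    using that hinj by (force simp: g_def image_image subset_iff)
  have ginj: "inj_on g Y" and gY: "g ` Y = X"
    using inj_on_inv_into[where B = Y and f = h and A = X] gh[of X] hY by (simp_all add: g_def)
  define \<C> where "\<C> = (`) g ` \<B>"
  have UC: "\<Union>\<C> = X"
    using gY unfolding \<C>_def defs(3) by (simp add: image_Union)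
  have BY: "B \<subseteq> Y" if "B \<in> \<B>" for B using that by (auto simp: defs)
  have "family_algebra \<C> \<subseteq> M"
    unfolding family_algebra_def UC
  proof (rule hull_minimal)
    show "algebra X M" by (rule algM)
    have "g ` B \<in> M" if "B \<in> \<B>" for B
    proof -
      have "B \<in> N" using that family_algebra_superset(1)[of \<B>] by (auto simp: defs)
      then obtain S where "S \<in> M" "f S = B" using fsurj by blast
      then show ?thesis using f_image gh[of S] M(1) by auto
    qed
    then show "\<C> \<union> {F. finite F \<and> F \<subseteq> X} \<subseteq> M"
      using family_algebra_superset(2)[of _ \<A>] by (auto simp: \<C>_def defs)
  qed
  moreover have "M \<subseteq> family_algebra \<C>"
  proof
    fix S assume S: "S \<in> M"
    define Z where "Z = {T. T \<subseteq> Y \<and> g ` T \<in> family_algebra \<C>}"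
    have algC: "algebra X (family_algebra \<C>)"
      using algebra_family_algebra[of \<C>] by (simp add: UC)
    have "N \<subseteq> Z"
      unfolding defs(4) family_algebra_def
    proof (rule hull_minimal)
      have "g ` (Y - T) = X - g ` T" if "T \<subseteq> Y" for T
        using inj_on_image_set_diff[OF ginj, of Y T] that gY by auto
      then show "algebra (\<Union>\<B>) Z"
        using algC unfolding Z_def defs(3)[symmetric] by (auto simp: algebra_iff_Un image_Un)
      show "\<B> \<union> {F. finite F \<and> F \<subseteq> \<Union>\<B>} \<subseteq> Z"
      proof
        fix T assume "T \<in> \<B> \<union> {F. finite F \<and> F \<subseteq> \<Union>\<B>}"
        then consider "T \<in> \<B>" | "finite T" "T \<subseteq> Y" by (auto simp: defs)
        then show "T \<in> Z"
        proof cases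
          case 1
          then show ?thesis
            using BY family_algebra_superset(1)[of \<C>] by (auto simp: Z_def \<C>_def)
        next
          case 2
          then have "g ` T \<subseteq> X" using gY by blast
          then show ?thesis
            using 2 family_algebra_superset(2)[of "g ` T" \<C>] by (simp add: Z_def UC)
        qed
      qed
    qed
    then have "g ` f S \<in> family_algebra \<C>" using fN[OF S] by (auto simp: Z_def)
    then show "S \<in> family_algebra \<C>" using f_image[OF S] gh[of S] S M(1) by auto
  qed
  ultimately have "family_algebra \<C> = family_algebra \<A>" by (simp add: defs)
  then have "equivalent_families \<A> \<C>"
    using UC unfolding equivalent_families_def isomorphic_algebras_def defs
    by (intro exI[of _ id]) auto
  moreover have "disjoint_countable \<C>"
    unfolding disjoint_countable_def
  proof
    show "\<forall>C\<in>\<C>. countable C \<and> infinite C"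
      using disj BY ginj unfolding disjoint_countable_def \<C>_def
      by (auto dest!: finite_imageD intro: inj_on_subset)
    show "pairwise disjnt \<C>"
      unfolding pairwise_def
    proof (intro ballI impI)
      fix C D assume "C \<in> \<C>" "D \<in> \<C>" "C \<noteq> D"
      then obtain B B' where B: "B \<in> \<B>" "B' \<in> \<B>" "C = g ` B" "D = g ` B'" "B \<noteq> B'"
        by (auto simp: \<C>_def)
      then have "B \<inter> B' = {}" using disj by (auto simp: disjoint_countable_def pairwise_def disjnt_def)
      then show "disjnt C D"
        using inj_on_image_Int[OF ginj BY[OF B(1)] BY[OF B(2)]] B by (simp add: disjnt_def)
    qed
  qed
  ultimately show ?thesis unfolding disjointifiable_def by blast
qed

end

theory Submission
  imports Defs "HOL-Algebra.Free_Abelian_Groups"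
begin

text \<open>All conditions are compared with the following one: \<open>\<A>\<close> becomes pairwise disjoint after the
  removal of a finite set from each member. Under this condition \<open>K\<^sub>\<A>\<close> is the one-point
  compactification of a disjoint sum of convergent sequences, and explicit formulas give the
  weakly compact copy of \<open>K\<^sub>\<A>\<close> and the isomorphism of \<open>C(K\<^sub>\<A>)\<close> with \<open>c\<^sub>0\<close>; an unconditional basis
  yields a projectional skeleton, whose members consist of the vectors supported on a given
  countable set.

  Conversely, an induction on cardinality shows that it suffices to find a function \<open>\<phi>\<close> from the
  finite to the countable subsets of \<open>\<A>\<close> such that, whenever \<open>S\<close> is countable and closed under
  \<open>\<phi>\<close> and \<open>A \<in> \<A> - S\<close>, the intersection \<open>A \<inter> \<Union>S\<close> is finite. If \<open>K\<^sub>\<A>\<close> is Eberlein, suppose that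
  \<open>A \<inter> \<Union>S\<close> is infinite. The closure of \<open>S\<close> provides coordinates that do not distinguish
  \<open>l\<^sub>A\<close> from \<open>\<infinity>\<close>, but have a cluster functional that on the points of \<open>A \<inter> \<Union>S\<close> agrees with a
  coordinate that does distinguish them; as these points converge weakly to \<open>l\<^sub>A\<close>, this is a
  contradiction. For a projectional skeleton, \<open>\<phi>\<close> is chosen so that \<open>S\<close> gives a projection \<open>P\<close>
  that fixes the values of \<open>1\<^sub>A\<close> on \<open>\<Union>S\<close>, while the functions in its range take the same value at
  \<open>l\<^sub>A\<close> and at \<open>\<infinity>\<close>; as \<open>P 1\<^sub>A\<close> vanishes at \<open>l\<^sub>B\<close> for \<open>B \<in> S\<close>, it vanishes at \<open>\<infinity>\<close> and at \<open>l\<^sub>A\<close>, so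
  that it cannot be \<open>1\<close> on an infinite subset of \<open>A\<close>.\<close>

section \<open>Almost disjoint families that are disjoint modulo finite sets\<close>

unbundle cardinal_syntax

text \<open>The operation \<phi> takes finite arguments so that closed sets are stable under unions
  of chains, whatever the cofinality. In the induction, S is well-ordered in the type of its
  cardinal; the hulls of its initial segments form a chain of smaller closed sets. A member A that
  enters at some stage meets the union of all earlier hulls, which is closed, in a finite set.
  Removing this set, together with the finite set that the hull of the stage prescribes for A, makes
  S disjoint. Testing countable S suffices because A is countable: an infinite part of A inside the
  union of S is covered by countably many members of S.

  With a skeleton the obstacle is that its projections are not assumed to be uniformly bounded,
  while limits along chains require such a bound. Countable directedness yields cofinally many
  members with a common bound, and the chains are built from these. Point functions have to be
  treated before the functions \<open>set_function A\<close>: finitely many members of \<A> are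
  disjoint only up to finitely many points, so the estimate for them requires a functional that
  vanishes on point functions.\<close>

lemma almost_disjoint_countableD:
  assumes "almost_disjoint_countable \<A>" "A \<in> \<A>"
  shows "countable A" "infinite A" "\<And>B. \<lbrakk>B \<in> \<A>; A \<noteq> B\<rbrakk> \<Longrightarrow> finite (A \<inter> B)"
proof -
  show "countable A" "infinite A" using assms by (simp_all add: almost_disjoint_countable_def)
  have "pairwise (\<lambda>A B. finite (A \<inter> B)) \<A>" using assms(1) by (simp add: almost_disjoint_countable_def)
  then show "finite (A \<inter> B)" if "B \<in> \<A>" "A \<noteq> B" for B
    using that by (rule pairwiseD[OF _ assms(2)])
qed

abbreviation disjoint_off :: "('a set \<Rightarrow> 'a set) \<Rightarrow> 'a set set \<Rightarrow> bool" where
  "disjoint_off F \<A> \<equiv> (\<forall>A\<in>\<A>. finite (F A)) \<and> (\<forall>A\<in>\<A>. \<forall>B\<in>\<A>. A \<noteq> B \<longrightarrow> (A - F A) \<inter> (B - F B) = {})"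

definition essentially_disjoint :: "'a set set \<Rightarrow> bool" where
  "essentially_disjoint \<A> \<longleftrightarrow> (\<exists>F. disjoint_off F \<A>)"

text \<open>A point lies in at most one reduced set \<open>A - F A\<close>; it is assigned to that
  A, and to any member containing it if there is none. Hence the points of A assigned elsewhere all
  lie in \<open>F A\<close>. The selector \<open>c\<close> is the form in which disjointness enters
  the explicit formulas.\<close>

lemma essentially_disjoint_selector:
  assumes "essentially_disjoint \<A>"
  obtains c where "\<And>x. x \<in> \<Union>\<A> \<Longrightarrow> c x \<in> \<A> \<and> x \<in> c x" "\<And>A. A \<in> \<A> \<Longrightarrow> finite {x\<in>A. c x \<noteq> A}"
proof -
  from assms obtain F where F': "disjoint_off F \<A>" unfolding essentially_disjoint_def ..
  have F: "finite (F A)" if "A \<in> \<A>" for A using F' that by simp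
  have F_disj: "(A - F A) \<inter> (B - F B) = {}" if "A \<in> \<A>" "B \<in> \<A>" "A \<noteq> B" for A B
    using F' that by simp
  have "\<exists>A. x \<in> \<Union>\<A> \<longrightarrow> A \<in> \<A> \<and> x \<in> A \<and> (\<forall>B\<in>\<A>. x \<in> B - F B \<longrightarrow> A = B)" for x
  proof (cases "\<exists>B\<in>\<A>. x \<in> B - F B")
    case True
    then obtain B where "B \<in> \<A>" "x \<in> B - F B" by blast
    then have "\<forall>C\<in>\<A>. x \<in> C - F C \<longrightarrow> B = C" using F_disj[of B] by blast
    then show ?thesis using \<open>B \<in> \<A>\<close> \<open>x \<in> B - F B\<close> by blast
  next
    case False
    then show ?thesis by blast
  qed
  then have "\<forall>x. \<exists>A. x \<in> \<Union>\<A> \<longrightarrow> A \<in> \<A> \<and> x \<in> A \<and> (\<forall>B\<in>\<A>. x \<in> B - F B \<longrightarrow> A = B)" ..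
  from choice[OF this] obtain c where
    c: "\<forall>x. x \<in> \<Union>\<A> \<longrightarrow> c x \<in> \<A> \<and> x \<in> c x \<and> (\<forall>B\<in>\<A>. x \<in> B - F B \<longrightarrow> c x = B)" ..
  show ?thesis
  proof
    show "finite {x\<in>A. c x \<noteq> A}" if "A \<in> \<A>" for A
      using that c by (intro finite_subset[OF _ F[OF that]]) blast
  qed (use c in blast)
qed

text \<open>In an enumeration, each member has finitely many predecessors and meets each of them in
  a finite set; these intersections are removed.\<close>

lemma essentially_disjoint_countable:
  assumes ad: "almost_disjoint_countable \<A>" and S: "countable S" "S \<subseteq> \<A>"
  shows "essentially_disjoint S"
proof -
  define F where "F A = A \<inter> \<Union>{B\<in>S. to_nat_on S B < to_nat_on S A}" for A
  have inj: "inj_on (to_nat_on S) S" using S(1) by (rule inj_on_to_nat_on)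
  have "finite (F A)" if A: "A \<in> S" for A
  proof -
    have "finite (to_nat_on S ` {B\<in>S. to_nat_on S B < to_nat_on S A})"
      by (rule finite_subset[of _ "{..<to_nat_on S A}"]) auto
    then have "finite {B\<in>S. to_nat_on S B < to_nat_on S A}"
      by (rule finite_imageD) (rule inj_on_subset[OF inj], auto)
    moreover have "finite (A \<inter> B)" if "B \<in> S" "to_nat_on S B < to_nat_on S A" for B
      using almost_disjoint_countableD(3)[OF ad, of A B] that A S(2) by auto
    ultimately show ?thesis unfolding F_def Int_Union by (intro finite_UN_I) auto
  qed
  moreover have "(A - F A) \<inter> (B - F B) = {}" if "A \<in> S" "B \<in> S" "A \<noteq> B" for A B
  proof -
    have "to_nat_on S A \<noteq> to_nat_on S B" using inj that by (auto dest: inj_onD)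
    then consider "to_nat_on S A < to_nat_on S B" | "to_nat_on S B < to_nat_on S A" by linarith
    then show ?thesis using that(1,2) unfolding F_def by cases auto
  qed
  ultimately show ?thesis unfolding essentially_disjoint_def by blast
qed

section \<open>Sets closed under a finitary operation, and the induction on cardinality\<close>

lemma countable_iff_card_of: "countable A \<longleftrightarrow> |A| \<le>o |UNIV :: nat set|"
  by (simp add: countable_def flip: card_of_ordLeq)

lemma finite_subset_incseq_Union:
  fixes U :: "nat \<Rightarrow> 'b set"
  assumes "incseq U" "finite s" "s \<subseteq> (\<Union>n. U n)"
  obtains n where "s \<subseteq> U n"
proof -
  have "\<exists>n. s \<subseteq> U n"
    using assms(2,3)
  proof (induction s)
    case (insert x s)
    then obtain m n where "x \<in> U m" "s \<subseteq> U n" by auto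
    then have "insert x s \<subseteq> U (max m n)"
      using incseqD[OF assms(1), of m "max m n"] incseqD[OF assms(1), of n "max m n"] by auto
    then show ?case by blast
  qed simp
  then show thesis using that by blast
qed

definition closed_under :: "('b set \<Rightarrow> 'b set) \<Rightarrow> 'b set \<Rightarrow> bool" where
  "closed_under \<phi> S \<longleftrightarrow> (\<forall>s. finite s \<and> s \<subseteq> S \<longrightarrow> \<phi> s \<subseteq> S)"

lemma closed_under_hull: "closed_under \<phi> (closed_under \<phi> hull T)"
  by (rule hull_in) (fastforce simp: closed_under_def)

text \<open>Countably many rounds reach the hull because a finite subset of the union already lies
  in one round, and a round does not exceed \<open>|B|\<close> because an infinite set has as many
  finite subsets as elements. The bound B has a type of its own, so that it can be
  \<open>nat\<close> as well as an initial segment enlarged by \<open>nat\<close>.\<close>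

lemma card_of_closed_under_hull:
  fixes \<phi> :: "'b set \<Rightarrow> 'b set" and B :: "'c set"
  assumes \<phi>: "\<And>s. finite s \<Longrightarrow> countable (\<phi> s)" and B: "infinite B" and T: "|T| \<le>o |B|"
  shows "|closed_under \<phi> hull T| \<le>o |B|"
proof -
  define U where "U = rec_nat T (\<lambda>_ V. V \<union> \<Union>(\<phi> ` Fpow V))"
  have U0: "U 0 = T" and US: "U (Suc n) = U n \<union> \<Union>(\<phi> ` Fpow (U n))" for n
    by (simp_all add: U_def)
  have mono: "U m \<subseteq> U n" if "m \<le> n" for m n
    by (rule lift_Suc_mono_le[OF _ that]) (simp add: US)
  have natB: "|UNIV :: nat set| \<le>o |B|" using B infinite_iff_card_of_nat by blast
  have U: "|U n| \<le>o |B|" for n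
  proof (induction n)
    case (Suc n)
    then obtain f where f: "inj_on f (U n)" "f ` U n \<subseteq> B" by (auto simp flip: card_of_ordLeq)
    have "|Fpow (U n)| \<le>o |Fpow B|"
      using inj_on_image_Fpow[OF f(1)] image_Fpow_mono[OF f(2)] by (auto simp flip: card_of_ordLeq)
    also have "|Fpow B| =o |B|" using eqpoll_Fpow[OF B] eqpoll_iff_card_of_ordIso by blast
    finally have "|Fpow (U n)| \<le>o |B|" .
    moreover have "|\<phi> s| \<le>o |B|" if "s \<in> Fpow (U n)" for s
      using \<phi>[of s] that countable_iff_card_of ordLeq_transitive[OF _ natB] by (auto simp: Fpow_def)
    ultimately have "|\<Union>(\<phi> ` Fpow (U n))| \<le>o |B|"
      using card_of_UNION_ordLeq_infinite[OF B] by blast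
    then show ?case unfolding US by (rule card_of_Un_ordLeq_infinite[OF B Suc])
  qed (simp add: U0 T)
  have "closed_under \<phi> (\<Union>n. U n)"
    unfolding closed_under_def
  proof (intro allI impI, elim conjE)
    fix s assume s: "finite s" "s \<subseteq> (\<Union>n. U n)"
    then obtain n where "s \<subseteq> U n"
      using finite_subset_incseq_Union[of U s] mono by (metis incseq_def)
    then have "\<phi> s \<subseteq> U (Suc n)" using s(1) by (auto simp: US Fpow_def)
    then show "\<phi> s \<subseteq> (\<Union>n. U n)" by blast
  qed
  then have "closed_under \<phi> hull T \<subseteq> (\<Union>n. U n)"
    by (rule hull_minimal[rotated]) (use U0 in blast)
  moreover have "|\<Union>n. U n| \<le>o |B|"
    using card_of_UNION_ordLeq_infinite[OF B natB] U by blast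
  ultimately show ?thesis using card_of_mono1 ordLeq_transitive by blast
qed

lemma countable_closed_under_hull:
  assumes "\<And>s. finite s \<Longrightarrow> countable (\<phi> s)" "countable T"
  shows "countable (closed_under \<phi> hull T)"
proof -
  have "|closed_under \<phi> hull T| \<le>o |UNIV :: nat set|"
  proof (rule card_of_closed_under_hull)
    show "|T| \<le>o |UNIV :: nat set|" using assms(2) countable_iff_card_of by blast
  qed (simp_all add: assms(1))
  then show ?thesis using countable_iff_card_of by blast
qed

text \<open>One member of S for each point of \<open>A \<inter> \<Union>S\<close>, together with an
  infinite countable part of S, generates a countable closed subset of S that covers the same points
  of A. A finite S is settled by almost disjointness, so \<open>good\<close> may assume S infinite;
  the argument for skeletons relies on this.\<close>

lemma finite_Int_Union_closed:
  assumes ad: "almost_disjoint_countable \<A>"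
    and \<phi>: "\<And>s. finite s \<Longrightarrow> countable (\<phi> s)"
    and good: "\<And>S A. \<lbrakk>countable S; infinite S; S \<subseteq> \<A>; closed_under \<phi> S; A \<in> \<A> - S\<rbrakk> \<Longrightarrow> finite (A \<inter> \<Union>S)"
    and S: "S \<subseteq> \<A>" "closed_under \<phi> S" and A: "A \<in> \<A> - S"
  shows "finite (A \<inter> \<Union>S)"
proof (cases "finite S")
  case True
  have "finite (A \<inter> B)" if "B \<in> S" for B
    using almost_disjoint_countableD(3)[OF ad, of A B] that A S(1) by blast
  then show ?thesis using True unfolding Int_Union by (intro finite_UN_I) auto
next
  case False
  then obtain S0 where S0: "S0 \<subseteq> S" "countable S0" "infinite S0"
    using infinite_countable_subset'[of S] by blast
  have "\<forall>x\<in>\<Union>S. \<exists>B. B \<in> S \<and> x \<in> B" by blast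
  from bchoice[OF this] obtain b where b: "\<And>x. x \<in> \<Union>S \<Longrightarrow> b x \<in> S \<and> x \<in> b x" by blast
  define T where "T = S0 \<union> b ` (A \<inter> \<Union>S)"
  have "countable A" using ad A by (auto simp: almost_disjoint_countable_def)
  then have T: "countable T" "T \<subseteq> S" using S0 b by (auto simp: T_def)
  let ?S = "closed_under \<phi> hull T"
  have sub: "?S \<subseteq> S" using T(2) S(2) by (rule hull_minimal)
  have "finite (A \<inter> \<Union>?S)"
  proof (rule good)
    show "countable ?S" using \<phi> T(1) by (rule countable_closed_under_hull)
    show "infinite ?S" using S0(3) hull_subset[of T "closed_under \<phi>"] unfolding T_def
      by (meson infinite_super le_sup_iff)
  qed (use sub S A closed_under_hull in auto)
  moreover have "A \<inter> \<Union>S \<subseteq> A \<inter> \<Union>?S"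
    using b hull_subset[of T "closed_under \<phi>"] unfolding T_def by blast
  ultimately show ?thesis by (rule finite_subset[rotated])
qed

theorem essentially_disjoint_if_closed_good:
  fixes \<A> :: "'a set set"
  assumes ad: "almost_disjoint_countable \<A>"
    and \<phi>: "\<And>s. finite s \<Longrightarrow> countable (\<phi> s)" "\<And>s. \<phi> s \<subseteq> \<A>"
    and good: "\<And>S A. \<lbrakk>countable S; infinite S; S \<subseteq> \<A>; closed_under \<phi> S; A \<in> \<A> - S\<rbrakk> \<Longrightarrow> finite (A \<inter> \<Union>S)"
  shows "essentially_disjoint \<A>"
proof -
  have "S \<subseteq> \<A> \<Longrightarrow> closed_under \<phi> S \<Longrightarrow> essentially_disjoint S" for S
  proof (induction S rule: wf_induct_rule[OF wf_inv_image[OF wf_ordLess, of card_of]])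
    case (1 S)
    show ?case
    proof (cases "countable S")
      case True
      then show ?thesis using essentially_disjoint_countable[OF ad _ 1(2)] by blast
    next
      case False
      then have inf: "infinite S" using countable_finite by blast
      have natS: "|UNIV :: nat set| <o |S|"
        using False by (simp add: countable_iff_card_of not_ordLeq_iff_ordLess)
      define r where "r = |S|"
      have r: "Card_order r" "Field r = S" "Well_order r" by (simp_all add: r_def)
      then have wf: "wf (r - Id)" and tr: "trans r" and as: "antisym r" and rf: "refl_on S r"
        and tot: "total_on S r"
        by (auto simp: well_order_on_def linear_order_on_def partial_order_on_def preorder_on_def)
      define V where "V a = closed_under \<phi> hull (under r a)" for a
      have V_closed: "closed_under \<phi> (V a)" for a unfolding V_def by (rule closed_under_hull)
      have VS: "V a \<subseteq> S" for a
        unfolding V_def using 1(3) by (intro hull_minimal) (auto simp: under_def r(2)[symmetric] Field_def)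
      have V_mono: "V a \<subseteq> V b" if "(a, b) \<in> r" for a b
        unfolding V_def using that tr by (intro hull_mono) (auto simp: under_def dest: transD)
      have V_self: "a \<in> V a" if "a \<in> S" for a
        using that rf hull_subset[of "under r a" "closed_under \<phi>"] unfolding V_def under_def
        by (auto dest: refl_onD)
      have V_ed: "essentially_disjoint (V a)" if a: "a \<in> S" for a
      proof (rule "1.IH")
        \<comment> \<open>The summand \<open>nat\<close> makes the bound infinite, since the hull of
          a finite segment may be infinite. The sum stays below \<open>|S|\<close> because S is
          uncountable here.\<close>
        let ?B = "underS r a <+> (UNIV :: nat set)"
        have "|underS r a| <o |S|" using card_of_underS[OF r(1), of a] a r(2) r_def by simp
        then have B: "|?B| <o |S|" using card_of_Plus_ordLess_infinite[OF inf _ natS] by blast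
        have "inj_on (\<lambda>b. if b = a then Inr 0 else Inl b) (under r a)" by (auto simp: inj_on_def)
        moreover have "(\<lambda>b. if b = a then Inr 0 else Inl b) ` under r a \<subseteq> ?B"
          by (auto simp: under_def underS_def)
        ultimately have "|under r a| \<le>o |?B|" using card_of_ordLeq by blast
        moreover have "infinite ?B" by (simp add: finite_Plus_iff)
        ultimately have "|V a| \<le>o |?B|" unfolding V_def by (intro card_of_closed_under_hull \<phi>(1))
        then have "|V a| <o |S|" using B by (rule ordLeq_ordLess_trans)
        then show "(V a, S) \<in> inv_image ordLess card_of" by (simp add: in_inv_image)
        show "V a \<subseteq> \<A>" using VS 1(2) by blast
      qed (rule V_closed)
      then have "\<forall>a\<in>S. \<exists>F. disjoint_off F (V a)"
        unfolding essentially_disjoint_def by blast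
      from bchoice[OF this] obtain G where G':
        "\<forall>a\<in>S. disjoint_off (G a) (V a)" ..
      have G: "finite (G a A)" if "a \<in> S" "A \<in> V a" for a A
        using G' that by simp
      have G_disj: "(A - G a A) \<inter> (B - G a B) = {}" if "a \<in> S" "A \<in> V a" "B \<in> V a" "A \<noteq> B" for a A B
        using G' that by simp
      have "\<exists>a. A \<in> S \<longrightarrow> a \<in> S \<and> A \<in> V a \<and> (\<forall>b. (b, a) \<in> r - Id \<longrightarrow> A \<notin> V b)" for A
      proof (cases "A \<in> S")
        case True
        then have "A \<in> {a\<in>S. A \<in> V a}" using V_self by blast
        then obtain a where "a \<in> {a\<in>S. A \<in> V a}" "\<And>b. (b, a) \<in> r - Id \<Longrightarrow> b \<notin> {a\<in>S. A \<in> V a}"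
          by (rule wfE_min[OF wf]) blast
        moreover have "b \<in> S" if "(b, a) \<in> r - Id" for b a using that r(2) by (auto simp: Field_def)
        ultimately show ?thesis by blast
      qed blast
      then have "\<forall>A. \<exists>a. A \<in> S \<longrightarrow> a \<in> S \<and> A \<in> V a \<and> (\<forall>b. (b, a) \<in> r - Id \<longrightarrow> A \<notin> V b)" ..
      from choice[OF this] obtain i where
        i': "\<forall>A. A \<in> S \<longrightarrow> i A \<in> S \<and> A \<in> V (i A) \<and> (\<forall>b. (b, i A) \<in> r - Id \<longrightarrow> A \<notin> V b)" ..
      have i: "i A \<in> S" "A \<in> V (i A)" "(b, i A) \<in> r - Id \<Longrightarrow> A \<notin> V b" if "A \<in> S" for A b
        using i' that by simp_all
      define W where "W a = \<Union>(V ` underS r a)" for a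
      have W: "finite (A \<inter> \<Union>(W (i A)))" if A: "A \<in> S" for A
      proof (cases "underS r (i A) = {}")
        case False
        have "closed_under \<phi> (W (i A))"
          unfolding closed_under_def
        proof (intro allI impI, elim conjE)
          fix s assume s: "finite s" "s \<subseteq> W (i A)"
          have "subset.chain UNIV (V ` underS r (i A))"
            unfolding subset_chain_def
          proof (intro conjI ballI)
            fix P Q assume "P \<in> V ` underS r (i A)" "Q \<in> V ` underS r (i A)"
            then obtain a b where ab: "P = V a" "Q = V b" "a \<in> S" "b \<in> S"
              by (auto simp: underS_def r(2)[symmetric] Field_def)
            then show "P \<subseteq> Q \<or> Q \<subseteq> P"
              using tot V_mono unfolding total_on_def by (metis order_refl)
          qed simp
          then obtain P where "P \<in> V ` underS r (i A)" "s \<subseteq> P"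
            using finite_subset_Union_chain[of s "V ` underS r (i A)" UNIV] s False
            unfolding W_def by (metis image_is_empty)
          then show "\<phi> s \<subseteq> W (i A)"
            using V_closed s(1) unfolding W_def closed_under_def by blast
        qed
        moreover have "A \<notin> W (i A)" using i(3)[OF A] by (auto simp: W_def underS_def)
        moreover have "W (i A) \<subseteq> \<A>" unfolding W_def using VS 1(2) by blast
        ultimately show ?thesis
          using A 1(2) by (intro finite_Int_Union_closed[OF ad \<phi>(1) good]) auto
      qed (simp add: W_def)
      define F where "F A = (A \<inter> \<Union>(W (i A))) \<union> G (i A) A" for A
      have less: "(A - F A) \<inter> (B - F B) = {}" if "A \<in> S" "B \<in> S" "(i A, i B) \<in> r - Id" for A B
      proof -
        have "A \<in> W (i B)" using that(3) i(2)[OF that(1)] by (auto simp: W_def underS_def)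
        then show ?thesis unfolding F_def by blast
      qed
      have "(A - F A) \<inter> (B - F B) = {}" if "A \<in> S" "B \<in> S" "A \<noteq> B" for A B
      proof (cases "i A = i B")
        case True
        then have "(A - G (i A) A) \<inter> (B - G (i B) B) = {}" using True
          G_disj[OF i(1)[OF that(1)] i(2)[OF that(1)] _ that(3)] i(2)[OF that(2)] by simp
        then show ?thesis unfolding F_def by blast
      next
        case False
        then have "(i A, i B) \<in> r - Id \<or> (i B, i A) \<in> r - Id"
          using tot i(1) that unfolding total_on_def by simp
        then show ?thesis using less[OF that(1,2)] less[OF that(2,1)] by blast
      qed
      moreover have "finite (F A)" if "A \<in> S" for A
        using W[OF that] G[OF i(1)[OF that] i(2)[OF that]] by (simp add: F_def)
      ultimately show ?thesis unfolding essentially_disjoint_def by (intro exI[of _ F]) simp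
    qed
  qed
  moreover have "closed_under \<phi> \<A>" using \<phi>(2) by (simp add: closed_under_def)
  ultimately show ?thesis by simp
qed

section \<open>Disjointifiability as disjointness modulo finite sets\<close>

lemma family_algebra_subsetI:
  assumes "\<Union>\<A> = \<Union>\<B>" "\<A> \<subseteq> family_algebra \<B>"
  shows "family_algebra \<A> \<subseteq> family_algebra \<B>"
  unfolding family_algebra_def[of \<A>]
proof (rule hull_minimal)
  show "\<A> \<union> {F. finite F \<and> F \<subseteq> \<Union>\<A>} \<subseteq> family_algebra \<B>"
    using assms family_algebra_superset(2)[of _ \<B>] by auto
  show "algebra (\<Union>\<A>) (family_algebra \<B>)"
    using algebra_family_algebra[of \<B>] assms(1) by simp
qed

lemma family_algebra_modify:
  assumes "A \<in> family_algebra \<A>" "finite F" "F \<subseteq> \<Union>\<A>"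
  shows "A \<union> F \<in> family_algebra \<A>" "A - F \<in> family_algebra \<A>"
proof -
  interpret algebra "\<Union>\<A>" "family_algebra \<A>" by (rule algebra_family_algebra)
  show "A \<union> F \<in> family_algebra \<A>" "A - F \<in> family_algebra \<A>"
    using assms family_algebra_superset(2)[of F \<A>] by (simp_all add: Un Diff)
qed

text \<open>Finite sets belong to the algebra, so a finite change of the generators does not change
  it. The points assigned to A form \<open>B A\<close>, which differs from A by a finite set, and
  the identity is the required isomorphism.\<close>

lemma disjointifiable_if_essentially_disjoint:
  assumes ad: "almost_disjoint_countable \<A>" and ed: "essentially_disjoint \<A>"
  shows "disjointifiable \<A>"
proof -
  obtain c where c: "\<And>x. x \<in> \<Union>\<A> \<Longrightarrow> c x \<in> \<A> \<and> x \<in> c x"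
    and fin: "\<And>A. A \<in> \<A> \<Longrightarrow> finite {x\<in>A. c x \<noteq> A}"
    using essentially_disjoint_selector[OF ed] by blast
  define B where "B A = {x\<in>A. c x = A}" for A
  have B: "B A = A - {x\<in>A. c x \<noteq> A}" "A = B A \<union> {x\<in>A. c x \<noteq> A}" for A
    by (auto simp: B_def)
  have "x \<in> B (c x)" if "x \<in> \<Union>\<A>" for x
    using c[OF that] by (simp add: B_def)
  moreover have "B A \<subseteq> A" for A by (auto simp: B_def)
  ultimately have UB: "\<Union>(B ` \<A>) = \<Union>\<A>" using c by blast
  have "B A \<in> family_algebra \<A>" if "A \<in> \<A>" for A
    unfolding B(1)[of A] using that family_algebra_superset(1)[of \<A>]
    by (intro family_algebra_modify fin) auto
  then have "family_algebra (B ` \<A>) \<subseteq> family_algebra \<A>"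
    by (intro family_algebra_subsetI UB) blast
  moreover have "A \<in> family_algebra (B ` \<A>)" if A: "A \<in> \<A>" for A
  proof -
    have "B A \<union> {x\<in>A. c x \<noteq> A} \<in> family_algebra (B ` \<A>)"
      using A family_algebra_superset(1)[of "B ` \<A>"] UB
      by (intro family_algebra_modify fin) auto
    then show ?thesis using B(2)[of A] by simp
  qed
  then have "family_algebra \<A> \<subseteq> family_algebra (B ` \<A>)"
    by (intro family_algebra_subsetI UB[symmetric]) blast
  ultimately have "family_algebra (B ` \<A>) = family_algebra \<A>" by (rule subset_antisym)
  then have "equivalent_families \<A> (B ` \<A>)"
    unfolding equivalent_families_def isomorphic_algebras_def UB
    by (intro exI[of _ id]) auto
  moreover have "disjoint_countable (B ` \<A>)"
    unfolding disjoint_countable_def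
  proof (intro conjI ballI)
    fix C assume "C \<in> B ` \<A>"
    then obtain A where A: "A \<in> \<A>" "C = B A" by blast
    have "countable A" "infinite A" using almost_disjoint_countableD[OF ad A(1)] by auto
    then show "countable C" "infinite C"
      using fin[OF A(1)] unfolding A(2) B(1)[of A] by (auto simp: Diff_infinite_finite)
  next
    show "pairwise disjnt (B ` \<A>)"
      unfolding pairwise_def disjnt_def B_def by auto
  qed
  ultimately show ?thesis unfolding disjointifiable_def by blast
qed

text \<open>An isomorphism preserves inclusion and hence atoms, and the atoms of an algebra
  containing all singletons are the singletons. So it is induced by a map of points, which makes
  finiteness of sets visible on both sides of an equivalence.\<close>

lemma isomorphic_algebras_point_map:
  assumes iso: "isomorphic_algebras X M Y N" and M: "algebra X M" and N: "algebra Y N"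
    and Msing: "\<And>x. x \<in> X \<Longrightarrow> {x} \<in> M" and Nsing: "\<And>y. y \<in> Y \<Longrightarrow> {y} \<in> N"
  obtains h where "inj_on h X" "(`) h ` M = N"
proof -
  obtain f where f: "bij_betw f M N"
    and f_hom: "\<forall>S\<in>M. \<forall>T\<in>M. f (S \<union> T) = f S \<union> f T \<and> f (S \<inter> T) = f S \<inter> f T"
    using iso unfolding isomorphic_algebras_def by (elim exE conjE)
  have MX: "S \<subseteq> X" and NY: "T \<subseteq> Y" if "S \<in> M" "T \<in> N" for S T
    using M N that by (auto simp: algebra_iff_Un)
  have M0: "{} \<in> M" and N0: "{} \<in> N" using M N by (auto simp: algebra_iff_Un)
  have surj: "\<exists>S\<in>M. f S = T" if "T \<in> N" for T
    using f that unfolding bij_betw_def by (metis imageE)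
  have into: "f S \<in> N" if "S \<in> M" for S using f that by (auto simp: bij_betw_def)
  have inj: "S = T" if "S \<in> M" "T \<in> M" "f S = f T" for S T
    using f that by (auto simp: bij_betw_def dest: inj_onD)
  have sub: "S \<subseteq> T \<longleftrightarrow> f S \<subseteq> f T" if "S \<in> M" "T \<in> M" for S T
    using f_hom that inj[of "S \<inter> T" S] M unfolding algebra_iff_Int by (metis inf.orderE inf.cobounded2)
  have f0: "f {} = {}"
    using surj[OF N0] sub[OF M0] by blast
  have atom: "\<exists>x\<in>X. T = {x}" if T: "T \<in> M" "f T = {y}" for T y
  proof -
    obtain x where x: "x \<in> T" using T f0 by fastforce
    then have "x \<in> X" "{x} \<in> M" using MX[OF T(1) N0] Msing by auto
    have "f {x} \<subseteq> {y}" using sub[OF \<open>{x} \<in> M\<close> T(1)] x T(2) by simp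
    moreover have "f {x} \<noteq> {}" using inj[OF \<open>{x} \<in> M\<close> M0] unfolding f0 by blast
    ultimately have "f {x} = f T" unfolding T(2) by (simp add: subset_singleton_iff)
    then have "T = {x}" using inj[OF T(1) \<open>{x} \<in> M\<close>] by simp
    then show ?thesis using \<open>x \<in> X\<close> by blast
  qed
  have point: "\<exists>x\<in>S. f {x} = {y}" if S: "S \<in> M" "y \<in> f S" for S y
  proof -
    have "{y} \<in> N" using NY[OF S(1) into[OF S(1)]] S(2) Nsing by blast
    then obtain T where T: "T \<in> M" "f T = {y}" using surj by blast
    then obtain x where "T = {x}" using atom by blast
    moreover have "T \<subseteq> S" using sub[OF T(1) S(1)] T(2) S(2) by simp
    ultimately show ?thesis using T by auto
  qed
  have "\<exists>y. f {x} = {y}" if x: "x \<in> X" for x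
  proof -
    have "f {x} \<noteq> {}" using inj[OF Msing[OF x] M0] unfolding f0 by blast
    then show ?thesis using point[OF Msing[OF x]] by blast
  qed
  then obtain h where h: "\<And>x. x \<in> X \<Longrightarrow> f {x} = {h x}" by metis
  have image: "f S = h ` S" if S: "S \<in> M" for S
  proof (intro subset_antisym subsetI)
    fix y assume "y \<in> f S"
    then obtain x where "x \<in> S" "f {x} = {y}" using point[OF S] by blast
    then show "y \<in> h ` S" using h[of x] MX[OF S N0] by auto
  next
    fix y assume "y \<in> h ` S"
    then obtain x where x: "x \<in> S" "y = h x" by blast
    then have "x \<in> X" using MX[OF S N0] by blast
    then show "y \<in> f S" using sub[OF Msing S, of x] h[of x] x by auto
  qed
  show thesis
  proof
    show "inj_on h X"
      by (rule inj_onI) (metis Msing inj h singleton_inject)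
    show "(`) h ` M = N"
      using image f unfolding bij_betw_def by (metis image_cong)
  qed
qed

text \<open>Sets whose trace on B is finite or cofinite in B form an algebra, so it is enough to
  look at the generators.\<close>

lemma family_algebra_trace:
  assumes B: "B \<in> \<A>" and fin: "\<And>C. \<lbrakk>C \<in> \<A>; C \<noteq> B\<rbrakk> \<Longrightarrow> finite (B \<inter> C)" and S: "S \<in> family_algebra \<A>"
  shows "finite (B \<inter> S) \<or> finite (B - S)"
proof -
  define Z where "Z = {S. S \<subseteq> \<Union>\<A> \<and> (finite (B \<inter> S) \<or> finite (B - S))}"
  have "family_algebra \<A> \<subseteq> Z"
    unfolding family_algebra_def
  proof (rule hull_minimal)
    show "\<A> \<union> {F. finite F \<and> F \<subseteq> \<Union>\<A>} \<subseteq> Z"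
      unfolding Z_def using fin by (auto simp: Int_commute) (metis Diff_cancel finite.emptyI)
    have "B \<inter> (\<Union>\<A> - S) = B - S" "B - (\<Union>\<A> - S) = B \<inter> S" for S using B by auto
    moreover have "finite (B \<inter> (S \<union> T)) \<or> finite (B - (S \<union> T))"
      if "S \<in> Z" "T \<in> Z" for S T
    proof -
      have "B \<inter> (S \<union> T) = (B \<inter> S) \<union> (B \<inter> T)" "B - (S \<union> T) = (B - S) \<inter> (B - T)" by auto
      then show ?thesis using that unfolding Z_def by auto
    qed
    ultimately show "algebra (\<Union>\<A>) Z"
      unfolding algebra_iff_Un by (auto simp: Z_def)
  qed
  then show ?thesis using S by (auto simp: Z_def)
qed

text \<open>The sets that are finite or cofinite outside finitely many members form an algebra
  containing the generators. If S met every member in a finite set, the first alternative would make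
  S finite; under the second, any member not among the finitely many would be almost contained in S,
  so these are all the members and S is again finite.\<close>

lemma family_algebra_infinite_meets:
  assumes B: "pairwise disjnt \<B>" "\<And>B. B \<in> \<B> \<Longrightarrow> infinite B" and S: "S \<in> family_algebra \<B>" "infinite S"
  shows "\<exists>B\<in>\<B>. infinite (S \<inter> B)"
proof (rule ccontr)
  assume "\<not> ?thesis"
  then have fin: "finite (S \<inter> B)" if "B \<in> \<B>" for B using that by blast
  define Y where "Y = \<Union>\<B>"
  define Z where "Z = {S. S \<subseteq> Y \<and> (\<exists>\<G>. finite \<G> \<and> \<G> \<subseteq> \<B> \<and> (finite (S - \<Union>\<G>) \<or> finite (Y - S - \<Union>\<G>)))}"
  have "family_algebra \<B> \<subseteq> Z"
    unfolding family_algebra_def Y_def[symmetric]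
  proof (rule hull_minimal)
    show "\<B> \<union> {F. finite F \<and> F \<subseteq> Y} \<subseteq> Z"
    proof
      fix T assume "T \<in> \<B> \<union> {F. finite F \<and> F \<subseteq> Y}"
      then consider "T \<in> \<B>" | "finite T" "T \<subseteq> Y" by blast
      then show "T \<in> Z"
      proof cases
        case 1
        then show ?thesis unfolding Z_def Y_def by (auto intro!: exI[of _ "{T}"])
      next
        case 2
        then show ?thesis unfolding Z_def by (auto intro!: exI[of _ "{}"])
      qed
    qed
    have compl: "Y - S \<in> Z" if "S \<in> Z" for S
    proof -
      have "Y - (Y - S) = S" using that by (auto simp: Z_def)
      then show ?thesis using that unfolding Z_def by (auto simp: Z_def)
    qed
    moreover have "S \<union> T \<in> Z" if ST: "S \<in> Z" "T \<in> Z" for S T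
    proof -
      obtain \<G> \<H> where G: "finite \<G>" "\<G> \<subseteq> \<B>" "finite (S - \<Union>\<G>) \<or> finite (Y - S - \<Union>\<G>)"
        and H: "finite \<H>" "\<H> \<subseteq> \<B>" "finite (T - \<Union>\<H>) \<or> finite (Y - T - \<Union>\<H>)"
        using ST unfolding Z_def by auto
      have "finite (S \<union> T - \<Union>(\<G> \<union> \<H>)) \<or> finite (Y - (S \<union> T) - \<Union>(\<G> \<union> \<H>))"
      proof (cases "finite (S - \<Union>\<G>) \<and> finite (T - \<Union>\<H>)")
        case True
        then have "finite ((S - \<Union>\<G>) \<union> (T - \<Union>\<H>))" by simp
        then have "finite (S \<union> T - \<Union>(\<G> \<union> \<H>))" by (rule finite_subset[rotated]) auto
        then show ?thesis ..
      next
        case False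
        then have "finite (Y - S - \<Union>\<G>) \<or> finite (Y - T - \<Union>\<H>)" using G(3) H(3) by blast
        then show ?thesis
        proof
          assume "finite (Y - S - \<Union>\<G>)"
          then have "finite (Y - (S \<union> T) - \<Union>(\<G> \<union> \<H>))" by (rule finite_subset[rotated]) auto
          then show ?thesis ..
        next
          assume "finite (Y - T - \<Union>\<H>)"
          then have "finite (Y - (S \<union> T) - \<Union>(\<G> \<union> \<H>))" by (rule finite_subset[rotated]) auto
          then show ?thesis ..
        qed
      qed
      moreover have "finite (\<G> \<union> \<H>)" "\<G> \<union> \<H> \<subseteq> \<B>" "S \<union> T \<subseteq> Y" using G H ST by (auto simp: Z_def)
      ultimately show ?thesis unfolding Z_def by blast
    qed
    moreover have "{} \<in> Z" unfolding Z_def by auto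
    ultimately show "algebra Y Z"
      unfolding algebra_iff_Un by (auto simp: Z_def)
  qed
  then obtain \<G> where G: "finite \<G>" "\<G> \<subseteq> \<B>" "finite (S - \<Union>\<G>) \<or> finite (Y - S - \<Union>\<G>)" and "S \<subseteq> Y"
    using S(1) by (auto simp: Z_def)
  have "finite (\<Union>B\<in>\<G>. S \<inter> B)" using G(1,2) fin by (intro finite_UN_I) auto
  then have finG: "finite (S \<inter> \<Union>\<G>)" unfolding Int_Union .
  have "finite (S - \<Union>\<G>)"
  proof (cases "finite (S - \<Union>\<G>)")
    case False
    then have fin': "finite (Y - S - \<Union>\<G>)" using G(3) by blast
    have "\<B> \<subseteq> \<G>"
    proof
      fix B assume BB: "B \<in> \<B>"
      show "B \<in> \<G>"
      proof (rule ccontr)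
        assume "B \<notin> \<G>"
        then have "B \<inter> C = {}" if "C \<in> \<G>" for C
          using pairwiseD[OF B(1) BB, of C] that G(2) unfolding disjnt_def by blast
        then have "B \<inter> \<Union>\<G> = {}" by blast
        then have "B - S \<subseteq> Y - S - \<Union>\<G>" using BB by (auto simp: Y_def)
        then have "finite (B - S)" using fin' by (rule finite_subset)
        moreover have "finite (B \<inter> S)" using fin[OF BB] by (simp add: Int_commute)
        ultimately have "finite (B \<inter> S \<union> (B - S))" by simp
        then show False using B(2)[OF BB] by (simp add: Int_Diff_Un)
      qed
    qed
    then have "Y \<subseteq> \<Union>\<G>" unfolding Y_def by (rule Union_mono)
    then have "S - \<Union>\<G> = {}" using \<open>S \<subseteq> Y\<close> by blast
    then show ?thesis by (metis finite.emptyI)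
  qed simp
  then have "finite (S \<inter> \<Union>\<G> \<union> (S - \<Union>\<G>))" using finG by simp
  then show False using S(2) by (simp add: Int_Diff_Un)
qed

text \<open>Each image \<open>h\<close> A\<open>has an infinite intersection with some\<close>b
  A\<open>of the disjoint family, and the trace dichotomy, used in both algebras, shows that the two
  differ by a finite set. If\<close>b A = b A'\<open>, this infinite set would be almost contained
  in the finite set\<close>h \<open>(A \<inter> A')\<close>; so distinct A have disjoint
  \<open>b A\<close>, and it suffices to remove from A the points sent outside
  \<open>b A\<close>.\<close>

lemma essentially_disjoint_if_disjointifiable:
  assumes ad: "almost_disjoint_countable \<A>" and d: "disjointifiable \<A>"
  shows "essentially_disjoint \<A>"
proof -
  obtain \<B> :: "'a set set" where B: "disjoint_countable \<B>" and eq: "equivalent_families \<A> \<B>"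
    using d unfolding disjointifiable_def by blast
  have Bdisj: "pairwise disjnt \<B>" and Binf: "\<And>B. B \<in> \<B> \<Longrightarrow> infinite B"
    using B by (auto simp: disjoint_countable_def)
  obtain h where h: "inj_on h (\<Union>\<A>)" "(`) h ` family_algebra \<A> = family_algebra \<B>"
  proof (rule isomorphic_algebras_point_map[OF eq[unfolded equivalent_families_def]])
    show "\<And>x. x \<in> \<Union>\<A> \<Longrightarrow> {x} \<in> family_algebra \<A>" "\<And>y. y \<in> \<Union>\<B> \<Longrightarrow> {y} \<in> family_algebra \<B>"
      by (auto intro: family_algebra_superset)
  qed (auto intro: algebra_family_algebra)
  have sub: "S \<subseteq> \<Union>\<A>" if "S \<in> family_algebra \<A>" for S
    using that algebra_family_algebra[of \<A>] by (auto simp: algebra_iff_Un)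
  have fin_iff: "finite (h ` S) \<longleftrightarrow> finite S" if "S \<subseteq> \<Union>\<A>" for S
    using h(1) that by (meson finite_image_iff inj_on_subset)
  have AinB: "h ` A \<in> family_algebra \<B>" if "A \<in> \<A>" for A
    using that h(2) family_algebra_superset(1)[of \<A>] by blast
  have traceB: "finite (B - h ` A)" if A: "A \<in> \<A>" and BB: "B \<in> \<B>" "infinite (h ` A \<inter> B)" for A B
  proof -
    have "finite (B \<inter> h ` A) \<or> finite (B - h ` A)"
    proof (rule family_algebra_trace[OF BB(1) _ AinB[OF A]])
      show "finite (B \<inter> C)" if "C \<in> \<B>" "C \<noteq> B" for C
        using pairwiseD[OF Bdisj BB(1) that(1)] that(2) unfolding disjnt_def by auto
    qed
    then show ?thesis using BB(2) by (simp add: Int_commute)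
  qed
  have traceA: "finite (h ` A - B)" if A: "A \<in> \<A>" and BB: "B \<in> \<B>" "infinite (h ` A \<inter> B)" for A B
  proof -
    have "B \<in> (`) h ` family_algebra \<A>" using h(2) BB(1) family_algebra_superset(1)[of \<B>] by blast
    then obtain S where S: "S \<in> family_algebra \<A>" "B = h ` S" by blast
    have AX: "A \<subseteq> \<Union>\<A>" using A by blast
    have "finite (A \<inter> S) \<or> finite (A - S)"
      using almost_disjoint_countableD(3)[OF ad A] by (intro family_algebra_trace[OF A _ S(1)]) auto
    moreover have "h ` (A \<inter> S) = h ` A \<inter> B" "h ` (A - S) = h ` A - B"
      using inj_on_image_Int[OF h(1) AX sub[OF S(1)]] inj_on_image_set_diff[OF h(1), of A S]
        AX sub[OF S(1)] unfolding S(2) by auto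
    ultimately show ?thesis using BB(2) by (metis finite_imageI)
  qed
  have "\<exists>B\<in>\<B>. infinite (h ` A \<inter> B)" if A: "A \<in> \<A>" for A
  proof (rule family_algebra_infinite_meets[OF Bdisj Binf AinB[OF A]])
    show "infinite (h ` A)" using fin_iff[of A] A almost_disjoint_countableD(2)[OF ad A] by blast
  qed
  then have "\<forall>A\<in>\<A>. \<exists>B. B \<in> \<B> \<and> infinite (h ` A \<inter> B)" by blast
  from bchoice[OF this] obtain b where
    b: "\<forall>A\<in>\<A>. b A \<in> \<B> \<and> infinite (h ` A \<inter> b A)" ..
  have b_inj: "b A \<noteq> b A'" if "A \<in> \<A>" "A' \<in> \<A>" "A \<noteq> A'" for A A'
  proof
    assume eq: "b A = b A'"
    have "b A \<in> \<B> \<and> infinite (h ` A \<inter> b A)" "b A' \<in> \<B> \<and> infinite (h ` A' \<inter> b A')"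
      using bspec[OF b that(1)] bspec[OF b that(2)] by simp_all
    then have "finite (b A - h ` A)" "finite (b A - h ` A')"
      using traceB[OF that(1), of "b A"] traceB[OF that(2), of "b A'"] unfolding eq by simp_all
    moreover have "b A \<subseteq> (b A - h ` A) \<union> (b A - h ` A') \<union> h ` (A \<inter> A')"
      using inj_on_image_Int[OF h(1), of A A'] that by (auto simp: Union_upper)
    moreover have "finite (A \<inter> A')" using almost_disjoint_countableD(3)[OF ad] that by blast
    ultimately have "finite (b A)" by (meson finite_Un finite_imageI finite_subset)
    then show False using Binf b that by blast
  qed
  define F where "F A = {x\<in>A. h x \<notin> b A}" for A
  have "finite (F A)" if A: "A \<in> \<A>" for A
  proof -
    have "h ` F A \<subseteq> h ` A - b A" by (auto simp: F_def)
    then have "finite (h ` F A)"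
      by (rule finite_subset) (use traceA[OF A] b A in simp)
    then show ?thesis using fin_iff[of "F A"] A by (auto simp: F_def)
  qed
  moreover have "(A - F A) \<inter> (A' - F A') = {}" if "A \<in> \<A>" "A' \<in> \<A>" "A \<noteq> A'" for A A'
  proof -
    have "b A \<inter> b A' = {}" using pairwiseD[OF Bdisj _ _ b_inj[OF that]] b that unfolding disjnt_def by blast
    then show ?thesis unfolding F_def by blast
  qed
  ultimately show ?thesis unfolding essentially_disjoint_def by (intro exI[of _ F]) simp
qed

section \<open>The topology of the compact space\<close>

abbreviation val :: "('i discrete \<Rightarrow>\<^sub>C real) \<Rightarrow> 'i \<Rightarrow> real" where
  "val f i \<equiv> apply_bcontfun f (discrete i)"

definition bfun :: "('i \<Rightarrow> real) \<Rightarrow> 'i discrete \<Rightarrow>\<^sub>C real" where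
  "bfun g = Bcontfun (\<lambda>d. g (of_discrete d))"

lemma val_bfun:
  assumes "\<And>i. \<bar>g i\<bar> \<le> B"
  shows "val (bfun g) i = g i"
proof -
  have "(\<lambda>d. g (of_discrete d)) \<in> bcontfun"
    by (rule bcontfun_normI[where b = B])
       (simp_all add: continuous_on_open_vimage open_discrete assms)
  then show ?thesis by (simp add: bfun_def Bcontfun_inverse discrete_inverse)
qed

lemma val_le_norm: "\<bar>val f i\<bar> \<le> norm f"
  using norm_bounded[of f "discrete i"] by simp

lemma norm_le_val: "(\<And>i. \<bar>val f i\<bar> \<le> B) \<Longrightarrow> norm f \<le> B"
  by (rule norm_bound) (metis of_discrete_inverse real_norm_def)

lemma bcontfun_discrete_eqI: "(\<And>i. val f i = val g i) \<Longrightarrow> f = g"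
  by (rule bcontfun_eqI) (metis of_discrete_inverse)

lemma val_sum: "val (sum f I) i = (\<Sum>j\<in>I. val (f j) i)"
  by (induction I rule: infinite_finite_induct) auto

abbreviation limit_nbhd :: "'a set \<Rightarrow> 'a kpoint set" where
  "limit_nbhd A \<equiv> insert (Limit A) (Point ` A)"

lemma K_points_simps [simp]:
  "Point x \<in> K_points \<A> \<longleftrightarrow> x \<in> \<Union>\<A>" "Limit A \<in> K_points \<A> \<longleftrightarrow> A \<in> \<A>" "Infinity \<in> K_points \<A>"
  by (auto simp: K_points_def)

abbreviation continuous_on_K :: "'a set set \<Rightarrow> ('a kpoint \<Rightarrow> real) \<Rightarrow> bool" where
  "continuous_on_K \<A> f \<equiv> continuous_map (K_space \<A>) euclideanreal f"

abbreviation CK :: "'a set set \<Rightarrow> ('a kpoint discrete \<Rightarrow>\<^sub>C real) set" where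
  "CK \<A> \<equiv> C_space (K_space \<A>)"

text \<open>Almost disjointness enters at the neighborhoods of \<open>Infinity\<close>: a remaining
  \<open>Limit B\<close> loses only finitely many points of B to the finitely many removed
  sets.\<close>

lemma openin_K_basic_nhd:
  assumes ad: "almost_disjoint_countable \<A>" and p: "p \<in> K_points \<A>" and N: "N \<in> K_basic_nhds \<A> p"
  shows "openin (K_space \<A>) N" "p \<in> N"
proof -
  show "p \<in> N" using N p by (cases p) auto
  have pts: "\<exists>M\<in>K_basic_nhds \<A> (Point x). M \<subseteq> N" if "Point x \<in> N" for x using that by auto
  let ?open = "N \<subseteq> K_points \<A> \<and> (\<forall>p\<in>N. \<exists>M\<in>K_basic_nhds \<A> p. M \<subseteq> N)"
  show "openin (K_space \<A>) N"
    unfolding openin_K_space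
  proof (cases p)
    case (Point x)
    then show ?open using N p by auto
  next
    case (Limit A)
    then obtain F where F: "finite F" "N = insert (Limit A) (Point ` (A - F))" using N by auto
    then have "\<exists>M\<in>K_basic_nhds \<A> (Limit A). M \<subseteq> N" by auto
    then show ?open
      using pts p unfolding F(2) Limit by auto
  next
    case Infinity
    then obtain \<F> where F: "finite \<F>" "\<F> \<subseteq> \<A>" "N = K_points \<A> - (\<Union>A\<in>\<F>. limit_nbhd A)"
      using N by auto
    have "\<exists>M\<in>K_basic_nhds \<A> q. M \<subseteq> N" if q: "q \<in> N" for q
    proof (cases q)
      case (Limit B)
      then have B: "B \<in> \<A>" "B \<notin> \<F>" using q F(3) by auto
      have "finite (\<Union>A\<in>\<F>. B \<inter> A)"
        using almost_disjoint_countableD(3)[OF ad B(1)] B(2) F(1,2) by (intro finite_UN_I) auto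
      then have "insert (Limit B) (Point ` (B - (\<Union>A\<in>\<F>. B \<inter> A))) \<in> K_basic_nhds \<A> q"
        using Limit by auto
      moreover have "insert (Limit B) (Point ` (B - (\<Union>A\<in>\<F>. B \<inter> A))) \<subseteq> N"
        using B F(3) by auto
      ultimately show ?thesis by blast
    next
      case Infinity
      then show ?thesis using N \<open>p = Infinity\<close> by blast
    qed (use pts q in simp)
    then show ?open using F(3) by simp
  qed
qed

lemma continuous_map_K_space_iff_nhds:
  fixes f :: "'a kpoint \<Rightarrow> real"
  assumes ad: "almost_disjoint_countable \<A>"
  shows "continuous_on_K \<A> f \<longleftrightarrow>
    (\<forall>p\<in>K_points \<A>. \<forall>e>0. \<exists>N\<in>K_basic_nhds \<A> p. \<forall>q\<in>N. \<bar>f q - f p\<bar> < e)"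
proof -
  have "continuous_on_K \<A> f \<longleftrightarrow>
    (\<forall>p\<in>K_points \<A>. \<forall>e>0. \<exists>U. openin (K_space \<A>) U \<and> p \<in> U \<and> (\<forall>q\<in>U. \<bar>f q - f p\<bar> < e))"
    using Met_TC.continuous_map_to_metric[of "K_space \<A>" f]
    by (simp add: topspace_K_space dist_real_def abs_minus_commute)
  also have "\<dots> \<longleftrightarrow> (\<forall>p\<in>K_points \<A>. \<forall>e>0. \<exists>N\<in>K_basic_nhds \<A> p. \<forall>q\<in>N. \<bar>f q - f p\<bar> < e)"
  proof (intro ball_cong refl all_cong)
    fix p and e :: real assume p: "p \<in> K_points \<A>"
    show "(\<exists>U. openin (K_space \<A>) U \<and> p \<in> U \<and> (\<forall>q\<in>U. \<bar>f q - f p\<bar> < e)) \<longleftrightarrow>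
        (\<exists>N\<in>K_basic_nhds \<A> p. \<forall>q\<in>N. \<bar>f q - f p\<bar> < e)"
      using openin_K_basic_nhd[OF ad p] unfolding openin_K_space[of \<A>] by (meson subsetD)
  qed
  finally show ?thesis .
qed

text \<open>Isolated points impose no condition. What remains is convergence along each A and
  uniform closeness to the value at \<open>Infinity\<close> off finitely many members.\<close>

lemma continuous_map_K_space_iff:
  fixes f :: "'a kpoint \<Rightarrow> real"
  assumes ad: "almost_disjoint_countable \<A>"
  shows "continuous_on_K \<A> f \<longleftrightarrow>
    (\<forall>A\<in>\<A>. \<forall>e>0. finite {x\<in>A. e \<le> \<bar>f (Point x) - f (Limit A)\<bar>}) \<and>
    (\<forall>e>0. \<exists>\<F>. finite \<F> \<and> \<F> \<subseteq> \<A> \<and>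
       (\<forall>p \<in> K_points \<A> - (\<Union>A\<in>\<F>. limit_nbhd A). \<bar>f p - f Infinity\<bar> < e))"
    (is "_ \<longleftrightarrow> ?L \<and> ?I")
proof -
  let ?P = "\<lambda>p e. \<exists>N\<in>K_basic_nhds \<A> p. \<forall>q\<in>N. \<bar>f q - f p\<bar> < e"
  have L: "?P (Limit A) e \<longleftrightarrow> finite {x\<in>A. e \<le> \<bar>f (Point x) - f (Limit A)\<bar>}" if "e > 0" for A e
  proof
    assume "?P (Limit A) e"
    then obtain F where F: "finite F" "\<forall>x\<in>A - F. \<bar>f (Point x) - f (Limit A)\<bar> < e" by auto
    show "finite {x\<in>A. e \<le> \<bar>f (Point x) - f (Limit A)\<bar>}"
      by (rule finite_subset[OF _ F(1)]) (use F(2) in force)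
  next
    let ?F = "{x\<in>A. e \<le> \<bar>f (Point x) - f (Limit A)\<bar>}"
    assume "finite ?F"
    then have "insert (Limit A) (Point ` (A - ?F)) \<in> K_basic_nhds \<A> (Limit A)" by auto
    moreover have "\<forall>q\<in>insert (Limit A) (Point ` (A - ?F)). \<bar>f q - f (Limit A)\<bar> < e"
      using that by (auto simp: not_le)
    ultimately show "?P (Limit A) e" by blast
  qed
  have I: "?P Infinity e \<longleftrightarrow> (\<exists>\<F>. finite \<F> \<and> \<F> \<subseteq> \<A> \<and>
       (\<forall>p \<in> K_points \<A> - (\<Union>A\<in>\<F>. limit_nbhd A). \<bar>f p - f Infinity\<bar> < e))" for e
    by auto
  have "continuous_on_K \<A> f \<longleftrightarrow> (\<forall>p\<in>K_points \<A>. \<forall>e>0. ?P p e)"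
    by (rule continuous_map_K_space_iff_nhds[OF ad])
  also have "\<dots> \<longleftrightarrow> (\<forall>A\<in>\<A>. \<forall>e>0. ?P (Limit A) e) \<and> (\<forall>e>0. ?P Infinity e)"
    unfolding K_points_def by (auto simp del: K_basic_nhds.simps(2,3))
  also have "\<dots> \<longleftrightarrow> ?L \<and> ?I" unfolding I using L by simp
  finally show ?thesis .
qed

text \<open>A covering set around \<open>Infinity\<close> leaves finitely many members with their
  limits, and a covering set around \<open>Limit A\<close> leaves finitely many points of A.\<close>

lemma compact_space_K_space: "compact_space (K_space \<A>)"
  unfolding compact_space_alt topspace_K_space
proof (intro allI impI, elim conjE)
  fix \<U> assume op: "\<forall>U\<in>\<U>. openin (K_space \<A>) U" and cover: "K_points \<A> \<subseteq> \<Union>\<U>"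
  have nhd: "\<exists>U\<in>\<U>. \<exists>N\<in>K_basic_nhds \<A> p. N \<subseteq> U" if p: "p \<in> K_points \<A>" for p
  proof -
    obtain U where "U \<in> \<U>" "p \<in> U" using cover p by blast
    then show ?thesis using op unfolding openin_K_space by blast
  qed
  have fin: "\<exists>\<V>. finite \<V> \<and> \<V> \<subseteq> \<U> \<and> Point ` F \<subseteq> \<Union>\<V>" if "finite F" "F \<subseteq> \<Union>\<A>" for F
  proof -
    have "\<forall>x\<in>F. \<exists>U. U \<in> \<U> \<and> Point x \<in> U"
    proof
      fix x assume "x \<in> F"
      then have "Point x \<in> K_points \<A>" using that(2) by auto
      then show "\<exists>U. U \<in> \<U> \<and> Point x \<in> U" using cover by blast
    qed
    from bchoice[OF this] obtain u where "\<forall>x\<in>F. u x \<in> \<U> \<and> Point x \<in> u x" ..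
    then show ?thesis using that(1) by (intro exI[of _ "u ` F"]) auto
  qed
  have lim: "\<exists>\<V>. finite \<V> \<and> \<V> \<subseteq> \<U> \<and> limit_nbhd A \<subseteq> \<Union>\<V>" if A: "A \<in> \<A>" for A
  proof -
    obtain U F where U: "U \<in> \<U>" "finite F" "insert (Limit A) (Point ` (A - F)) \<subseteq> U"
      using nhd[of "Limit A"] A by auto
    obtain \<V> where "finite \<V>" "\<V> \<subseteq> \<U>" "Point ` (A \<inter> F) \<subseteq> \<Union>\<V>"
      using fin[of "A \<inter> F"] U(2) A by auto
    moreover have eq: "limit_nbhd A = insert (Limit A) (Point ` (A - F)) \<union> Point ` (A \<inter> F)"
      by auto
    ultimately have "limit_nbhd A \<subseteq> U \<union> \<Union>\<V>"
      unfolding eq using U(3) by (intro Un_mono)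
    then have "limit_nbhd A \<subseteq> \<Union>(insert U \<V>)" by simp
    then show ?thesis using U(1) \<open>finite \<V>\<close> \<open>\<V> \<subseteq> \<U>\<close> by (intro exI[of _ "insert U \<V>"]) simp
  qed
  obtain U \<F> where U: "U \<in> \<U>" "finite \<F>" "\<F> \<subseteq> \<A>" "K_points \<A> - (\<Union>A\<in>\<F>. limit_nbhd A) \<subseteq> U"
    using nhd[of Infinity] by auto
  have "\<forall>A\<in>\<F>. \<exists>\<V>. finite \<V> \<and> \<V> \<subseteq> \<U> \<and> limit_nbhd A \<subseteq> \<Union>\<V>"
    using lim U(3) by blast
  from bchoice[OF this] obtain v where
    v: "\<forall>A\<in>\<F>. finite (v A) \<and> v A \<subseteq> \<U> \<and> limit_nbhd A \<subseteq> \<Union>(v A)" ..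
  show "\<exists>\<V>. finite \<V> \<and> \<V> \<subseteq> \<U> \<and> K_points \<A> \<subseteq> \<Union>\<V>"
  proof (intro exI[of _ "insert U (\<Union>(v ` \<F>))"] conjI)
    show "K_points \<A> \<subseteq> \<Union>(insert U (\<Union>(v ` \<F>)))"
    proof
      fix p assume p: "p \<in> K_points \<A>"
      show "p \<in> \<Union>(insert U (\<Union>(v ` \<F>)))"
      proof (cases "p \<in> (\<Union>A\<in>\<F>. limit_nbhd A)")
        case True
        then obtain A where A: "A \<in> \<F>" "p \<in> limit_nbhd A" by (rule UN_E)
        have "limit_nbhd A \<subseteq> \<Union>(v A)" using v A(1) by simp
        then have "p \<in> \<Union>(v A)" using A(2) by (rule subsetD)
        then show ?thesis using A(1) by auto
      next
        case False
        then have "p \<in> U" using U(4) p by (meson DiffI subsetD)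
        then show ?thesis by simp
      qed
    qed
    show "finite (insert U (\<Union>(v ` \<F>)))" using U(2) v by (intro finite.insertI finite_UN_I) simp_all
    show "insert U (\<Union>(v ` \<F>)) \<subseteq> \<U>" using U(1) v by (simp add: UN_subset_iff)
  qed
qed

section \<open>Isomorphism with a space of null functions\<close>

text \<open>The disjoint sum with \<open>nat\<close> represents the cardinal |\<A>| + \<omega>; the
  bijection makes the points of K themselves usable as coordinates of the null functions.\<close>

lemma K_points_bij:
  fixes \<A> :: "'a set set"
  assumes ad: "almost_disjoint_countable \<A>" and ne: "\<A> \<noteq> {}"
  shows "\<exists>\<beta>. bij_betw \<beta> (K_points \<A>) (\<A> <+> (UNIV :: nat set))"
proof -
  let ?\<Gamma> = "\<A> <+> (UNIV :: nat set)"
  have inf: "infinite ?\<Gamma>" by (simp add: finite_Plus_iff)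
  have A: "|\<A>| \<le>o |?\<Gamma>|" by (rule card_of_Plus1)
  have nat: "|UNIV :: nat set| \<le>o |?\<Gamma>|" by (rule card_of_Plus2)
  have "|B| \<le>o |?\<Gamma>|" if "B \<in> \<A>" for B
    using almost_disjoint_countableD(1)[OF ad that] ordLeq_transitive[OF _ nat]
    unfolding countable_iff_card_of by blast
  then have "|\<Union>B\<in>\<A>. B| \<le>o |?\<Gamma>|" by (intro card_of_UNION_ordLeq_infinite[OF inf A] ballI)
  then have P: "|Point ` \<Union>\<A>| \<le>o |?\<Gamma>|" using ordLeq_transitive[OF card_of_image] by simp
  have L: "|Limit ` \<A>| \<le>o |?\<Gamma>|" using ordLeq_transitive[OF card_of_image A] .
  have "|{Infinity :: 'a kpoint}| \<le>o |?\<Gamma>|"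
    using ordLeq_transitive[OF _ nat] countable_iff_card_of[of "{Infinity :: 'a kpoint}"] by simp
  then have le: "|K_points \<A>| \<le>o |?\<Gamma>|"
    unfolding K_points_def by (intro card_of_Un_ordLeq_infinite[OF inf] P L)
  \<comment> \<open>One member already supplies the infinitely many points needed for the summand
    \<open>nat\<close>. For an empty family K would be a single point.\<close>
  obtain A0 where A0: "A0 \<in> \<A>" using ne by blast
  have cA0: "countable A0" "infinite A0" using almost_disjoint_countableD[OF ad A0] by auto
  let ?j = "case_sum Limit (\<lambda>n. Point (from_nat_into A0 n))"
  have "inj_on ?j ?\<Gamma>"
    using bij_betw_imp_inj_on[OF bij_betw_from_nat_into[OF cA0]] by (auto simp: inj_on_def)
  moreover have "?j ` ?\<Gamma> \<subseteq> K_points \<A>"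
    using from_nat_into[OF infinite_imp_nonempty[OF cA0(2)]] A0 by (auto intro!: bexI[of _ A0])
  ultimately have "|?\<Gamma>| \<le>o |K_points \<A>|" using card_of_ordLeq by blast
  then have "|K_points \<A>| =o |?\<Gamma>|" using le by (simp add: ordIso_iff_ordLeq)
  then show ?thesis using card_of_ordIso by blast
qed

lemma C_spaceD:
  assumes "f \<in> CK \<A>"
  shows "continuous_on_K \<A> (val f)" "p \<notin> K_points \<A> \<Longrightarrow> val f p = 0"
  using assms by (auto simp: C_space_def topspace_K_space)

lemma bfun_in_C_space:
  assumes "\<And>p. \<bar>g p\<bar> \<le> B" "continuous_on_K \<A> g" "\<And>p. p \<notin> K_points \<A> \<Longrightarrow> g p = 0"
  shows "bfun g \<in> CK \<A>"
  using assms(2,3) by (simp add: C_space_def topspace_K_space val_bfun[of g, OF assms(1)])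

text \<open>When \<open>c x\<close> is the member of the disjointified family containing \<open>x\<close>, the increments of a
  continuous function along the chains \<open>Infinity\<close>, \<open>Limit (c x)\<close>, \<open>Point x\<close> form a null
  function.\<close>

definition increments :: "('a \<Rightarrow> 'a set) \<Rightarrow> ('a kpoint \<Rightarrow> real) \<Rightarrow> 'a kpoint \<Rightarrow> real" where
  "increments c f p = (case p of
      Point x \<Rightarrow> f (Point x) - f (Limit (c x))
    | Limit A \<Rightarrow> f (Limit A) - f Infinity
    | Infinity \<Rightarrow> f Infinity)"

definition cumulation :: "('a \<Rightarrow> 'a set) \<Rightarrow> ('a kpoint \<Rightarrow> real) \<Rightarrow> 'a kpoint \<Rightarrow> real" where
  "cumulation c g p = (case p of
      Point x \<Rightarrow> g (Point x) + g (Limit (c x)) + g Infinity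
    | Limit A \<Rightarrow> g (Limit A) + g Infinity
    | Infinity \<Rightarrow> g Infinity)"

lemma cumulation_increments: "cumulation c (increments c f) p = f p"
  and increments_cumulation: "increments c (cumulation c g) p = g p"
  by (cases p; simp add: cumulation_def increments_def)+

lemma finite_increments:
  assumes ad: "almost_disjoint_countable \<A>"
    and c: "\<And>x. x \<in> \<Union>\<A> \<Longrightarrow> c x \<in> \<A> \<and> x \<in> c x" "\<And>A. A \<in> \<A> \<Longrightarrow> finite {x\<in>A. c x \<noteq> A}"
    and f: "continuous_on_K \<A> f" and e: "e > 0"
  shows "finite {p\<in>K_points \<A>. e \<le> \<bar>increments c f p\<bar>}"
proof -
  have fA: "finite {x\<in>A. e \<le> \<bar>f (Point x) - f (Limit A)\<bar>}" if "A \<in> \<A>" for A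
    using f e that unfolding continuous_map_K_space_iff[OF ad] by blast
  \<comment> \<open>For a point x outside the exceptional members, \<open>Point x\<close> and
    \<open>Limit (c x)\<close> are both compared with \<open>Infinity\<close>, each at the cost of e
    / 2.\<close>
  have "e / 2 > 0" using e by simp
  then obtain \<F> where F: "finite \<F>" "\<F> \<subseteq> \<A>"
    "\<forall>p\<in>K_points \<A> - (\<Union>A\<in>\<F>. limit_nbhd A). \<bar>f p - f Infinity\<bar> < e / 2"
    using f unfolding continuous_map_K_space_iff[OF ad] by blast
  let ?S = "insert Infinity (Limit ` \<F> \<union>
    Point ` (\<Union>A\<in>\<F>. {x\<in>A. c x \<noteq> A} \<union> {x\<in>A. e \<le> \<bar>f (Point x) - f (Limit A)\<bar>}))"
  have "finite ?S"
    using F(1,2) c(2) fA by (intro finite.insertI finite_UnI finite_imageI finite_UN_I) auto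
  moreover have "{p\<in>K_points \<A>. e \<le> \<bar>increments c f p\<bar>} \<subseteq> ?S"
  proof
    fix p assume "p \<in> {p\<in>K_points \<A>. e \<le> \<bar>increments c f p\<bar>}"
    then have p: "p \<in> K_points \<A>" "e \<le> \<bar>increments c f p\<bar>" by auto
    show "p \<in> ?S"
    proof (cases p)
      case (Limit A)
      have "A \<in> \<F>"
      proof (rule ccontr)
        assume "A \<notin> \<F>"
        then have "\<bar>f p - f Infinity\<bar> < e / 2" using F(3) p(1) Limit by auto
        then show False using p(2) Limit e by (simp add: increments_def)
      qed
      then show ?thesis using Limit by blast
    next
      case (Point x)
      show ?thesis
      proof (cases "x \<in> \<Union>\<F>")
        case True
        then obtain A where A: "A \<in> \<F>" "x \<in> A" by blast
        then have "c x \<noteq> A \<or> e \<le> \<bar>f (Point x) - f (Limit A)\<bar>"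
          using p(2) Point by (auto simp: increments_def)
        then show ?thesis using A Point by blast
      next
        case False
        then have x: "c x \<in> \<A>" "c x \<notin> \<F>" using c(1)[of x] p(1) Point by auto
        have "Point x \<in> K_points \<A> - (\<Union>A\<in>\<F>. limit_nbhd A)" (is ?P)
          and "Limit (c x) \<in> K_points \<A> - (\<Union>A\<in>\<F>. limit_nbhd A)" (is ?L)
          using p(1) False Point x by auto
        have "\<bar>f (Point x) - f Infinity\<bar> < e / 2" "\<bar>f (Limit (c x)) - f Infinity\<bar> < e / 2"
          using bspec[OF F(3) \<open>?P\<close>] bspec[OF F(3) \<open>?L\<close>] by simp_all
        then have "\<bar>f (Point x) - f (Limit (c x))\<bar> < e" by linarith
        then show ?thesis using p(2) Point by (simp add: increments_def)
      qed
    qed simp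
  qed
  ultimately show ?thesis by (rule finite_subset[rotated])
qed

lemma continuous_map_cumulation:
  assumes ad: "almost_disjoint_countable \<A>"
    and c: "\<And>x. x \<in> \<Union>\<A> \<Longrightarrow> c x \<in> \<A> \<and> x \<in> c x" "\<And>A. A \<in> \<A> \<Longrightarrow> finite {x\<in>A. c x \<noteq> A}"
    and g: "\<And>e. e > 0 \<Longrightarrow> finite {p\<in>K_points \<A>. e \<le> \<bar>g p\<bar>}"
  shows "continuous_on_K \<A> (cumulation c g)"
  unfolding continuous_map_K_space_iff[OF ad]
proof (intro conjI ballI allI impI)
  fix A and e :: real assume A: "A \<in> \<A>" and e: "e > 0"
  have "finite (Point -` {p\<in>K_points \<A>. e \<le> \<bar>g p\<bar>})"
    by (intro finite_vimageI g[OF e]) (simp add: inj_def)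
  moreover have "{x\<in>A. e \<le> \<bar>cumulation c g (Point x) - cumulation c g (Limit A)\<bar>} \<subseteq>
     {x\<in>A. c x \<noteq> A} \<union> Point -` {p\<in>K_points \<A>. e \<le> \<bar>g p\<bar>}"
    using A by (auto simp: cumulation_def)
  ultimately show "finite {x\<in>A. e \<le> \<bar>cumulation c g (Point x) - cumulation c g (Limit A)\<bar>}"
    using c(2)[OF A] by (meson finite_UnI finite_subset)
next
  fix e :: real assume e: "e > 0"
  define H where "H = {p\<in>K_points \<A>. e / 2 \<le> \<bar>g p\<bar>}"
  have H: "finite H" unfolding H_def using e by (intro g) simp
  \<comment> \<open>A member is exceptional if its limit has a large value or if a point with a
    large value is assigned to it. For any other point the two summands that distinguish it from
    \<open>Infinity\<close> are both below e / 2.\<close>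
  define \<F> where "\<F> = Limit -` H \<union> c ` (Point -` H)"
  have "finite \<F>" unfolding \<F>_def by (intro finite_UnI finite_imageI finite_vimageI H) (auto simp: inj_def)
  moreover have "\<F> \<subseteq> \<A>"
  proof
    fix A assume "A \<in> \<F>"
    then consider "Limit A \<in> H" | x where "Point x \<in> H" "A = c x" by (auto simp: \<F>_def)
    then show "A \<in> \<A>" using c(1) by cases (auto simp: H_def)
  qed
  moreover have "\<bar>cumulation c g p - cumulation c g Infinity\<bar> < e"
    if p: "p \<in> K_points \<A> - (\<Union>A\<in>\<F>. limit_nbhd A)" for p
  proof (cases p)
    case (Limit A)
    then have "Limit A \<notin> H" using p by (auto simp: \<F>_def)
    then show ?thesis using p Limit e by (auto simp: H_def cumulation_def not_le)
  next
    case (Point x)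
    then have cx: "c x \<in> \<A>" "x \<in> c x" "x \<in> \<Union>\<A>" using c(1)[of x] p by auto
    then have "c x \<notin> \<F>" using p Point by auto
    then have "Limit (c x) \<notin> H" "Point x \<notin> H" by (auto simp: \<F>_def)
    then have "\<bar>g (Limit (c x))\<bar> < e / 2" "\<bar>g (Point x)\<bar> < e / 2" using cx by (auto simp: H_def not_le)
    then show ?thesis using Point by (simp add: cumulation_def)
  qed (use e in \<open>simp add: cumulation_def\<close>)
  ultimately show "\<exists>\<F>. finite \<F> \<and> \<F> \<subseteq> \<A> \<and>
      (\<forall>p\<in>K_points \<A> - (\<Union>A\<in>\<F>. limit_nbhd A). \<bar>cumulation c g p - cumulation c g Infinity\<bar> < e)"
    by blast
qed

text \<open>\<open>increments\<close> and \<open>cumulation\<close> are mutually inverse; \<beta>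
  merely renames coordinates. The norm bounds 2 and 3 are the largest numbers of values combined in
  the two formulas.\<close>

theorem isomorphic_c0_if_essentially_disjoint:
  fixes \<A> :: "'a set set" and \<Gamma> :: "'i set"
  assumes ad: "almost_disjoint_countable \<A>" and ed: "essentially_disjoint \<A>"
    and \<beta>: "bij_betw \<beta> (K_points \<A>) \<Gamma>"
  shows "isomorphic_banach (CK \<A>) (c0_space \<Gamma>)"
proof -
  let ?K = "K_points \<A>"
  obtain c where c: "\<And>x. x \<in> \<Union>\<A> \<Longrightarrow> c x \<in> \<A> \<and> x \<in> c x"
    "\<And>A. A \<in> \<A> \<Longrightarrow> finite {x\<in>A. c x \<noteq> A}"
    using essentially_disjoint_selector[OF ed] by blast
  define \<gamma> where "\<gamma> = inv_into ?K \<beta>"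
  have \<gamma>\<beta>: "\<gamma> (\<beta> p) = p" "\<beta> p \<in> \<Gamma>" if "p \<in> ?K" for p
    using \<beta> that by (auto simp: \<gamma>_def bij_betw_def)
  have \<beta>\<gamma>: "\<beta> (\<gamma> i) = i" "\<gamma> i \<in> ?K" if "i \<in> \<Gamma>" for i
    using \<beta> that by (auto simp: \<gamma>_def bij_betw_def f_inv_into_f inv_into_into)
  have inc_cong: "increments c f p = increments c f' p" if "p \<in> ?K" "\<And>q. q \<in> ?K \<Longrightarrow> f q = f' q" for f f' p
    using that c(1) by (cases p) (auto simp: increments_def)
  have cum_cong: "cumulation c f p = cumulation c f' p" if "p \<in> ?K" "\<And>q. q \<in> ?K \<Longrightarrow> f q = f' q" for f f' p
    using that c(1) by (cases p) (auto simp: cumulation_def)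
  have inc_le: "\<bar>increments c f p\<bar> \<le> 2 * B" if "\<And>q. \<bar>f q\<bar> \<le> B" for f p B
  proof (cases p)
    case (Point x)
    then show ?thesis using that[of "Point x"] that[of "Limit (c x)"] by (simp add: increments_def)
  next
    case (Limit A)
    then show ?thesis using that[of "Limit A"] that[of Infinity] by (simp add: increments_def)
  next
    case Infinity
    then show ?thesis using that[of Infinity] by (simp add: increments_def)
  qed
  have cum_le: "\<bar>cumulation c f p\<bar> \<le> 3 * B" if "\<And>q. \<bar>f q\<bar> \<le> B" for f p B
  proof (cases p)
    case (Point x)
    then show ?thesis using that[of "Point x"] that[of "Limit (c x)"] that[of Infinity] by (simp add: cumulation_def)
  next
    case (Limit A)
    then show ?thesis using that[of "Limit A"] that[of Infinity] by (simp add: cumulation_def)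
  next
    case Infinity
    then show ?thesis using that[of Infinity] by (simp add: cumulation_def)
  qed
  define T where "T f = bfun (\<lambda>i. if i \<in> \<Gamma> then increments c (val f) (\<gamma> i) else 0)"
    for f :: "'a kpoint discrete \<Rightarrow>\<^sub>C real"
  define S where "S g = bfun (\<lambda>p. if p \<in> ?K then cumulation c (\<lambda>q. val g (\<beta> q)) p else 0)"
    for g :: "'i discrete \<Rightarrow>\<^sub>C real"
  have T_bd: "\<bar>if i \<in> \<Gamma> then increments c (val f) (\<gamma> i) else 0\<bar> \<le> 2 * norm f" for f i
    using inc_le[OF val_le_norm[of f]] by simp
  have T: "val (T f) i = (if i \<in> \<Gamma> then increments c (val f) (\<gamma> i) else 0)" for f i
    unfolding T_def by (rule val_bfun[OF T_bd])
  have S_bd: "\<bar>if p \<in> ?K then cumulation c (\<lambda>q. val g (\<beta> q)) p else 0\<bar> \<le> 3 * norm g" for g p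
    using cum_le[OF val_le_norm[of g]] by simp
  have S: "val (S g) p = (if p \<in> ?K then cumulation c (\<lambda>q. val g (\<beta> q)) p else 0)" for g p
    unfolding S_def by (rule val_bfun[OF S_bd])
  have T_in: "T f \<in> c0_space \<Gamma>" if f: "f \<in> CK \<A>" for f
    unfolding c0_space_def
  proof (intro CollectI conjI allI impI)
    fix e :: real assume e: "e > 0"
    have "{i. e \<le> \<bar>val (T f) i\<bar>} \<subseteq> \<beta> ` {p\<in>?K. e \<le> \<bar>increments c (val f) p\<bar>}"
    proof
      fix i assume "i \<in> {i. e \<le> \<bar>val (T f) i\<bar>}"
      then have "i \<in> \<Gamma>" "e \<le> \<bar>increments c (val f) (\<gamma> i)\<bar>" using e by (auto simp: T split: if_splits)
      then show "i \<in> \<beta> ` {p\<in>?K. e \<le> \<bar>increments c (val f) p\<bar>}"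
        using \<beta>\<gamma>[of i] by (intro image_eqI[of _ _ "\<gamma> i"]) auto
    qed
    moreover have "finite {p\<in>?K. e \<le> \<bar>increments c (val f) p\<bar>}"
      by (rule finite_increments[OF ad c C_spaceD(1)[OF f] e])
    ultimately show "finite {i. e \<le> \<bar>val (T f) i\<bar>}"
      using finite_subset by blast
  qed (simp add: T)
  have S_in: "S g \<in> CK \<A>" if g: "g \<in> c0_space \<Gamma>" for g
  proof -
    have fin: "finite {p\<in>?K. e \<le> \<bar>val g (\<beta> p)\<bar>}" if "e > 0" for e
    proof (rule finite_imageD)
      show "finite (\<beta> ` {p\<in>?K. e \<le> \<bar>val g (\<beta> p)\<bar>})"
        by (rule finite_subset[of _ "{i. e \<le> \<bar>val g i\<bar>}"]) (use g that in \<open>auto simp: c0_space_def\<close>)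
      show "inj_on \<beta> {p\<in>?K. e \<le> \<bar>val g (\<beta> p)\<bar>}"
        using \<beta> by (auto simp: bij_betw_def intro: inj_on_subset)
    qed
    have "continuous_on_K \<A> (cumulation c (\<lambda>q. val g (\<beta> q)))"
      by (intro continuous_map_cumulation[OF ad c] fin)
    then have "continuous_on_K \<A> (\<lambda>p. if p \<in> ?K then cumulation c (\<lambda>q. val g (\<beta> q)) p else 0)"
      by (rule continuous_map_eq) (simp add: topspace_K_space)
    then show ?thesis unfolding S_def by (intro bfun_in_C_space[OF S_bd]) auto
  qed
  have ST: "S (T f) = f" if f: "f \<in> CK \<A>" for f
  proof (rule bcontfun_discrete_eqI)
    fix p
    show "val (S (T f)) p = val f p"
    proof (cases "p \<in> ?K")
      case True
      have "val (S (T f)) p = cumulation c (increments c (val f)) p"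
        using True \<gamma>\<beta> by (auto simp: S T intro: cum_cong)
      then show ?thesis by (simp add: cumulation_increments)
    qed (use C_spaceD(2)[OF f] in \<open>simp add: S\<close>)
  qed
  have TS: "T (S g) = g" if g: "g \<in> c0_space \<Gamma>" for g
  proof (rule bcontfun_discrete_eqI)
    fix i
    show "val (T (S g)) i = val g i"
    proof (cases "i \<in> \<Gamma>")
      case True
      have "val (T (S g)) i = increments c (cumulation c (\<lambda>q. val g (\<beta> q))) (\<gamma> i)"
        using True \<beta>\<gamma> by (auto simp: S T intro: inc_cong)
      then show ?thesis using True \<beta>\<gamma> by (simp add: increments_cumulation)
    qed (use g in \<open>simp add: T c0_space_def\<close>)
  qed
  have T_linear: "T (x + y) = T x + T y" "T (r *\<^sub>R x) = r *\<^sub>R T x" for x y r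
    by (rule bcontfun_discrete_eqI; simp add: T increments_def algebra_simps split: kpoint.split)+
  have S_linear: "S (x + y) = S x + S y" "S (r *\<^sub>R x) = r *\<^sub>R S x" for x y r
    by (rule bcontfun_discrete_eqI; simp add: S cumulation_def algebra_simps split: kpoint.split)+
  have T_norm: "norm (T f) \<le> 2 * norm f" for f
    using T_bd by (intro norm_le_val) (simp add: T)
  have S_norm: "norm (S g) \<le> 3 * norm g" for g
    using S_bd by (intro norm_le_val) (simp add: S)
  have "bounded_linear_on (CK \<A>) (c0_space \<Gamma>) T"
    unfolding bounded_linear_on_def
    by (intro conjI ballI allI image_subsetI exI[of _ 2] T_in T_linear T_norm)
  moreover have "bounded_linear_on (c0_space \<Gamma>) (CK \<A>) S"
    unfolding bounded_linear_on_def
    by (intro conjI ballI allI image_subsetI exI[of _ 3] S_in S_linear S_norm)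
  ultimately show ?thesis
    unfolding isomorphic_banach_def by (intro exI[of _ T] exI[of _ S] conjI ballI ST TS)
qed

section \<open>Unconditional bases\<close>

lemma has_sum_iff_eps:
  fixes f :: "'i \<Rightarrow> 'v::real_normed_vector"
  shows "(f has_sum x) I \<longleftrightarrow>
    (\<forall>e>0. \<exists>F0. finite F0 \<and> F0 \<subseteq> I \<and> (\<forall>F. finite F \<and> F0 \<subseteq> F \<and> F \<subseteq> I \<longrightarrow> norm (sum f F - x) < e))"
  by (simp add: has_sum_def tendsto_iff eventually_finite_subsets_at_top dist_norm)

lemma has_sum_epsD:
  fixes f :: "'i \<Rightarrow> 'v::real_normed_vector"
  assumes "(f has_sum x) I" "e > 0"
  shows "\<exists>F0. finite F0 \<and> F0 \<subseteq> I \<and> (\<forall>F. finite F \<and> F0 \<subseteq> F \<and> F \<subseteq> I \<longrightarrow> norm (sum f F - x) < e)"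
  using assms unfolding has_sum_iff_eps by simp

lemma has_sum_norm_le:
  fixes f :: "'i \<Rightarrow> 'v::real_normed_vector"
  assumes "(f has_sum x) I" "\<And>F. finite F \<Longrightarrow> F \<subseteq> I \<Longrightarrow> norm (sum f F) \<le> B"
  shows "norm x \<le> B"
proof (rule tendsto_upperbound)
  show "((\<lambda>F. norm (sum f F)) \<longlongrightarrow> norm x) (finite_subsets_at_top I)"
    using assms(1) unfolding has_sum_def by (rule tendsto_norm)
  show "\<forall>\<^sub>F F in finite_subsets_at_top I. norm (sum f F) \<le> B"
    using assms(2) by (rule eventually_finite_subsets_at_top_weakI)
qed (rule finite_subsets_at_top_neq_bot)

text \<open>Adding to F the finite set beyond which all sums are within 1 of x changes the sum over
  F by at most the norms of the terms of that set.\<close>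

lemma has_sum_bounded_partial_sums:
  fixes f :: "'i \<Rightarrow> 'v::real_normed_vector"
  assumes "(f has_sum x) I"
  shows "\<exists>B. \<forall>F. finite F \<and> F \<subseteq> I \<longrightarrow> norm (sum f F) \<le> B"
proof -
  obtain F0 where F0': "finite F0 \<and> F0 \<subseteq> I \<and>
      (\<forall>F. finite F \<and> F0 \<subseteq> F \<and> F \<subseteq> I \<longrightarrow> norm (sum f F - x) < 1)"
    using has_sum_epsD[OF assms zero_less_one] ..
  then have F0: "finite F0" "F0 \<subseteq> I" by simp_all
  have "norm (sum f F) \<le> norm x + 1 + (\<Sum>i\<in>F0. norm (f i))" if F: "finite F" "F \<subseteq> I" for F
  proof -
    have "sum f (F \<union> F0) = sum f F + sum f (F0 - F)"
      using F F0 sum.union_disjoint[of F "F0 - F" f] by (simp add: Un_Diff_cancel)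
    then have eq: "sum f F = (sum f (F \<union> F0) - x) + x - sum f (F0 - F)" by simp
    have "norm (sum f F) \<le> norm (sum f (F \<union> F0) - x) + norm x + norm (sum f (F0 - F))"
      unfolding eq by (metis norm_triangle_ineq4 norm_triangle_ineq order_trans add_right_mono)
    moreover have "norm (sum f (F \<union> F0) - x) < 1" using F F0' by simp
    moreover have "norm (sum f (F0 - F)) \<le> (\<Sum>i\<in>F0 - F. norm (f i))" by (rule norm_sum)
    moreover have "\<dots> \<le> (\<Sum>i\<in>F0. norm (f i))" using F0(1) by (intro sum_mono2) auto
    ultimately show ?thesis by linarith
  qed
  then show ?thesis by blast
qed

lemma has_sum_countable_support:
  fixes f :: "'i \<Rightarrow> 'v::real_normed_vector"
  assumes "(f has_sum x) I"
  shows "countable {i\<in>I. f i \<noteq> 0}"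
proof -
  have "finite {i\<in>I. norm (f i) \<ge> e}" if "e > 0" for e
  proof -
    have "e / 2 > 0" using that by simp
    from has_sum_epsD[OF assms this] obtain F0 where F0': "finite F0 \<and> F0 \<subseteq> I \<and>
        (\<forall>F. finite F \<and> F0 \<subseteq> F \<and> F \<subseteq> I \<longrightarrow> norm (sum f F - x) < e / 2)" ..
    then have F0: "finite F0" "F0 \<subseteq> I" by simp_all
    have close: "norm (sum f F - x) < e / 2" if "finite F" "F0 \<subseteq> F" "F \<subseteq> I" for F
      using F0' that by simp
    have "norm (f i) < e" if i: "i \<in> I" "i \<notin> F0" for i
    proof -
      have "norm (sum f (insert i F0) - x) < e / 2" "norm (sum f F0 - x) < e / 2"
        by (rule close; use F0 i in auto)+
      moreover have "f i = (sum f (insert i F0) - x) - (sum f F0 - x)" using F0(1) i by simp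
      ultimately show ?thesis
        using norm_triangle_ineq4[of "sum f (insert i F0) - x" "sum f F0 - x"] by simp
    qed
    then have "{i\<in>I. norm (f i) \<ge> e} \<subseteq> F0" by force
    then show ?thesis using F0(1) finite_subset by blast
  qed
  then have "countable (\<Union>n. {i\<in>I. norm (f i) \<ge> 1 / real (Suc n)})"
    by (intro countable_UN[OF countableI_type] countable_finite) auto
  moreover have "{i\<in>I. f i \<noteq> 0} \<subseteq> (\<Union>n. {i\<in>I. norm (f i) \<ge> 1 / real (Suc n)})"
  proof
    fix i assume "i \<in> {i\<in>I. f i \<noteq> 0}"
    then have "i \<in> I" "norm (f i) > 0" by auto
    then obtain n where "inverse (real (Suc n)) < norm (f i)" using reals_Archimedean by blast
    then show "i \<in> (\<Union>n. {i\<in>I. norm (f i) \<ge> 1 / real (Suc n)})"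
      using \<open>i \<in> I\<close> by (auto simp: inverse_eq_divide intro: less_imp_le)
  qed
  ultimately show ?thesis by (rule countable_subset[rotated])
qed

lemma closed_subspace_has_sum:
  fixes f :: "'i \<Rightarrow> 'v::real_normed_vector"
  assumes "closed E" "subspace E" "\<And>i. i \<in> I \<Longrightarrow> f i \<in> E" "(f has_sum x) I"
  shows "x \<in> E"
proof (rule Lim_in_closed_set[OF assms(1)])
  show "(sum f \<longlongrightarrow> x) (finite_subsets_at_top I)" using assms(4) unfolding has_sum_def .
  show "\<forall>\<^sub>F F in finite_subsets_at_top I. sum f F \<in> E"
    using assms(2,3) by (intro eventually_finite_subsets_at_top_weakI subspace_sum) auto
qed (rule finite_subsets_at_top_neq_bot)

section \<open>Coefficients of a basis and the uniform bound on partial sums\<close>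

locale unconditional_basis_of =
  fixes E :: "'v::banach set" and I :: "'i set" and e :: "'i \<Rightarrow> 'v"
  assumes closed: "closed E" and subspace: "subspace E" and basis: "unconditional_basis E I e"
begin

definition coef :: "'v \<Rightarrow> 'i \<Rightarrow> real" where
  "coef x = (THE a. (\<forall>i. i \<notin> I \<longrightarrow> a i = 0) \<and> ((\<lambda>i. a i *\<^sub>R e i) has_sum x) I)"

definition partial :: "'v \<Rightarrow> 'i set \<Rightarrow> 'v" where
  "partial x F = (\<Sum>i\<in>F. coef x i *\<^sub>R e i)"

lemma e_in: "i \<in> I \<Longrightarrow> e i \<in> E"
  using basis by (auto simp: unconditional_basis_def)

lemma coef:
  assumes "x \<in> E"
  shows "i \<notin> I \<Longrightarrow> coef x i = 0" "((\<lambda>i. coef x i *\<^sub>R e i) has_sum x) I"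
proof -
  have "\<exists>!a. (\<forall>i. i \<notin> I \<longrightarrow> a i = 0) \<and> ((\<lambda>i. a i *\<^sub>R e i) has_sum x) I"
    using basis assms unfolding unconditional_basis_def by blast
  from theI'[OF this] show "i \<notin> I \<Longrightarrow> coef x i = 0" "((\<lambda>i. coef x i *\<^sub>R e i) has_sum x) I"
    unfolding coef_def by blast+
qed

lemma coef_eqI:
  assumes "x \<in> E" "\<And>i. i \<notin> I \<Longrightarrow> a i = 0" "((\<lambda>i. a i *\<^sub>R e i) has_sum x) I"
  shows "coef x = a"
proof -
  have "\<exists>!a. (\<forall>i. i \<notin> I \<longrightarrow> a i = 0) \<and> ((\<lambda>i. a i *\<^sub>R e i) has_sum x) I"
    using basis assms(1) unfolding unconditional_basis_def by blast
  from the1_equality[OF this] show ?thesis using assms(2,3) unfolding coef_def by blast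
qed

lemma coef_inject: "\<lbrakk>x \<in> E; y \<in> E; coef x = coef y\<rbrakk> \<Longrightarrow> x = y"
  using coef(2)[of x] coef(2)[of y] has_sum_unique by metis

lemma coef_add: "x \<in> E \<Longrightarrow> y \<in> E \<Longrightarrow> coef (x + y) = (\<lambda>i. coef x i + coef y i)"
  using has_sum_add[OF coef(2) coef(2), of x y] coef(1)[of x] coef(1)[of y] subspace
  by (intro coef_eqI) (auto simp: scaleR_add_left subspace_add)

lemma coef_scaleR: "x \<in> E \<Longrightarrow> coef (r *\<^sub>R x) = (\<lambda>i. r * coef x i)"
  using has_sum_scaleR[OF coef(2), of x r] coef(1)[of x] subspace
  by (intro coef_eqI) (auto simp: subspace_scale)

lemma coef_diff: "x \<in> E \<Longrightarrow> y \<in> E \<Longrightarrow> coef (x - y) = (\<lambda>i. coef x i - coef y i)"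
  using coef_add[of x "(-1) *\<^sub>R y"] coef_scaleR[of y "-1"] subspace by (simp add: subspace_neg)

lemma coef_0: "coef 0 = (\<lambda>i. 0)"
  using coef_scaleR[of 0 0] subspace_0[OF subspace] by simp

lemma coef_e: "i \<in> I \<Longrightarrow> coef (e i) = (\<lambda>j. if j = i then 1 else 0)"
proof (rule coef_eqI)
  assume i: "i \<in> I"
  show "((\<lambda>j. (if j = i then 1 else 0) *\<^sub>R e j) has_sum e i) I"
    by (rule has_sum_finite_neutralI[of "{i}"]) (use i in auto)
qed (auto intro: e_in)

lemma e_nonzero: "i \<in> I \<Longrightarrow> e i \<noteq> 0"
  using coef_e[of i] coef_0 by (metis zero_neq_one)

lemma partial_in: "F \<subseteq> I \<Longrightarrow> partial x F \<in> E"
  unfolding partial_def by (intro subspace_sum[OF subspace] subspace_scale[OF subspace] e_in) auto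

lemma partial_scaleR: "x \<in> E \<Longrightarrow> partial (r *\<^sub>R x) F = r *\<^sub>R partial x F"
  by (simp add: partial_def coef_scaleR scaleR_sum_right)

lemma partial_diff: "x \<in> E \<Longrightarrow> y \<in> E \<Longrightarrow> partial (x - y) F = partial x F - partial y F"
  by (simp add: partial_def coef_diff scaleR_diff_left sum_subtractf)

lemma partial_add: "x \<in> E \<Longrightarrow> y \<in> E \<Longrightarrow> partial (x + y) F = partial x F + partial y F"
  by (simp add: partial_def coef_add scaleR_add_left sum.distrib)

abbreviation partials_le :: "'v \<Rightarrow> real \<Rightarrow> bool" where
  "partials_le x B \<equiv> \<forall>F. finite F \<and> F \<subseteq> I \<longrightarrow> norm (partial x F) \<le> B"

text \<open>The sets \<open>V n\<close> cover E, so the closure of one of them contains a ball of E;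
  differences move the ball to 0 and double the bound. The coefficients are not yet known to be
  continuous, so \<open>V n\<close> need not be closed, and only an approximation u of x has
  controlled partial sums.\<close>

lemma Baire_partial:
  "\<exists>M>0. \<forall>x\<in>E. \<forall>\<delta>>0. \<exists>u\<in>E. norm (x - u) < \<delta> \<and> partials_le u (M * norm x)"
proof -
  define V where "V n = {x\<in>E. partials_le x (real n)}" for n
  have E: "E = (\<Union>n. V n)"
  proof
    show "E \<subseteq> (\<Union>n. V n)"
    proof
      fix x assume x: "x \<in> E"
      obtain B where B: "partials_le x B"
        using has_sum_bounded_partial_sums[OF coef(2)[OF x]] unfolding partial_def by blast
      obtain n where "B \<le> real n" using real_arch_simple by blast
      then have "x \<in> V n" using B x unfolding V_def by fastforce
      then show "x \<in> (\<Union>n. V n)" by blast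
    qed
  qed (auto simp: V_def)
  let ?X = "top_of_set E"
  have complete: "completely_metrizable_space ?X"
    using closed by (simp add: completely_metrizable_space_closedin completely_metrizable_space_euclidean)
  have nonempty: "?X interior_of \<Union>(range (\<lambda>n. E \<inter> closure (V n))) \<noteq> {}"
  proof -
    have "\<Union>(range (\<lambda>n. E \<inter> closure (V n))) = topspace ?X"
      using E closure_subset by fastforce
    then show ?thesis using subspace_0[OF subspace] by (metis empty_iff interior_of_topspace topspace_euclidean_subtopology)
  qed
  have "\<exists>n. ?X interior_of (E \<inter> closure (V n)) \<noteq> {}"
  proof (rule ccontr)
    assume "\<not> ?thesis"
    then have "?X interior_of \<Union>(range (\<lambda>n. E \<inter> closure (V n))) = {}"
      using complete by (intro Baire_category_alt) (auto simp: closedin_closed_Int)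
    then show False using nonempty by blast
  qed
  then obtain n x0 U where U: "openin ?X U" "x0 \<in> U" "U \<subseteq> closure (V n)"
    by (auto simp: interior_of_def)
  then obtain \<epsilon> where \<epsilon>: "\<epsilon> > 0" "ball x0 \<epsilon> \<inter> E \<subseteq> U"
    by (meson openin_contains_ball)
  have x0: "x0 \<in> E" using U by (meson openin_subset subsetD topspace_euclidean_subtopology openin_imp_subset)
  have small: "\<exists>u\<in>E. norm (x - u) < \<delta> \<and> partials_le u (2 * real n)"
    if x: "x \<in> E" "norm x < \<epsilon>" and \<delta>: "\<delta> > 0" for x \<delta>
  proof -
    have "x0 + x \<in> ball x0 \<epsilon> \<inter> E" using x x0 subspace by (simp add: dist_norm subspace_add)
    then have "x0 + x \<in> closure (V n)" "x0 \<in> closure (V n)" using \<epsilon>(2) U by blast+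
    then obtain u v where u: "u \<in> V n" "dist u (x0 + x) < \<delta> / 2" and v: "v \<in> V n" "dist v x0 < \<delta> / 2"
      using \<delta> by (meson closure_approachable half_gt_zero)
    have uv: "u \<in> E" "v \<in> E" using u v by (auto simp: V_def)
    have "x - (u - v) = (v - x0) - (u - (x0 + x))" by simp
    then have "norm (x - (u - v)) \<le> norm (v - x0) + norm (u - (x0 + x))" by (metis norm_triangle_ineq4)
    then have "norm (x - (u - v)) < \<delta>" using u(2) v(2) by (simp add: dist_norm)
    moreover have "norm (partial (u - v) F) \<le> 2 * real n" if F: "finite F" "F \<subseteq> I" for F
    proof -
      have "norm (partial (u - v) F) \<le> norm (partial u F) + norm (partial v F)"
        unfolding partial_diff[OF uv] by (rule norm_triangle_ineq4)
      moreover have "norm (partial u F) \<le> real n" "norm (partial v F) \<le> real n"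
        using u(1) v(1) F by (auto simp: V_def)
      ultimately show ?thesis by simp
    qed
    ultimately show ?thesis using uv subspace by (blast intro: subspace_diff)
  qed
  \<comment> \<open>Scaling x to norm \<epsilon> / 2, where the bound is 2 n, and scaling back gives
    4 n / \<epsilon>. The summand 1 keeps M positive when n = 0.\<close>
  define M where "M = 4 * real n / \<epsilon> + 1"
  have M: "M > 0" using \<epsilon>(1) by (simp add: M_def add_nonneg_pos)
  have "\<exists>u\<in>E. norm (x - u) < \<delta> \<and> partials_le u (M * norm x)"
    if x: "x \<in> E" and \<delta>: "\<delta> > 0" for x \<delta>
  proof (cases "x = 0")
    case True
    then show ?thesis using x \<delta> by (intro bexI[of _ 0]) (simp_all add: partial_def coef_0)
  next
    case False
    define r where "r = \<epsilon> / (2 * norm x)"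
    have r: "r > 0" "r * norm x = \<epsilon> / 2" using False \<epsilon>(1) by (simp_all add: r_def)
    have "norm (r *\<^sub>R x) < \<epsilon>" using r \<epsilon>(1) by simp
    moreover have "r *\<^sub>R x \<in> E" using x subspace by (simp add: subspace_scale)
    ultimately obtain u where u: "u \<in> E" "norm (r *\<^sub>R x - u) < r * \<delta>"
      "partials_le u (2 * real n)"
      using small[of "r *\<^sub>R x" "r * \<delta>"] r(1) \<delta> by auto
    have "r *\<^sub>R x - u = r *\<^sub>R (x - inverse r *\<^sub>R u)" using r(1) by (simp add: scaleR_diff_right)
    then have "norm (x - inverse r *\<^sub>R u) < \<delta>" using u(2) r(1) by simp
    moreover have "norm (partial (inverse r *\<^sub>R u) F) \<le> M * norm x" if F: "finite F \<and> F \<subseteq> I" for F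
    proof -
      have "norm (partial (inverse r *\<^sub>R u) F) = inverse r * norm (partial u F)"
        using r(1) by (simp add: partial_scaleR[OF u(1)])
      also have "\<dots> \<le> inverse r * (2 * real n)"
        using u(3) F r(1) by (intro mult_left_mono) auto
      also have "\<dots> = 4 * real n / \<epsilon> * norm x" using \<epsilon>(1) False by (simp add: r_def field_simps)
      also have "\<dots> \<le> M * norm x" by (intro mult_right_mono) (simp_all add: M_def)
      finally show ?thesis .
    qed
    ultimately show ?thesis using u(1) subspace by (blast intro: subspace_scale)
  qed
  then show ?thesis using M by blast
qed

text \<open>The open mapping argument: the approximations of \<open>Baire_partial\<close> are summed up to
  an expansion with bounded partial sums, which is the expansion of the given vector.\<close>

lemma partial_bounded:
  obtains M where "M > 0" "\<And>x F. \<lbrakk>x \<in> E; finite F; F \<subseteq> I\<rbrakk> \<Longrightarrow> norm (partial x F) \<le> M * norm x"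
proof -
  obtain M where M': "M > 0 \<and> (\<forall>x\<in>E. \<forall>\<delta>>0.
      \<exists>u\<in>E. norm (x - u) < \<delta> \<and> partials_le u (M * norm x))"
    using Baire_partial ..
  then have M: "M > 0" ..
  have "\<forall>x\<in>E. \<exists>u. u \<in> E \<and> norm (x - u) \<le> norm x / 2 \<and>
      partials_le u (M * norm x)"
  proof
    fix x assume x: "x \<in> E"
    show "\<exists>u. u \<in> E \<and> norm (x - u) \<le> norm x / 2 \<and>
        partials_le u (M * norm x)"
    proof (cases "x = 0")
      case True
      then show ?thesis using x by (intro exI[of _ 0]) (simp add: partial_def coef_0)
    next
      case False
      then have "norm x / 2 > 0" by simp
      then obtain u where "u \<in> E" "norm (x - u) < norm x / 2"
        "partials_le u (M * norm x)"
        using M' x by meson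
      then show ?thesis by (intro exI[of _ u]) simp
    qed
  qed
  from bchoice[OF this] obtain pick where pick:
    "\<forall>x\<in>E. pick x \<in> E \<and> norm (x - pick x) \<le> norm x / 2 \<and>
      partials_le (pick x) (M * norm x)" ..
  have "norm (partial x F) \<le> 2 * M * norm x" if x: "x \<in> E" and F: "finite F" "F \<subseteq> I" for x F
  proof -
    \<comment> \<open>y k is the remainder after k approximations. It is halved at each step, so the
      partial sums of u k are bounded by a geometric sequence, uniformly over the finite sets
      F.\<close>
    define y where "y k = ((\<lambda>y. y - pick y) ^^ k) x" for k
    define u where "u k = pick (y k)" for k
    have y0: "y 0 = x" and yS: "y (Suc k) = y k - u k" for k by (simp_all add: y_def u_def)
    have yE: "y k \<in> E" for k
      by (induction k) (use x pick subspace in \<open>auto simp: y0 yS u_def subspace_diff\<close>)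
    then have uE: "u k \<in> E" for k using pick by (auto simp: u_def)
    have y_norm: "norm (y k) \<le> norm x / 2 ^ k" for k
    proof (induction k)
      case (Suc k)
      have "norm (y (Suc k)) \<le> norm (y k) / 2" using pick yE[of k] by (simp add: yS u_def)
      then show ?case using Suc by simp
    qed (simp add: y0)
    have u_norm: "norm (partial (u k) F) \<le> M * norm x / 2 ^ k" if "finite F" "F \<subseteq> I" for k F
    proof -
      have "norm (partial (u k) F) \<le> M * norm (y k)" using pick yE[of k] that by (simp add: u_def)
      also have "\<dots> \<le> M * (norm x / 2 ^ k)" using y_norm M by (intro mult_left_mono) auto
      finally show ?thesis by simp
    qed
    define b where "b i = suminf (\<lambda>k. coef (u k) i)" for i
    \<comment> \<open>A coefficient is controlled by the partial sum over the single index i, since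
      \<open>e i\<close> is nonzero; the coefficients of u k are thus dominated by a geometric
      series.\<close>
    have coef_sums: "(\<lambda>k. coef (u k) i) sums b i" if i: "i \<in> I" for i
    proof -
      have le: "norm (coef (u k) i) \<le> inverse (norm (e i)) * (M * norm x) * (1/2) ^ k" for k
        using u_norm[of "{i}" k] i e_nonzero[OF i]
        by (simp add: partial_def field_simps power_divide)
      have "summable (\<lambda>k. inverse (norm (e i)) * (M * norm x) * (1/2 :: real) ^ k)"
        by (intro summable_mult summable_geometric) simp
      then have "summable (\<lambda>k. coef (u k) i)"
        by (rule summable_comparison_test'[where N = 0]) (rule le)
      then show ?thesis by (simp add: b_def summable_sums)
    qed
    have coef_partial: "(\<Sum>k<n. coef (u k) i) = coef (x - y n) i" for n i
    proof (induction n)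
      case 0
      then show ?case by (simp add: y0 coef_0)
    next
      case (Suc n)
      have eq: "x - y (Suc n) = (x - y n) + u n" by (simp add: yS)
      have "x - y n \<in> E" using x yE subspace by (simp add: subspace_diff)
      then show ?case using Suc unfolding eq by (simp add: coef_add[OF _ uE])
    qed
    have lim: "(\<lambda>n. partial (x - y n) F) \<longlonglongrightarrow> (\<Sum>i\<in>F. b i *\<^sub>R e i)" if "F \<subseteq> I" for F
      unfolding partial_def
      using coef_sums that unfolding sums_def coef_partial by (intro tendsto_sum tendsto_scaleR) auto
    have partial_step: "norm (partial (x - y m) F - partial (x - y n) F) \<le> 2 * M * norm x / 2 ^ n"
      if F: "finite F" "F \<subseteq> I" and mn: "n \<le> m" for F m n
    proof -
      \<comment> \<open>The sharper telescoping bound is what the induction on m preserves.\<close>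
      have "norm (partial (x - y m) F - partial (x - y n) F) \<le> 2 * M * norm x * (1 / 2 ^ n - 1 / 2 ^ m)"
        using mn
      proof (induction m rule: dec_induct)
        case (step m)
        have eq: "x - y (Suc m) = (x - y m) + u m" by (simp add: yS)
        have "partial (x - y (Suc m)) F = partial (x - y m) F + partial (u m) F"
          unfolding eq using x yE uE subspace by (intro partial_add subspace_diff)
        then have "norm (partial (x - y (Suc m)) F - partial (x - y n) F) \<le>
            norm (partial (x - y m) F - partial (x - y n) F) + norm (partial (u m) F)"
          by (metis add_diff_eq add.commute norm_triangle_ineq diff_add_eq)
        moreover have "2 * M * norm x * (1 / 2 ^ n - 1 / 2 ^ Suc m) =
            2 * M * norm x * (1 / 2 ^ n - 1 / 2 ^ m) + M * norm x / 2 ^ m" by (simp add: field_simps)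
        ultimately show ?case using step.IH u_norm[OF F, of m] by linarith
      qed simp
      also have "\<dots> \<le> 2 * M * norm x * (1 / 2 ^ n)"
        using M by (intro mult_left_mono) auto
      finally show ?thesis by simp
    qed
    have b_partial: "norm ((\<Sum>i\<in>F. b i *\<^sub>R e i) - partial (x - y n) F) \<le> 2 * M * norm x / 2 ^ n"
      if F: "finite F" "F \<subseteq> I" for F n
    proof (rule tendsto_upperbound)
      show "(\<lambda>m. norm (partial (x - y m) F - partial (x - y n) F)) \<longlonglongrightarrow>
          norm ((\<Sum>i\<in>F. b i *\<^sub>R e i) - partial (x - y n) F)"
        by (intro tendsto_norm tendsto_diff lim F(2) tendsto_const)
      show "\<forall>\<^sub>F m in sequentially. norm (partial (x - y m) F - partial (x - y n) F) \<le> 2 * M * norm x / 2 ^ n"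
        using partial_step[OF F] by (rule eventually_sequentiallyI)
    qed simp
    have to_0: "(\<lambda>n. c / 2 ^ n) \<longlonglongrightarrow> 0" for c :: real
      using tendsto_mult_right_zero[OF LIMSEQ_power_zero[of "1/2 :: real"], of c]
      by (simp add: power_divide)
    \<comment> \<open>The bound \<open>b_partial\<close> does not depend on F. So one n can be fixed
      first, and then a finite set F0 from the known expansion of x - y n; the last third of
      \<epsilon> pays for y n.\<close>
    have "((\<lambda>i. b i *\<^sub>R e i) has_sum x) I"
      unfolding has_sum_iff_eps
    proof (intro allI impI)
      fix \<epsilon> :: real assume \<epsilon>: "\<epsilon> > 0"
      have "\<forall>\<^sub>F n in sequentially. 2 * M * norm x / 2 ^ n < \<epsilon> / 3 \<and> norm x / 2 ^ n < \<epsilon> / 3"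
        by (intro eventually_conj order_tendstoD(2)[OF to_0]) (use \<epsilon> in simp_all)
      then obtain n where n: "2 * M * norm x / 2 ^ n < \<epsilon> / 3" "norm x / 2 ^ n < \<epsilon> / 3"
        by (auto simp: eventually_sequentially)
      have "x - y n \<in> E" using x yE subspace by (simp add: subspace_diff)
      then have "((\<lambda>i. coef (x - y n) i *\<^sub>R e i) has_sum (x - y n)) I" by (rule coef(2))
      moreover have "\<epsilon> / 3 > 0" using \<epsilon> by simp
      ultimately obtain F0 where F0: "finite F0 \<and> F0 \<subseteq> I \<and> (\<forall>F. finite F \<and> F0 \<subseteq> F \<and> F \<subseteq> I \<longrightarrow>
          norm (partial (x - y n) F - (x - y n)) < \<epsilon> / 3)"
        unfolding partial_def by (rule has_sum_epsD[THEN exE])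
      have "norm ((\<Sum>i\<in>F. b i *\<^sub>R e i) - x) < \<epsilon>" if F: "finite F" "F0 \<subseteq> F" "F \<subseteq> I" for F
      proof -
        have "(\<Sum>i\<in>F. b i *\<^sub>R e i) - x =
            ((\<Sum>i\<in>F. b i *\<^sub>R e i) - partial (x - y n) F) + (partial (x - y n) F - (x - y n)) - y n"
          by simp
        also have "norm \<dots> \<le> norm ((\<Sum>i\<in>F. b i *\<^sub>R e i) - partial (x - y n) F) +
            norm (partial (x - y n) F - (x - y n)) + norm (y n)"
          by (rule order_trans[OF norm_triangle_ineq4 add_right_mono[OF norm_triangle_ineq]])
        also have "\<dots> < \<epsilon> / 3 + \<epsilon> / 3 + \<epsilon> / 3"
        proof (intro add_strict_mono)
          show "norm ((\<Sum>i\<in>F. b i *\<^sub>R e i) - partial (x - y n) F) < \<epsilon> / 3"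
            using b_partial[OF F(1,3)] n(1) by (rule le_less_trans)
          show "norm (partial (x - y n) F - (x - y n)) < \<epsilon> / 3" using F0 F by simp
          show "norm (y n) < \<epsilon> / 3" using y_norm[of n] n(2) by (rule le_less_trans)
        qed
        finally show ?thesis by simp
      qed
      then show "\<exists>F0. finite F0 \<and> F0 \<subseteq> I \<and>
          (\<forall>F. finite F \<and> F0 \<subseteq> F \<and> F \<subseteq> I \<longrightarrow> norm ((\<Sum>i\<in>F. b i *\<^sub>R e i) - x) < \<epsilon>)"
        using F0 by blast
    qed
    moreover have "b i = 0" if "i \<notin> I" for i
      using coef(1)[OF uE that] by (simp add: b_def)
    \<comment> \<open>By uniqueness b consists of the coefficients of x itself, so the estimate for
      b with n = 0, where x - y 0 = 0, is the desired one.\<close>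
    ultimately have "coef x = b" using x by (intro coef_eqI)
    then show ?thesis
      using b_partial[OF F, of 0] by (simp add: partial_def y0 coef_0)
  qed
  then show thesis using that[of "2 * M"] M by simp
qed

end

section \<open>Coordinate projections and the skeleton of countably supported subspaces\<close>

context unconditional_basis_of
begin

definition restriction :: "'i set \<Rightarrow> 'v \<Rightarrow> 'v" where
  "restriction C x = infsum (\<lambda>i. coef x i *\<^sub>R e i) (C \<inter> I)"

definition supported_on :: "'i set \<Rightarrow> 'v set" where
  "supported_on C = {x\<in>E. \<forall>i. i \<notin> C \<longrightarrow> coef x i = 0}"

lemma restriction:
  assumes x: "x \<in> E"
  shows "restriction C x \<in> E" "coef (restriction C x) = (\<lambda>i. if i \<in> C then coef x i else 0)"
proof -
  have "(\<lambda>i. coef x i *\<^sub>R e i) summable_on I" using coef(2)[OF x] by (auto simp: summable_on_def)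
  then have "(\<lambda>i. coef x i *\<^sub>R e i) summable_on (C \<inter> I)" by (rule summable_on_subset_banach) auto
  then have sum: "((\<lambda>i. coef x i *\<^sub>R e i) has_sum restriction C x) (C \<inter> I)"
    unfolding restriction_def by (rule has_sum_infsum)
  show E: "restriction C x \<in> E"
    by (rule closed_subspace_has_sum[OF closed subspace _ sum])
       (auto intro: subspace_scale[OF subspace] e_in)
  have "((\<lambda>i. (if i \<in> C then coef x i else 0) *\<^sub>R e i) has_sum restriction C x) I \<longleftrightarrow>
      ((\<lambda>i. coef x i *\<^sub>R e i) has_sum restriction C x) (C \<inter> I)"
    by (rule has_sum_cong_neutral) auto
  then show "coef (restriction C x) = (\<lambda>i. if i \<in> C then coef x i else 0)"
    using sum E coef(1)[OF x] by (intro coef_eqI) auto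
qed

lemma restriction_bounded: "\<exists>M. \<forall>x\<in>E. norm (restriction C x) \<le> M * norm x"
proof -
  obtain M where M: "\<And>x F. \<lbrakk>x \<in> E; finite F; F \<subseteq> I\<rbrakk> \<Longrightarrow> norm (partial x F) \<le> M * norm x"
    using partial_bounded by metis
  have "norm (restriction C x) \<le> M * norm x" if x: "x \<in> E" for x
  proof (rule has_sum_norm_le[OF coef(2)[OF restriction(1)[OF x]]])
    fix F assume F: "finite F" "F \<subseteq> I"
    have "(\<Sum>i\<in>F. coef (restriction C x) i *\<^sub>R e i) = partial x (F \<inter> C)"
      unfolding partial_def restriction(2)[OF x] sum.inter_restrict[OF F(1)]
      by (intro sum.cong) auto
    then show "norm (\<Sum>i\<in>F. coef (restriction C x) i *\<^sub>R e i) \<le> M * norm x"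
      using M[OF x, of "F \<inter> C"] F by auto
  qed
  then show ?thesis by blast
qed

lemma restriction_supported: "x \<in> supported_on C \<Longrightarrow> restriction C x = x"
  unfolding supported_on_def by (intro coef_inject) (auto simp: restriction)

lemma restriction_image: "restriction C ` E = supported_on C"
proof
  show "restriction C ` E \<subseteq> supported_on C" by (auto simp: supported_on_def restriction)
  show "supported_on C \<subseteq> restriction C ` E"
  proof
    fix x assume x: "x \<in> supported_on C"
    then have "x \<in> E" by (simp add: supported_on_def)
    then show "x \<in> restriction C ` E" using restriction_supported[OF x] by (metis imageI)
  qed
qed

lemma projection_restriction: "projection_on E (restriction C)"
  unfolding projection_on_def bounded_linear_on_def
proof (intro conjI ballI allI)
  show "restriction C ` E \<subseteq> E" by (auto simp: restriction)
  show "restriction C (x + y) = restriction C x + restriction C y" if "x \<in> E" "y \<in> E" for x y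
    using that subspace_add[OF subspace]
    by (intro coef_inject) (auto simp: restriction coef_add)
  show "restriction C (r *\<^sub>R x) = r *\<^sub>R restriction C x" if "x \<in> E" for x r
    using that subspace_scale[OF subspace]
    by (intro coef_inject) (auto simp: restriction coef_scaleR)
  show "restriction C (restriction C x) = restriction C x" if "x \<in> E" for x
    using that by (intro coef_inject) (auto simp: restriction)
qed (rule restriction_bounded)

lemma supported_on_basis: "C \<subseteq> I \<Longrightarrow> {i\<in>I. e i \<in> supported_on C} = C"
  by (auto simp: supported_on_def coef_e e_in)

lemma supported_on_mono: "C \<subseteq> D \<Longrightarrow> supported_on C \<subseteq> supported_on D"
  by (auto simp: supported_on_def)

lemma partial_close:
  assumes "x \<in> supported_on C" "C \<subseteq> I" "\<epsilon> > 0"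
  obtains F where "finite F" "F \<subseteq> C" "norm (partial x F - x) < \<epsilon>"
proof -
  have x: "x \<in> E" using assms(1) by (simp add: supported_on_def)
  from has_sum_epsD[OF coef(2)[OF x] assms(3)] obtain F0 where F0: "finite F0" "F0 \<subseteq> I"
    "norm (partial x F0 - x) < \<epsilon>" unfolding partial_def by auto
  have "partial x F0 = partial x (F0 \<inter> C)"
    unfolding partial_def using assms(1) F0(1)
    by (intro sum.mono_neutral_right) (auto simp: supported_on_def)
  then show thesis using that[of "F0 \<inter> C"] F0 by auto
qed

lemma subspace_supported_on: "subspace (supported_on C)"
  using subspace_0[OF subspace] subspace_add[OF subspace] subspace_scale[OF subspace]
  by (intro subspaceI) (auto simp: supported_on_def coef_0 coef_add coef_scaleR)

lemma separable_supported_on: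
  assumes C: "countable C" "C \<subseteq> I"
  shows "separable_space (top_of_set (supported_on C))"
proof -
  \<comment> \<open>Finite sets of pairs encode the rational combinations, so countability is that
    of \<open>Fpow\<close>.\<close>
  define D where "D = (\<lambda>s. \<Sum>(i, q)\<in>s. q *\<^sub>R e i) ` Fpow (C \<times> \<rat>)"
  have "countable D"
    unfolding D_def using C(1) countable_rat by (intro countable_image countable_Fpow countable_SIGMA) auto
  moreover have "D \<subseteq> supported_on C"
  proof
    fix y assume "y \<in> D"
    then obtain s where s: "s \<subseteq> C \<times> \<rat>" "y = (\<Sum>(i, q)\<in>s. q *\<^sub>R e i)"
      by (auto simp: D_def Fpow_def)
    have "e i \<in> supported_on C" if "i \<in> C" for i
      using C(2) that by (auto simp: supported_on_def coef_e e_in)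
    then show "y \<in> supported_on C"
      unfolding s(2) using s(1)
      by (intro subspace_sum[OF subspace_supported_on]) (auto intro!: subspace_scale[OF subspace_supported_on])
  qed
  moreover have "supported_on C \<subseteq> closure D"
  proof
    fix x assume x: "x \<in> supported_on C"
    show "x \<in> closure D" unfolding closure_approachable
    proof (intro allI impI)
      fix \<epsilon> :: real assume \<epsilon>: "\<epsilon> > 0"
      have "\<epsilon> / 2 > 0" using \<epsilon> by simp
      then obtain F where F: "finite F" "F \<subseteq> C" "norm (partial x F - x) < \<epsilon> / 2"
        using partial_close[OF x C(2)] by metis
      define B where "B = (\<Sum>i\<in>F. norm (e i)) + 1"
      have B: "B > 0" by (simp add: B_def add_nonneg_pos sum_nonneg)
      have "\<exists>q. q \<in> \<rat> \<and> \<bar>q - coef x i\<bar> < \<epsilon> / (2 * B)" for i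
      proof -
        obtain q where "q \<in> \<rat>" "coef x i - \<epsilon> / (2 * B) < q" "q < coef x i"
          using Rats_dense_in_real[of "coef x i - \<epsilon> / (2 * B)" "coef x i"] \<epsilon> B by auto
        then show ?thesis by (intro exI[of _ q]) simp
      qed
      then have "\<forall>i. \<exists>q. q \<in> \<rat> \<and> \<bar>q - coef x i\<bar> < \<epsilon> / (2 * B)" ..
      from choice[OF this] obtain q where q: "\<forall>i. q i \<in> \<rat> \<and> \<bar>q i - coef x i\<bar> < \<epsilon> / (2 * B)" ..
      let ?s = "(\<lambda>i. (i, q i)) ` F"
      let ?y = "\<Sum>i\<in>F. q i *\<^sub>R e i"
      have "inj_on (\<lambda>i. (i, q i)) F" by (simp add: inj_on_def)
      then have eq: "?y = (\<Sum>(i, q)\<in>?s. q *\<^sub>R e i)" by (simp add: sum.reindex)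
      have "?s \<in> Fpow (C \<times> \<rat>)" using F q by (auto simp: Fpow_def)
      then have "?y \<in> D" unfolding D_def eq by (rule imageI)
      moreover have "dist ?y x < \<epsilon>"
      proof -
        have "?y - partial x F = (\<Sum>i\<in>F. (q i - coef x i) *\<^sub>R e i)"
          by (simp add: partial_def scaleR_diff_left sum_subtractf)
        also have "norm \<dots> \<le> (\<Sum>i\<in>F. norm ((q i - coef x i) *\<^sub>R e i))" by (rule norm_sum)
        also have "\<dots> \<le> (\<Sum>i\<in>F. \<epsilon> / (2 * B) * norm (e i))"
        proof (rule sum_mono)
          fix i
          have "\<bar>q i - coef x i\<bar> \<le> \<epsilon> / (2 * B)" using q by (simp add: less_imp_le)
          then show "norm ((q i - coef x i) *\<^sub>R e i) \<le> \<epsilon> / (2 * B) * norm (e i)"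
            unfolding norm_scaleR by (rule mult_right_mono) simp
        qed
        also have "\<dots> = \<epsilon> / (2 * B) * (B - 1)" by (simp add: B_def sum_distrib_left)
        also have "\<dots> \<le> \<epsilon> / (2 * B) * B" using \<epsilon> B by (intro mult_left_mono) auto
        also have "\<dots> = \<epsilon> / 2" using B by simp
        finally have "norm (?y - partial x F) \<le> \<epsilon> / 2" .
        moreover have "?y - x = (?y - partial x F) + (partial x F - x)" by simp
        then have "norm (?y - x) \<le> norm (?y - partial x F) + norm (partial x F - x)"
          by (metis norm_triangle_ineq)
        ultimately show ?thesis using F(3) by (simp add: dist_norm)
      qed
      ultimately show "\<exists>y\<in>D. dist y x < \<epsilon>" by blast
    qed
  qed
  ultimately show ?thesis
    unfolding separable_space_def
    by (intro exI[of _ D]) (auto simp: closure_of_subtopology Int_absorb1 Int_absorb2)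
qed

text \<open>The supported vectors are the fixed vectors of the bounded map
  \<open>restriction C\<close>, and limits of fixed vectors are fixed.\<close>

lemma closed_supported_on: "closed (supported_on C)"
proof -
  obtain M where M: "\<forall>x\<in>E. norm (restriction C x) \<le> M * norm x" using restriction_bounded by blast
  have "x \<in> supported_on C" if u: "\<And>n. u n \<in> supported_on C" "u \<longlonglongrightarrow> x" for u x
  proof -
    have uE: "u n \<in> E" for n using u(1) by (simp add: supported_on_def)
    have x: "x \<in> E" using closed uE u(2) by (meson closed_sequentially)
    have diff: "restriction C (x - u n) = restriction C x - u n" for n
      using x uE[of n] u(1)[of n] subspace_diff[OF subspace]
      by (intro coef_inject) (auto simp: restriction coef_diff supported_on_def)
    have "(\<lambda>n. restriction C x - u n) \<longlonglongrightarrow> 0"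
    proof (rule Lim_null_comparison)
      show "\<forall>\<^sub>F n in sequentially. norm (restriction C x - u n) \<le> M * norm (x - u n)"
        using M x uE subspace_diff[OF subspace] by (simp flip: diff)
      have "(\<lambda>n. M * norm (x - u n)) \<longlonglongrightarrow> M * norm (x - x)"
        by (intro tendsto_mult tendsto_norm tendsto_diff tendsto_const u(2))
      then show "(\<lambda>n. M * norm (x - u n)) \<longlonglongrightarrow> 0" by simp
    qed
    moreover have "(\<lambda>n. restriction C x - u n) \<longlonglongrightarrow> restriction C x - x"
      by (intro tendsto_diff tendsto_const u(2))
    ultimately have "restriction C x - x = 0" using LIMSEQ_unique by blast
    then have "restriction C x = x" by simp
    then show ?thesis using restriction_image[of C] x by (metis imageI)
  qed
  then show ?thesis unfolding closed_sequential_limits by blast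
qed

text \<open>A partial sum has finite support, which lies in one of the sets \<open>C n\<close>; so
  partial sums approximate from within the union.\<close>

lemma closure_Union_supported_on:
  assumes "incseq C" "\<And>n. C n \<subseteq> I"
  shows "closure (\<Union>n. supported_on (C n)) = supported_on (\<Union>n. C n)"
proof
  show "closure (\<Union>n. supported_on (C n)) \<subseteq> supported_on (\<Union>n. C n)"
    by (intro closure_minimal closed_supported_on UN_least supported_on_mono) auto
  show "supported_on (\<Union>n. C n) \<subseteq> closure (\<Union>n. supported_on (C n))"
  proof
    fix x assume x: "x \<in> supported_on (\<Union>n. C n)"
    have CI: "(\<Union>n. C n) \<subseteq> I" using assms(2) by blast
    show "x \<in> closure (\<Union>n. supported_on (C n))" unfolding closure_approachable
    proof (intro allI impI)
      fix \<epsilon> :: real assume "\<epsilon> > 0"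
      then obtain F where F: "finite F" "F \<subseteq> (\<Union>n. C n)" "norm (partial x F - x) < \<epsilon>"
        using partial_close[OF x CI] by metis
      obtain n where n: "F \<subseteq> C n" using finite_subset_incseq_Union[OF assms(1) F(1,2)] by blast
      have xE: "x \<in> E" using x by (simp add: supported_on_def)
      have FI: "F \<subseteq> I" using F(2) CI by blast
      have "((\<lambda>i. (if i \<in> F then coef x i else 0) *\<^sub>R e i) has_sum partial x F) I"
        unfolding partial_def using F(1) FI
        by (intro has_sum_finite_neutralI[of F]) auto
      then have "coef (partial x F) = (\<lambda>i. if i \<in> F then coef x i else 0)"
        using FI by (intro coef_eqI partial_in) auto
      then have "partial x F \<in> supported_on (C n)"
        using n partial_in[OF FI] by (auto simp: supported_on_def)
      then show "\<exists>y\<in>\<Union>n. supported_on (C n). dist y x < \<epsilon>" using F(3) by (auto simp: dist_norm)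
    qed
  qed
qed

theorem has_projectional_skeleton: "has_projectional_skeleton E"
proof -
  define \<F> where "\<F> = supported_on ` {C. countable C \<and> C \<subseteq> I}"
  have FE: "\<exists>C. countable C \<and> C \<subseteq> I \<and> F = supported_on C" if "F \<in> \<F>" for F
    using that unfolding \<F>_def by auto
  \<comment> \<open>A skeleton indexes projections by subspaces, not by index sets; C is recovered
    from \<open>supported_on C\<close> as the set of indices whose basis vectors belong to
    it.\<close>
  define P where "P F = restriction {i\<in>I. e i \<in> F}" for F
  have PC: "P (supported_on C) = restriction C" if "C \<subseteq> I" for C
    using supported_on_basis[OF that] by (simp add: P_def)
  have "complemented_in E F \<and> separable_space (top_of_set F)" if "F \<in> \<F>" for F
    using that projection_restriction restriction_image separable_supported_on
    unfolding \<F>_def complemented_in_def by blast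
  moreover have "E = \<Union>\<F>"
  proof
    show "E \<subseteq> \<Union>\<F>"
    proof
      fix x assume x: "x \<in> E"
      let ?C = "{i\<in>I. coef x i *\<^sub>R e i \<noteq> 0}"
      have "countable ?C" by (rule has_sum_countable_support[OF coef(2)[OF x]])
      moreover have "x \<in> supported_on ?C"
        using x coef(1)[OF x] e_nonzero by (auto simp: supported_on_def)
      ultimately show "x \<in> \<Union>\<F>" unfolding \<F>_def by blast
    qed
  qed (auto simp: \<F>_def supported_on_def)
  moreover have "\<exists>H\<in>\<F>. F \<subseteq> H \<and> G \<subseteq> H" if FG: "F \<in> \<F>" "G \<in> \<F>" for F G
  proof -
    obtain C D where CD: "countable C" "C \<subseteq> I" "F = supported_on C" "countable D" "D \<subseteq> I" "G = supported_on D"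
      using FG unfolding \<F>_def by blast
    then have "supported_on (C \<union> D) \<in> \<F>" unfolding \<F>_def by (intro imageI) simp
    then show ?thesis using CD supported_on_mono[of C "C \<union> D"] supported_on_mono[of D "C \<union> D"] by blast
  qed
  moreover have "closure (\<Union>n. S n) \<in> \<F>" if S: "\<forall>n. S n \<in> \<F>" "\<forall>n. S n \<subseteq> S (Suc n)" for S :: "nat \<Rightarrow> 'v set"
  proof -
    define C where "C n = {i\<in>I. e i \<in> S n}" for n
    have C: "countable (C n)" "supported_on (C n) = S n" for n
    proof -
      obtain D where D: "countable D" "D \<subseteq> I" "S n = supported_on D" using S(1) unfolding \<F>_def by blast
      then have "C n = D" using supported_on_basis[OF D(2)] by (simp add: C_def)
      then show "countable (C n)" "supported_on (C n) = S n" using D by simp_all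
    qed
    have CI: "C n \<subseteq> I" for n by (auto simp: C_def)
    have "incseq C" using S(2) by (intro incseq_SucI) (auto simp: C_def)
    then have "closure (\<Union>n. S n) = supported_on (\<Union>n. C n)"
      using closure_Union_supported_on[of C] CI by (simp add: C(2))
    moreover have "countable (\<Union>n. C n)" "(\<Union>n. C n) \<subseteq> I" using C(1) CI by auto
    ultimately show ?thesis unfolding \<F>_def by simp
  qed
  moreover have "projection_on E (P F) \<and> P F ` E = F" if "F \<in> \<F>" for F
  proof -
    from FE[OF that] obtain C where "countable C \<and> C \<subseteq> I \<and> F = supported_on C" ..
    then have C: "C \<subseteq> I" "F = supported_on C" by simp_all
    show ?thesis unfolding C(2) PC[OF C(1)] by (intro conjI projection_restriction restriction_image)
  qed
  moreover have "P F (P G x) = P F x \<and> P G (P F x) = P F x"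
    if FG: "F \<in> \<F>" "G \<in> \<F>" "F \<subseteq> G" and x: "x \<in> E" for F G x
  proof -
    from FE[OF FG(1)] obtain C where "countable C \<and> C \<subseteq> I \<and> F = supported_on C" ..
    moreover from FE[OF FG(2)] obtain D where "countable D \<and> D \<subseteq> I \<and> G = supported_on D" ..
    ultimately have CD: "C \<subseteq> I" "F = supported_on C" "D \<subseteq> I" "G = supported_on D" by simp_all
    have "C = {i\<in>I. e i \<in> F}" "D = {i\<in>I. e i \<in> G}"
      using supported_on_basis[OF CD(1)] supported_on_basis[OF CD(3)] CD(2,4) by simp_all
    then have "C \<subseteq> D" using FG(3) by auto
    then show ?thesis
      unfolding CD(2,4) PC[OF CD(1)] PC[OF CD(3)] using x
      by (intro conjI coef_inject) (auto simp: restriction fun_eq_iff)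
  qed
  ultimately show ?thesis
    unfolding has_projectional_skeleton_def by (intro exI[of _ \<F>] exI[of _ P]) simp
qed

end

section \<open>Eberlein compacta\<close>

text \<open>The evaluations at \<open>i m\<close> have a cluster point in a product of compact intervals.\<close>

lemma generalized_limit_evaluation:
  fixes i :: "nat \<Rightarrow> 'q"
  obtains \<phi> :: "('q discrete \<Rightarrow>\<^sub>C real) \<Rightarrow> real" where "bounded_linear \<phi>"
    "\<And>f c. (\<lambda>m. val f (i m)) \<longlonglongrightarrow> c \<Longrightarrow> \<phi> f = c"
proof -
  define K :: "(('q discrete \<Rightarrow>\<^sub>C real) \<Rightarrow> real) set" where "K = (\<Pi>\<^sub>E f\<in>UNIV. cball 0 (norm f))"
  have "compactin (product_topology (\<lambda>_. euclideanreal) UNIV) K"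
    unfolding K_def compactin_PiE by simp
  then have "compact K" by (simp add: euclidean_product_topology)
  define F where "F = filtermap (\<lambda>m f. val f (i m)) sequentially"
  have FK: "\<forall>\<^sub>F \<psi> in F. \<psi> \<in> K"
    unfolding F_def eventually_filtermap by (simp add: K_def PiE_iff val_le_norm)
  have "F \<noteq> bot" by (simp add: F_def filtermap_bot_iff)
  then obtain \<phi> where \<phi>: "\<phi> \<in> K" "inf (nhds \<phi>) F \<noteq> bot"
    using \<open>compact K\<close> FK unfolding compact_filter by meson
  \<comment> \<open>G converges to \<phi> pointwise and refines F. So whatever holds at all
    evaluations, such as linearity, passes to \<phi>, and existing limits along m are kept.\<close>
  define G where "G = inf (nhds \<phi>) F"
  have lim: "((\<lambda>\<psi>. \<psi> f) \<longlongrightarrow> \<phi> f) G" for f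
  proof -
    have "((\<lambda>\<psi>. \<psi> f) \<longlongrightarrow> \<phi> f) (nhds \<phi>)"
    proof (rule topological_tendstoI)
      fix S :: "real set" assume S: "open S" "\<phi> f \<in> S"
      have "open ((\<lambda>\<psi>::('q discrete \<Rightarrow>\<^sub>C real) \<Rightarrow> real. \<psi> f) -` S)"
        by (intro open_vimage S(1) continuous_on_product_coordinates)
      then show "\<forall>\<^sub>F \<psi> in nhds \<phi>. \<psi> f \<in> S"
        unfolding eventually_nhds using S(2) by (intro exI[of _ "(\<lambda>\<psi>. \<psi> f) -` S"]) simp
    qed
    then show ?thesis unfolding G_def by (rule tendsto_mono[OF inf_le1])
  qed
  have eq: "\<phi> f = c" if "((\<lambda>\<psi>. \<psi> f) \<longlongrightarrow> c) G" for f c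
    using tendsto_unique[OF _ lim that] \<phi>(2) by (simp add: G_def)
  have ev: "eventually P G" if "\<And>m. P (\<lambda>f. val f (i m))" for P
  proof -
    have "eventually P F" unfolding F_def eventually_filtermap using that by simp
    then show ?thesis unfolding G_def by (rule filter_leD[OF inf_le2])
  qed
  show thesis
  proof
    show "\<phi> f = c" if "(\<lambda>m. val f (i m)) \<longlonglongrightarrow> c" for f c
    proof (rule eq)
      have "((\<lambda>\<psi>. \<psi> f) \<longlongrightarrow> c) F" using that by (simp add: F_def filterlim_filtermap)
      then show "((\<lambda>\<psi>. \<psi> f) \<longlongrightarrow> c) G" unfolding G_def by (rule tendsto_mono[OF inf_le2])
    qed
    show "bounded_linear \<phi>"
    proof (rule bounded_linear_intro[where K = 1])
      show "\<phi> (f + g) = \<phi> f + \<phi> g" for f g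
      proof (rule eq, rule Lim_transform_eventually)
        show "((\<lambda>\<psi>. \<psi> f + \<psi> g) \<longlongrightarrow> \<phi> f + \<phi> g) G" by (intro tendsto_add lim)
        show "\<forall>\<^sub>F \<psi> in G. \<psi> f + \<psi> g = \<psi> (f + g)" by (rule ev) simp
      qed
      show "\<phi> (r *\<^sub>R f) = r *\<^sub>R \<phi> f" for r f
      proof (rule eq, rule Lim_transform_eventually)
        show "((\<lambda>\<psi>. r *\<^sub>R \<psi> f) \<longlongrightarrow> r *\<^sub>R \<phi> f) G" by (intro tendsto_scaleR tendsto_const lim)
        show "\<forall>\<^sub>F \<psi> in G. r *\<^sub>R \<psi> f = \<psi> (r *\<^sub>R f)" by (rule ev) simp
      qed
      show "norm (\<phi> f) \<le> norm f * 1" for f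
        using \<phi>(1) by (auto simp: K_def PiE_iff)
    qed
  qed
qed

lemma finite_limits_far_from_infinity:
  assumes ad: "almost_disjoint_countable \<A>" and f: "continuous_on_K \<A> f"
    and e: "e > 0"
  shows "finite {A\<in>\<A>. e \<le> \<bar>f (Limit A) - f Infinity\<bar>}"
proof -
  obtain \<F> where F: "finite \<F>" "\<F> \<subseteq> \<A>"
    "\<forall>p\<in>K_points \<A> - (\<Union>A\<in>\<F>. limit_nbhd A). \<bar>f p - f Infinity\<bar> < e"
    using f e unfolding continuous_map_K_space_iff[OF ad] by blast
  have "A \<in> \<F>" if "A \<in> \<A>" "e \<le> \<bar>f (Limit A) - f Infinity\<bar>" for A
  proof (rule ccontr)
    assume "A \<notin> \<F>"
    then have "Limit A \<in> K_points \<A> - (\<Union>A\<in>\<F>. limit_nbhd A)" using that by auto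
    from bspec[OF F(3) this] show False using that by simp
  qed
  then show ?thesis by (intro finite_subset[OF _ F(1)]) blast
qed

lemma countable_limits_ne_infinity:
  assumes ad: "almost_disjoint_countable \<A>" and f: "continuous_on_K \<A> f"
  shows "countable {A\<in>\<A>. f (Limit A) \<noteq> f Infinity}"
proof -
  have "countable (\<Union>n. {A\<in>\<A>. inverse (real (Suc n)) \<le> \<bar>f (Limit A) - f Infinity\<bar>})"
    by (intro countable_UN[OF countableI_type] countable_finite finite_limits_far_from_infinity[OF ad f]) simp
  moreover have "{A\<in>\<A>. f (Limit A) \<noteq> f Infinity} \<subseteq>
      (\<Union>n. {A\<in>\<A>. inverse (real (Suc n)) \<le> \<bar>f (Limit A) - f Infinity\<bar>})"
  proof
    fix A assume "A \<in> {A\<in>\<A>. f (Limit A) \<noteq> f Infinity}"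
    then have "A \<in> \<A>" "\<bar>f (Limit A) - f Infinity\<bar> > 0" by auto
    then obtain n where "inverse (real (Suc n)) < \<bar>f (Limit A) - f Infinity\<bar>" using reals_Archimedean by blast
    then show "A \<in> (\<Union>n. {A\<in>\<A>. inverse (real (Suc n)) \<le> \<bar>f (Limit A) - f Infinity\<bar>})"
      using \<open>A \<in> \<A>\<close> by (auto intro: less_imp_le)
  qed
  ultimately show ?thesis by (rule countable_subset[rotated])
qed

text \<open>The tuples of values over the finite set G lie in a separable space, so countably many
  indices are dense among them. Rounding down to multiples of 1 / (n + 1) leaves countably many
  codes; one index is kept for each.\<close>

lemma countable_representatives:
  fixes g :: "'p \<Rightarrow> 'q \<Rightarrow> real"
  assumes "finite G"
  obtains R where "countable R"
    "\<And>i n. \<exists>j\<in>R. \<forall>p\<in>G. \<bar>g p j - g p i\<bar> < 1 / real (Suc n)"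
proof -
  define code where "code n i = restrict (\<lambda>p. \<lfloor>real (Suc n) * g p i\<rfloor>) G" for n i
  define R where "R = (\<Union>n. (\<lambda>c. SOME i. code n i = c) ` range (code n))"
  have "range (code n) \<subseteq> (\<Pi>\<^sub>E p\<in>G. UNIV)" for n by (auto simp: code_def)
  then have count: "countable (range (code n))" for n
    by (rule countable_subset) (intro countable_PiE assms, simp)
  have "countable R" unfolding R_def
    by (rule countable_UN[OF countableI_type], rule countable_image, rule count)
  moreover have "\<exists>j\<in>R. \<forall>p\<in>G. \<bar>g p j - g p i\<bar> < 1 / real (Suc n)" for i n
  proof (intro bexI ballI)
    let ?j = "SOME j. code n j = code n i"
    show "?j \<in> R" by (auto simp: R_def)
    fix p assume p: "p \<in> G"
    have "code n ?j = code n i" by (rule someI[of "\<lambda>j. code n j = code n i"]) simp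
    then have "code n ?j p = code n i p" by simp
    then have "\<lfloor>real (Suc n) * g p ?j\<rfloor> = \<lfloor>real (Suc n) * g p i\<rfloor>" using p by (simp add: code_def)
    then have "\<bar>real (Suc n) * g p ?j - real (Suc n) * g p i\<bar> < 1" by linarith
    then have "real (Suc n) * \<bar>g p ?j - g p i\<bar> < 1"
      by (metis abs_mult abs_of_nat right_diff_distrib)
    then show "\<bar>g p ?j - g p i\<bar> < 1 / real (Suc n)" by (simp add: pos_less_divide_eq mult.commute)
  qed
  ultimately show thesis by (rule that)
qed

theorem essentially_disjoint_if_weakly_embedded:
  fixes h :: "'a kpoint \<Rightarrow> 'q discrete \<Rightarrow>\<^sub>C real"
  assumes ad: "almost_disjoint_countable \<A>"
    and cont: "\<And>\<phi>. bounded_linear \<phi> \<Longrightarrow> continuous_on_K \<A> (\<lambda>p. \<phi> (h p))"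
    and inj: "inj_on h (K_points \<A>)"
  shows "essentially_disjoint \<A>"
proof -
  have cont_val: "continuous_on_K \<A> (\<lambda>p. val (h p) i)" for i
    by (rule cont) (rule bounded_linear_eval_bcontfun)
  have "\<exists>R. countable R \<and> (\<forall>i n. \<exists>j\<in>R. \<forall>p\<in>G. \<bar>val (h p) j - val (h p) i\<bar> < 1 / real (Suc n))"
    if "finite G" for G
    using countable_representatives[OF that, of "\<lambda>p. val (h p)"] by metis
  then have "\<forall>G\<in>Collect finite. \<exists>R. countable R \<and>
      (\<forall>i n. \<exists>j\<in>R. \<forall>p\<in>G. \<bar>val (h p) j - val (h p) i\<bar> < 1 / real (Suc n))" by simp
  from bchoice[OF this] obtain R where R: "\<forall>G\<in>Collect finite. countable (R G) \<and>
      (\<forall>i n. \<exists>j\<in>R G. \<forall>p\<in>G. \<bar>val (h p) j - val (h p) i\<bar> < 1 / real (Suc n))" ..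
  \<comment> \<open>Each coordinate distinguishes only countably many limits from
    \<open>Infinity\<close>. There are countably many finite sets of points in question and
    countably many representatives for each, so \<open>\<phi> s\<close> remains countable.\<close>
  define \<phi> where "\<phi> s = (\<Union>G\<in>Fpow (insert Infinity (Point ` \<Union>(s \<inter> \<A>))). \<Union>i\<in>R G.
      {A\<in>\<A>. val (h (Limit A)) i \<noteq> val (h Infinity) i})" for s
  show ?thesis
  proof (rule essentially_disjoint_if_closed_good[OF ad])
    show "countable (\<phi> s)" if "finite s" for s
    proof -
      have "countable A" if "A \<in> s \<inter> \<A>" for A using almost_disjoint_countableD(1)[OF ad] that by blast
      then have "countable (\<Union>A\<in>s \<inter> \<A>. A)"
        using that by (intro countable_UN) (simp_all add: countable_finite)
      then have "countable (Fpow (insert Infinity (Point ` \<Union>(s \<inter> \<A>))))"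
        by (intro countable_Fpow countable_insert countable_image) simp
      then show ?thesis
        unfolding \<phi>_def using R
        by (intro countable_UN countable_limits_ne_infinity[OF ad cont_val]) (auto simp: Fpow_def)
    qed
    show "\<phi> s \<subseteq> \<A>" for s by (auto simp: \<phi>_def)
    fix S A assume S: "countable S" "infinite S" "S \<subseteq> \<A>" "closed_under \<phi> S" and A: "A \<in> \<A> - S"
    show "finite (A \<inter> \<Union>S)"
    proof (rule ccontr)
      assume inf: "infinite (A \<inter> \<Union>S)"
      have "Limit A \<in> K_points \<A>" "Infinity \<in> K_points \<A>" using A by auto
      then have "h (Limit A) \<noteq> h Infinity" using inj by (metis inj_on_def kpoint.distinct(5))
      then obtain i0 where i0: "val (h (Limit A)) i0 \<noteq> val (h Infinity) i0"
        using bcontfun_discrete_eqI[of "h (Limit A)" "h Infinity"] by auto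
      have cA: "countable (A \<inter> \<Union>S)" using almost_disjoint_countableD(1)[OF ad] A by blast
      define y where "y = from_nat_into (A \<inter> \<Union>S)"
      have y: "range y = A \<inter> \<Union>S" unfolding y_def
        using inf cA by (intro range_from_nat_into) auto
      \<comment> \<open>The coordinates i m are to approximate i0 on the first m + 1 points of
        \<open>A \<inter> \<Union>S\<close> and at \<open>Infinity\<close>, but not at
        \<open>Limit A\<close>, where closedness of S dictates their value.\<close>
      define G where "G m = insert Infinity (Point ` y ` {..m})" for m :: nat
      have finG: "finite (G m)" for m by (simp add: G_def)
      have "\<exists>i. i \<in> R (G m) \<and> (\<forall>p\<in>G m. \<bar>val (h p) i - val (h p) i0\<bar> < 1 / real (Suc m))" for m
        using R finG[of m] by blast
      then have "\<forall>m. \<exists>i. i \<in> R (G m) \<and> (\<forall>p\<in>G m. \<bar>val (h p) i - val (h p) i0\<bar> < 1 / real (Suc m))" ..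
      from choice[OF this] obtain i where
        i: "\<forall>m. i m \<in> R (G m) \<and> (\<forall>p\<in>G m. \<bar>val (h p) (i m) - val (h p) i0\<bar> < 1 / real (Suc m))" ..
      obtain \<psi> :: "('q discrete \<Rightarrow>\<^sub>C real) \<Rightarrow> real" where \<psi>: "bounded_linear \<psi>"
        and \<psi>_lim: "\<And>f c. (\<lambda>m. val f (i m)) \<longlonglongrightarrow> c \<Longrightarrow> \<psi> f = c"
        using generalized_limit_evaluation[of i] by metis
      have \<psi>_eq: "(\<lambda>m. val (h p) (i m)) \<longlonglongrightarrow> val (h p) i0" if "p \<in> G n" for p n
      proof (rule LIMSEQ_I)
        fix e :: real assume "e > 0"
        then obtain N where N: "inverse (real (Suc N)) < e" using reals_Archimedean by blast
        have "norm (val (h p) (i m) - val (h p) i0) < e" if m: "m \<ge> max n N" for m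
        proof -
          have "p \<in> G m" using \<open>p \<in> G n\<close> m by (auto simp: G_def)
          then have "\<bar>val (h p) (i m) - val (h p) i0\<bar> < inverse (real (Suc m))" using i by (simp add: inverse_eq_divide)
          also have "\<dots> \<le> inverse (real (Suc N))" using m by (intro le_imp_inverse_le) auto
          finally show ?thesis using N by simp
        qed
        then show "\<exists>N. \<forall>m\<ge>N. norm (val (h p) (i m) - val (h p) i0) < e" by blast
      qed
      have \<psi>_y: "\<psi> (h (Point x)) = val (h (Point x)) i0" if x: "x \<in> A \<inter> \<Union>S" for x
      proof -
        obtain n where "x = y n" using y x by blast
        then have "Point x \<in> G n" by (simp add: G_def)
        then show ?thesis by (intro \<psi>_lim \<psi>_eq)
      qed
      have "val (h (Limit A)) (i m) = val (h Infinity) (i m)" for m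
      proof -
        have "\<forall>x\<in>\<Union>S. \<exists>B. B \<in> S \<and> x \<in> B" by blast
        from bchoice[OF this] obtain b where b: "\<forall>x\<in>\<Union>S. b x \<in> S \<and> x \<in> b x" ..
        have "y k \<in> A \<inter> \<Union>S" for k unfolding y[symmetric] by (rule rangeI)
        then have "y k \<in> \<Union>S" for k by (rule IntD2)
        from bspec[OF b this] have bS: "b (y k) \<in> S" and yb: "y k \<in> b (y k)" for k by simp_all
        \<comment> \<open>The members chosen around y 0, ..., y m form a finite part of S whose
          union contains the points of \<open>G m\<close>. So the coordinate i m is among those
          collected in \<open>\<phi> ?s\<close>, and A, not being in \<open>\<phi> ?s\<close>, has a
          limit that i m does not distinguish from \<open>Infinity\<close>.\<close>
        let ?s = "b ` y ` {..m}"
        have s: "?s \<subseteq> S" using bS by auto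
        have "y k \<in> \<Union>(?s \<inter> \<A>)" if "k \<le> m" for k
          by (rule UnionI[OF _ yb]) (use bS[of k] S(3) that in auto)
        then have G: "G m \<in> Fpow (insert Infinity (Point ` \<Union>(?s \<inter> \<A>)))"
          by (auto simp: Fpow_def G_def)
        have "\<phi> ?s \<subseteq> S" using S(4)[unfolded closed_under_def, rule_format, of ?s] s by simp
        then have "A \<notin> \<phi> ?s" using A by blast
        moreover have "A \<in> \<phi> ?s" if "val (h (Limit A)) (i m) \<noteq> val (h Infinity) (i m)"
          unfolding \<phi>_def using i A that by (intro UN_I[OF G] UN_I[of "i m"]) simp_all
        ultimately show ?thesis by blast
      qed
      then have "\<psi> (h (Limit A)) = val (h Infinity) i0"
        using \<psi>_eq[of Infinity 0] by (intro \<psi>_lim) (simp add: G_def)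
      \<comment> \<open>On \<open>A \<inter> \<Union>S\<close> the functional \<psi> agrees with the
        coordinate i0, yet along A they tend to the values of i0 at \<open>Infinity\<close> and at
        \<open>Limit A\<close>. A point where both are within half of the distance of these values
        contradicts the triangle inequality.\<close>
      define e where "e = \<bar>val (h (Limit A)) i0 - val (h Infinity) i0\<bar> / 2"
      have e: "e > 0" using i0 by (simp add: e_def)
      have "finite {x\<in>A. e \<le> \<bar>\<psi> (h (Point x)) - \<psi> (h (Limit A))\<bar>}"
        "finite {x\<in>A. e \<le> \<bar>val (h (Point x)) i0 - val (h (Limit A)) i0\<bar>}"
        using cont[OF \<psi>] cont_val[of i0] A e unfolding continuous_map_K_space_iff[OF ad] by auto
      then have "finite ({x\<in>A. e \<le> \<bar>\<psi> (h (Point x)) - \<psi> (h (Limit A))\<bar>} \<union>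
          {x\<in>A. e \<le> \<bar>val (h (Point x)) i0 - val (h (Limit A)) i0\<bar>})" by simp
      then obtain x where x: "x \<in> A \<inter> \<Union>S" "x \<notin> {x\<in>A. e \<le> \<bar>\<psi> (h (Point x)) - \<psi> (h (Limit A))\<bar>} \<union>
          {x\<in>A. e \<le> \<bar>val (h (Point x)) i0 - val (h (Limit A)) i0\<bar>}"
        using inf by (meson finite_subset subsetI)
      then have "\<bar>val (h (Point x)) i0 - val (h Infinity) i0\<bar> < e"
        "\<bar>val (h (Point x)) i0 - val (h (Limit A)) i0\<bar> < e"
        using \<psi>_y[OF x(1)] \<open>\<psi> (h (Limit A)) = val (h Infinity) i0\<close> by auto
      moreover have "\<bar>val (h (Limit A)) i0 - val (h Infinity) i0\<bar> \<le>
          \<bar>val (h (Point x)) i0 - val (h Infinity) i0\<bar> + \<bar>val (h (Point x)) i0 - val (h (Limit A)) i0\<bar>"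
        by simp
      ultimately show False unfolding e_def by simp
    qed
  qed
qed

lemma essentially_disjoint_if_eberlein:
  assumes ad: "almost_disjoint_countable \<A>" and e: "eberlein_compact (K_space \<A>)"
  shows "essentially_disjoint \<A>"
proof -
  obtain W :: "(('a kpoint \<times> 'a kpoint) discrete \<Rightarrow>\<^sub>C real) set" and h
    where h: "homeomorphic_map (K_space \<A>) (subtopology weak_topology W) h"
    using e unfolding eberlein_compact_def eberlein_in_def homeomorphic_space by blast
  have "continuous_map (K_space \<A>) weak_topology h"
    using homeomorphic_imp_continuous_map[OF h] continuous_map_in_subtopology by blast
  moreover have "continuous_map weak_topology euclideanreal \<phi>"
    if "bounded_linear \<phi>" for \<phi> :: "(('a kpoint \<times> 'a kpoint) discrete \<Rightarrow>\<^sub>C real) \<Rightarrow> real"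
    unfolding continuous_map_def using openin_weak_topology_vimage[OF that] by (simp add: vimage_def)
  ultimately have "continuous_on_K \<A> (\<lambda>p. \<phi> (h p))"
    if "bounded_linear \<phi>" for \<phi>
    using continuous_map_compose[of _ _ h _ \<phi>] that by (metis comp_def continuous_map_eq)
  moreover have "inj_on h (K_points \<A>)"
    using h by (simp add: homeomorphic_eq_everything_map topspace_K_space)
  ultimately show ?thesis by (rule essentially_disjoint_if_weakly_embedded[OF ad])
qed

section \<open>Projectional skeletons\<close>

lemma subspace_C_space: "subspace (C_space K)"
  unfolding C_space_def
  by (intro subspaceI)
     (auto intro: continuous_map_add continuous_map_real_mult_left simp: zero_bcontfun.rep_eq)

lemma closed_C_space:
  assumes ad: "almost_disjoint_countable \<A>"
  shows "closed (CK \<A>)"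
proof -
  have "f \<in> CK \<A>"
    if u: "\<And>n. u n \<in> CK \<A>" and lim: "u \<longlonglongrightarrow> f"
    for u :: "nat \<Rightarrow> 'a kpoint discrete \<Rightarrow>\<^sub>C real" and f
  proof -
    have close: "\<exists>n. \<forall>p. \<bar>val (u n) p - val f p\<bar> < e" if "e > 0" for e
    proof -
      obtain n where n: "norm (u n - f) < e" using LIMSEQ_D[OF lim \<open>e > 0\<close>] by blast
      have "\<bar>val (u n) p - val f p\<bar> < e" for p
        using val_le_norm[of "u n - f" p] n by simp
      then show ?thesis by blast
    qed
    have "continuous_on_K \<A> (val f)"
      unfolding continuous_map_K_space_iff_nhds[OF ad]
    proof (intro ballI allI impI)
      fix p and e :: real assume p: "p \<in> K_points \<A>" and e: "e > 0"
      have e3: "e / 3 > 0" using e by simp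
      obtain n where n: "\<forall>p. \<bar>val (u n) p - val f p\<bar> < e / 3" using close[OF e3] ..
      have "\<exists>N\<in>K_basic_nhds \<A> p. \<forall>q\<in>N. \<bar>val (u n) q - val (u n) p\<bar> < e / 3"
        using C_spaceD(1)[OF u[of n], unfolded continuous_map_K_space_iff_nhds[OF ad], rule_format, OF p e3] .
      then obtain N where N: "N \<in> K_basic_nhds \<A> p" "\<forall>q\<in>N. \<bar>val (u n) q - val (u n) p\<bar> < e / 3" ..
      have "\<bar>val f q - val f p\<bar> < e" if "q \<in> N" for q
        using n[rule_format, of p] n[rule_format, of q] bspec[OF N(2) that] by linarith
      then show "\<exists>N\<in>K_basic_nhds \<A> p. \<forall>q\<in>N. \<bar>val f q - val f p\<bar> < e" using N(1) by (intro bexI[of _ N]) simp_all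
    qed
    moreover have "val f p = 0" if "p \<notin> K_points \<A>" for p
    proof (rule ccontr)
      assume "val f p \<noteq> 0"
      then obtain n where "\<forall>q. \<bar>val (u n) q - val f q\<bar> < \<bar>val f p\<bar>" using close[of "\<bar>val f p\<bar>"] by auto
      then have "\<bar>val (u n) p - val f p\<bar> < \<bar>val f p\<bar>" ..
      then show False using C_spaceD(2)[OF u that] by simp
    qed
    ultimately show ?thesis by (simp add: C_space_def topspace_K_space)
  qed
  then show ?thesis unfolding closed_sequential_limits by blast
qed

definition unit_function :: "'i \<Rightarrow> 'i discrete \<Rightarrow>\<^sub>C real" where
  "unit_function i = bfun (\<lambda>j. of_bool (j = i))"

lemma val_unit_function [simp]: "val (unit_function i) j = of_bool (j = i)"
  unfolding unit_function_def by (rule val_bfun[of _ 1]) simp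

lemma val_sum_unit_functions:
  assumes "finite F"
  shows "val (\<Sum>i\<in>F. a i *\<^sub>R unit_function i) j = (if j \<in> F then a j else 0)"
proof -
  have "val (\<Sum>i\<in>F. a i *\<^sub>R unit_function i) j = (\<Sum>i\<in>F. if j = i then a i else 0)"
    by (simp add: val_sum) (intro sum.cong, auto)
  then show ?thesis using assms by (simp add: sum.delta')
qed

abbreviation point_function :: "'a \<Rightarrow> 'a kpoint discrete \<Rightarrow>\<^sub>C real" where
  "point_function \<equiv> \<lambda>z. unit_function (Point z)"

definition set_function :: "'a set \<Rightarrow> 'a kpoint discrete \<Rightarrow>\<^sub>C real" where
  "set_function A = bfun (\<lambda>p. of_bool (p \<in> limit_nbhd A))"

lemma val_set_function [simp]: "val (set_function A) p = of_bool (p \<in> limit_nbhd A)"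
  unfolding set_function_def by (rule val_bfun[of _ 1]) simp

lemma point_function_in:
  assumes ad: "almost_disjoint_countable \<A>" and z: "z \<in> \<Union>\<A>"
  shows "point_function z \<in> CK \<A>"
  unfolding unit_function_def
proof (rule bfun_in_C_space[where B = 1])
  obtain Z where Z: "Z \<in> \<A>" "z \<in> Z" using z by blast
  show "continuous_on_K \<A> (\<lambda>p. of_bool (p = Point z))"
    unfolding continuous_map_K_space_iff[OF ad]
  proof (intro conjI ballI allI impI)
    fix A and e :: real assume "e > 0"
    then have "{x\<in>A. e \<le> \<bar>of_bool (Point x = Point z) - of_bool (Limit A = Point z)\<bar>} \<subseteq> {z}" by auto
    then show "finite {x\<in>A. e \<le> \<bar>of_bool (Point x = Point z) - of_bool (Limit A = Point z)\<bar>}"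
      by (rule finite_subset) simp
  next
    fix e :: real assume "e > 0"
    then show "\<exists>\<F>. finite \<F> \<and> \<F> \<subseteq> \<A> \<and> (\<forall>p\<in>K_points \<A> - (\<Union>A\<in>\<F>. limit_nbhd A).
        \<bar>of_bool (p = Point z) - of_bool (Infinity = Point z)\<bar> < e)"
      using Z by (intro exI[of _ "{Z}"]) auto
  qed
qed (use z in auto)

lemma set_function_in:
  assumes ad: "almost_disjoint_countable \<A>" and A: "A \<in> \<A>"
  shows "set_function A \<in> CK \<A>"
  unfolding set_function_def
proof (rule bfun_in_C_space[where B = 1])
  show "continuous_on_K \<A> (\<lambda>p. of_bool (p \<in> limit_nbhd A))"
    unfolding continuous_map_K_space_iff[OF ad]
  proof (intro conjI ballI allI impI)
    fix B and e :: real assume B: "B \<in> \<A>" and "e > 0"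
    then have sub: "{x\<in>B. e \<le> \<bar>of_bool (Point x \<in> limit_nbhd A) -
        of_bool (Limit B \<in> limit_nbhd A)\<bar>} \<subseteq> (if A = B then {} else A \<inter> B)"
      by auto
    have "finite (if A = B then {} else A \<inter> B)"
      using almost_disjoint_countableD(3)[OF ad A B] by simp
    with sub show "finite {x\<in>B. e \<le> \<bar>of_bool (Point x \<in> limit_nbhd A) -
        of_bool (Limit B \<in> limit_nbhd A)\<bar>}" by (rule finite_subset)
  next
    fix e :: real assume "e > 0"
    then show "\<exists>\<F>. finite \<F> \<and> \<F> \<subseteq> \<A> \<and> (\<forall>p\<in>K_points \<A> - (\<Union>A\<in>\<F>. limit_nbhd A).
        \<bar>of_bool (p \<in> limit_nbhd A) - of_bool (Infinity \<in> limit_nbhd A)\<bar> < e)"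
      using A by (intro exI[of _ "{A}"]) auto
  qed
qed (use A in auto)

lemma bounded_linear_on_sum:
  assumes T: "bounded_linear_on E G T" and E: "subspace E" and f: "\<And>i. i \<in> F \<Longrightarrow> f i \<in> E"
    and F: "finite F"
  shows "T (\<Sum>i\<in>F. c i *\<^sub>R f i) = (\<Sum>i\<in>F. c i *\<^sub>R T (f i))"
  using F f
proof (induction F)
  case empty
  have "T (0 *\<^sub>R 0) = 0 *\<^sub>R T 0" using T subspace_0[OF E] unfolding bounded_linear_on_def by blast
  then show ?case by simp
next
  case (insert i F)
  have "(\<Sum>i\<in>F. c i *\<^sub>R f i) \<in> E" "f i \<in> E" "c i *\<^sub>R f i \<in> E"
    using insert.prems E by (auto intro!: subspace_sum subspace_scale)
  then have "T (c i *\<^sub>R f i + (\<Sum>i\<in>F. c i *\<^sub>R f i)) = c i *\<^sub>R T (f i) + T (\<Sum>i\<in>F. c i *\<^sub>R f i)"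
    using T unfolding bounded_linear_on_def by simp
  then show ?case using insert by simp
qed

section \<open>Functionals are nonzero on only countably many characteristic functions\<close>

lemma countable_nonzero_if_sums_bounded:
  fixes b :: "'i \<Rightarrow> real"
  assumes "\<And>F. finite F \<Longrightarrow> F \<subseteq> J \<Longrightarrow> (\<Sum>i\<in>F. \<bar>b i\<bar>) \<le> C"
  shows "countable {i\<in>J. b i \<noteq> 0}"
proof -
  have "(\<lambda>i. \<bar>b i\<bar>) summable_on J"
    using assms by (intro nonneg_bdd_above_summable_on) (auto intro!: bdd_aboveI[of _ C])
  then show ?thesis using summable_countable_real by fastforce
qed

text \<open>The functional is tested on the combination of the unit functions with the signs of its
  own values; disjoint supports keep its norm at most 1, so the norm bound of T is an l1
  bound.\<close>

lemma functional_unit_sums_bounded: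
  assumes T: "bounded_linear_on E (UNIV :: real set) T" and E: "subspace E"
    and J: "\<And>i. i \<in> J \<Longrightarrow> unit_function i \<in> E"
  shows "\<exists>C. \<forall>F. finite F \<and> F \<subseteq> J \<longrightarrow> (\<Sum>i\<in>F. \<bar>T (unit_function i)\<bar>) \<le> C"
proof -
  obtain C where C: "\<forall>f\<in>E. norm (T f) \<le> C * norm f"
    using T unfolding bounded_linear_on_def by auto
  have "(\<Sum>i\<in>F. \<bar>T (unit_function i)\<bar>) \<le> \<bar>C\<bar>" if F: "finite F" "F \<subseteq> J" for F
  proof -
    have FE: "unit_function i \<in> E" if "i \<in> F" for i using J F(2) that by blast
    define g where "g = (\<Sum>i\<in>F. sgn (T (unit_function i)) *\<^sub>R unit_function i)"
    have g: "g \<in> E" unfolding g_def by (intro subspace_sum subspace_scale E FE)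
    have "norm g \<le> 1"
      by (rule norm_le_val) (simp add: g_def val_sum_unit_functions[OF F(1)] sgn_if)
    have "T g = (\<Sum>i\<in>F. sgn (T (unit_function i)) *\<^sub>R T (unit_function i))"
      unfolding g_def by (rule bounded_linear_on_sum[OF T E FE F(1)])
    also have "\<dots> = (\<Sum>i\<in>F. \<bar>T (unit_function i)\<bar>)" by (simp add: abs_sgn mult.commute)
    finally have "(\<Sum>i\<in>F. \<bar>T (unit_function i)\<bar>) \<le> norm (T g)" by simp
    also have "\<dots> \<le> C * norm g" using C g by simp
    also have "\<dots> \<le> \<bar>C\<bar> * 1" using \<open>norm g \<le> 1\<close> by (intro mult_mono) auto
    finally show ?thesis by simp
  qed
  then show ?thesis by blast
qed

lemma countable_functional_nonzero_point:
  assumes ad: "almost_disjoint_countable \<A>"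
    and T: "bounded_linear_on (CK \<A>) (UNIV :: real set) T"
  shows "countable {z\<in>\<Union>\<A>. T (point_function z) \<noteq> 0}"
proof -
  have "unit_function p \<in> CK \<A>" if "p \<in> Point ` \<Union>\<A>" for p
    using that by (elim imageE) (simp only: point_function_in[OF ad])
  from functional_unit_sums_bounded[OF T subspace_C_space this] obtain C where
    "\<forall>F. finite F \<and> F \<subseteq> Point ` \<Union>\<A> \<longrightarrow> (\<Sum>p\<in>F. \<bar>T (unit_function p)\<bar>) \<le> C" ..
  then have "countable {p \<in> Point ` \<Union>\<A>. T (unit_function p) \<noteq> 0}"
    by (intro countable_nonzero_if_sums_bounded[where C = C]) simp
  moreover have "Point ` {z\<in>\<Union>\<A>. T (point_function z) \<noteq> 0} \<subseteq> {p \<in> Point ` \<Union>\<A>. T (unit_function p) \<noteq> 0}"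
    by auto
  ultimately show ?thesis
    by (rule countable_image_inj_on[OF countable_subset[rotated]]) (simp add: inj_on_def)
qed

text \<open>Off the finite set \<open>D\<close> of pairwise intersections, the sets are disjoint.\<close>

lemma countable_functional_nonzero_set:
  assumes ad: "almost_disjoint_countable \<A>"
    and T: "bounded_linear_on (CK \<A>) (UNIV :: real set) T"
    and T0: "\<And>z. z \<in> \<Union>\<A> \<Longrightarrow> T (point_function z) = 0"
  shows "countable {A\<in>\<A>. T (set_function A) \<noteq> 0}"
proof -
  let ?E = "CK \<A>"
  obtain C where C: "\<forall>f\<in>?E. norm (T f) \<le> C * norm f"
    using T unfolding bounded_linear_on_def by auto
  have "(\<Sum>A\<in>F. \<bar>T (set_function A)\<bar>) \<le> \<bar>C\<bar>" if F: "finite F" "F \<subseteq> \<A>" for F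
  proof -
    have sF: "set_function A \<in> ?E" if "A \<in> F" for A
      using F(2) that by (intro set_function_in[OF ad]) blast
    define D where "D = (\<Union>A\<in>F. \<Union>B\<in>F - {A}. A \<inter> B)"
    have "finite (A \<inter> B)" if "A \<in> F" "B \<in> F - {A}" for A B
      using almost_disjoint_countableD(3)[OF ad, of A B] that F(2) by blast
    then have D: "finite D" unfolding D_def using F(1) by (intro finite_UN_I) simp_all
    have DX: "D \<subseteq> \<Union>\<A>" unfolding D_def using F(2) by blast
    have pD: "unit_function p \<in> ?E" if "p \<in> Point ` D" for p
    proof -
      obtain z where "z \<in> D" "p = Point z" using \<open>p \<in> Point ` D\<close> by (rule imageE)
      then show ?thesis using DX point_function_in[OF ad, of z] by blast
    qed
    define g where "g = (\<Sum>A\<in>F. sgn (T (set_function A)) *\<^sub>R set_function A)"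
    \<comment> \<open>k cancels g on the overlaps, where signs could add up. It is a combination of
      point functions, on which T vanishes, so T does not notice the correction.\<close>
    define k where "k = (\<Sum>p\<in>Point ` D. (- val g p) *\<^sub>R unit_function p)"
    have g: "g \<in> ?E" unfolding g_def by (intro subspace_sum subspace_scale subspace_C_space sF)
    have k: "k \<in> ?E" unfolding k_def by (intro subspace_sum subspace_scale subspace_C_space pD)
    have val_k: "val k p = (if p \<in> Point ` D then - val g p else 0)" for p
      unfolding k_def by (rule val_sum_unit_functions[OF finite_imageI[OF D]])
    have "norm (g + k) \<le> 1"
    proof (rule norm_le_val)
      fix p
      have val_g: "val g p = (\<Sum>A\<in>F. sgn (T (set_function A)) * of_bool (p \<in> limit_nbhd A))"
        by (simp add: g_def val_sum)
      show "\<bar>val (g + k) p\<bar> \<le> 1"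
      proof (cases "p \<in> Point ` D")
        case True
        then show ?thesis using val_k[of p] by simp
      next
        case False
        then have "val k p = 0" using val_k[of p] by simp
        moreover have "\<bar>val g p\<bar> \<le> 1"
        proof (cases "\<exists>A\<in>F. p \<in> limit_nbhd A")
          case True
          then obtain A where A: "A \<in> F" "p \<in> limit_nbhd A" ..
          have "p \<notin> limit_nbhd B" if B: "B \<in> F" "B \<noteq> A" for B
          proof
            assume "p \<in> limit_nbhd B"
            then obtain x where "p = Point x" "x \<in> A" "x \<in> B" using A(2) B(2) by auto
            then have "x \<in> D" unfolding D_def using A(1) B by blast
            then show False using False \<open>p = Point x\<close> by blast
          qed
          then have "val g p = (\<Sum>B\<in>F. if A = B then sgn (T (set_function B)) else 0)"
            unfolding val_g using A by (intro sum.cong) auto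
          also have "\<dots> = sgn (T (set_function A))" using F(1) A(1) by (simp add: sum.delta')
          finally show ?thesis by (simp add: sgn_if)
        next
          case False
          then have "val g p = 0" unfolding val_g by (intro sum.neutral) auto
          then show ?thesis by simp
        qed
        ultimately show ?thesis by simp
      qed
    qed
    have "T k = (\<Sum>p\<in>Point ` D. (- val g p) *\<^sub>R T (unit_function p))"
      unfolding k_def by (rule bounded_linear_on_sum[OF T subspace_C_space pD finite_imageI[OF D]])
    also have "\<dots> = 0"
    proof -
      have "T (point_function z) = 0" if "z \<in> D" for z using DX that by (intro T0) blast
      then show ?thesis by (intro sum.neutral) auto
    qed
    finally have "T (g + k) = T g" using T g k unfolding bounded_linear_on_def by simp
    also have "\<dots> = (\<Sum>A\<in>F. sgn (T (set_function A)) *\<^sub>R T (set_function A))"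
      unfolding g_def by (rule bounded_linear_on_sum[OF T subspace_C_space sF F(1)])
    also have "\<dots> = (\<Sum>A\<in>F. \<bar>T (set_function A)\<bar>)" by (simp add: abs_sgn mult.commute)
    finally have "(\<Sum>A\<in>F. \<bar>T (set_function A)\<bar>) \<le> norm (T (g + k))" by simp
    also have "\<dots> \<le> C * norm (g + k)" using C subspace_add[OF subspace_C_space g k] by simp
    also have "\<dots> \<le> \<bar>C\<bar> * 1" using \<open>norm (g + k) \<le> 1\<close> by (intro mult_mono) auto
    finally show ?thesis by simp
  qed
  then show ?thesis by (rule countable_nonzero_if_sums_bounded)
qed

section \<open>Common bounds and chain limits in a projectional skeleton\<close>

locale projectional_skeleton =
  fixes E :: "'v::real_normed_vector set" and \<F> :: "'v set set" and P :: "'v set \<Rightarrow> 'v \<Rightarrow> 'v"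
  assumes subspace: "subspace E"
    and separable: "F \<in> \<F> \<Longrightarrow> separable_space (top_of_set F)"
    and cover: "E = \<Union>\<F>"
    and directed: "\<lbrakk>F \<in> \<F>; G \<in> \<F>\<rbrakk> \<Longrightarrow> \<exists>H\<in>\<F>. F \<subseteq> H \<and> G \<subseteq> H"
    and closure_chain: "\<lbrakk>\<And>n. S n \<in> \<F>; \<And>n. S n \<subseteq> S (Suc n)\<rbrakk> \<Longrightarrow> closure (\<Union>n::nat. S n) \<in> \<F>"
    and projection: "F \<in> \<F> \<Longrightarrow> projection_on E (P F)"
    and image: "F \<in> \<F> \<Longrightarrow> P F ` E = F"
    and compatible: "\<lbrakk>F \<in> \<F>; G \<in> \<F>; F \<subseteq> G; x \<in> E\<rbrakk> \<Longrightarrow> P F (P G x) = P F x"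
begin

lemma subset: "F \<in> \<F> \<Longrightarrow> F \<subseteq> E"
  using cover by blast

lemma P_in: "F \<in> \<F> \<Longrightarrow> x \<in> E \<Longrightarrow> P F x \<in> F"
  using image by blast

lemma P_id: "F \<in> \<F> \<Longrightarrow> x \<in> F \<Longrightarrow> P F x = x"
  using image[of F] projection[of F] unfolding projection_on_def by (metis imageE)

lemma P_linear:
  assumes "F \<in> \<F>" "x \<in> E" "y \<in> E"
  shows "P F (x + y) = P F x + P F y" "P F (r *\<^sub>R x) = r *\<^sub>R P F x" "P F (x - y) = P F x - P F y"
proof -
  have add: "P F (x + y) = P F x + P F y" if "x \<in> E" "y \<in> E" for x y
    using projection[OF assms(1)] that unfolding projection_on_def bounded_linear_on_def by simp
  have scale: "P F (r *\<^sub>R x) = r *\<^sub>R P F x" if "x \<in> E" for x r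
    using projection[OF assms(1)] that unfolding projection_on_def bounded_linear_on_def by simp
  show "P F (x + y) = P F x + P F y" "P F (r *\<^sub>R x) = r *\<^sub>R P F x" using add scale assms by simp_all
  have m: "(-1) *\<^sub>R y \<in> E" using assms(3) subspace by (intro subspace_scale)
  have "P F (x + (-1) *\<^sub>R y) = P F x + (-1) *\<^sub>R P F y"
    unfolding add[OF assms(2) m] scale[OF assms(3)] by (rule refl)
  then show "P F (x - y) = P F x - P F y" by simp
qed

definition bounded_by :: "real \<Rightarrow> 'v set \<Rightarrow> bool" where
  "bounded_by r F \<longleftrightarrow> F \<in> \<F> \<and> (\<forall>x\<in>E. norm (P F x) \<le> r * norm x)"

text \<open>Directedness turns the sequence into an increasing chain above it, and the closure of
  its union is again a member: finite directedness improves to countable directedness.\<close>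

lemma upper_bound:
  fixes G :: "nat \<Rightarrow> 'v set"
  assumes "\<And>n. G n \<in> \<F>"
  shows "\<exists>H\<in>\<F>. \<forall>n. G n \<subseteq> H"
proof -
  have "\<exists>S. \<forall>n. (S n \<in> \<F> \<and> G n \<subseteq> S n) \<and> S n \<subseteq> S (Suc n)"
  proof (rule dependent_nat_choice)
    show "\<exists>H. H \<in> \<F> \<and> G 0 \<subseteq> H" using assms by blast
    show "\<exists>K. (K \<in> \<F> \<and> G (Suc n) \<subseteq> K) \<and> H \<subseteq> K" if "H \<in> \<F> \<and> G n \<subseteq> H" for H n
      using directed[OF assms[of "Suc n"], of H] that by blast
  qed
  then obtain S where S: "\<forall>n. (S n \<in> \<F> \<and> G n \<subseteq> S n) \<and> S n \<subseteq> S (Suc n)" ..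
  have "closure (\<Union>n. S n) \<in> \<F>" using S by (intro closure_chain) simp_all
  moreover have "G n \<subseteq> closure (\<Union>n. S n)" for n
    using S closure_subset[of "\<Union>n. S n"] by (meson UN_upper UNIV_I order_trans)
  ultimately show ?thesis by blast
qed

text \<open>Otherwise each n has a member \<open>F n\<close> contained in no member with bound n. A
  common upper bound of all \<open>F n\<close> has some bounded projection, hence bound n for a
  large n, contrary to the choice of \<open>F n\<close>.\<close>

lemma cofinal_bounded: "\<exists>r. \<forall>F\<in>\<F>. \<exists>G. bounded_by r G \<and> F \<subseteq> G"
proof (rule ccontr)
  assume "\<not> ?thesis"
  then have "\<forall>n. \<exists>F. F \<in> \<F> \<and> (\<forall>G. bounded_by (real n) G \<longrightarrow> \<not> F \<subseteq> G)" by blast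
  from choice[OF this] obtain F where
    F: "\<forall>n. F n \<in> \<F> \<and> (\<forall>G. bounded_by (real n) G \<longrightarrow> \<not> F n \<subseteq> G)" ..
  obtain H where H: "H \<in> \<F>" "\<forall>n. F n \<subseteq> H" using upper_bound[of F] F by auto
  obtain C where C: "\<forall>x\<in>E. norm (P H x) \<le> C * norm x"
    using projection[OF H(1)] unfolding projection_on_def bounded_linear_on_def by auto
  obtain n where n: "C \<le> real n" using real_arch_simple by blast
  have "norm (P H x) \<le> real n * norm x" if "x \<in> E" for x
    using bspec[OF C that] mult_right_mono[OF n norm_ge_zero[of x]] by simp
  then have "bounded_by (real n) H" using H(1) by (simp add: bounded_by_def)
  then show False using F H(2) by blast
qed

lemma bounded_upper_bound:
  assumes r: "\<And>F. F \<in> \<F> \<Longrightarrow> \<exists>G. bounded_by r G \<and> F \<subseteq> G"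
    and G: "countable \<G>" "\<G> \<subseteq> \<F>" and Z: "countable Z" "Z \<subseteq> E"
  shows "\<exists>F. bounded_by r F \<and> (\<forall>G\<in>\<G>. G \<subseteq> F) \<and> Z \<subseteq> F"
proof -
  have "\<forall>z\<in>Z. \<exists>F. F \<in> \<F> \<and> z \<in> F" using Z(2) cover by blast
  from bchoice[OF this] obtain f where f: "\<forall>z\<in>Z. f z \<in> \<F> \<and> z \<in> f z" ..
  obtain F0 where "F0 \<in> \<F>" using cover subspace_0[OF subspace] by blast
  define \<H> where "\<H> = insert F0 (\<G> \<union> f ` Z)"
  have H: "\<H> \<subseteq> \<F>" "\<H> \<noteq> {}" "countable \<H>" using G Z f \<open>F0 \<in> \<F>\<close> by (auto simp: \<H>_def)
  then have "from_nat_into \<H> n \<in> \<F>" for n using from_nat_into[OF H(2), of n] by blast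
  then obtain H where "H \<in> \<F>" "\<forall>n. from_nat_into \<H> n \<subseteq> H" using upper_bound by metis
  moreover obtain F where F: "bounded_by r F" "H \<subseteq> F" using r[OF \<open>H \<in> \<F>\<close>] by blast
  ultimately have up: "G \<subseteq> F" if "G \<in> \<H>" for G
    using that range_from_nat_into[OF H(2,3)] by (metis order_trans rangeE)
  have "Z \<subseteq> F"
  proof
    fix z assume z: "z \<in> Z"
    then have "f z \<subseteq> F" by (intro up) (simp add: \<H>_def)
    then show "z \<in> F" using f z by blast
  qed
  then show ?thesis using F(1) up unfolding \<H>_def by blast
qed

text \<open>With H the closure of the union, compatibility gives
  \<open>P (S n) x = P (S n) (P H x)\<close>. A vector of some \<open>S N\<close> close to
  \<open>P H x\<close> is fixed by all later projections, and the common bound r controls the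
  remaining error.\<close>

lemma chain_limit:
  assumes S: "\<And>n. bounded_by r (S n)" "\<And>n. S n \<subseteq> S (Suc n)"
  shows "bounded_by r (closure (\<Union>n. S n))"
    "x \<in> E \<Longrightarrow> (\<lambda>n. P (S n) x) \<longlonglongrightarrow> P (closure (\<Union>n. S n)) x"
proof -
  let ?H = "closure (\<Union>n. S n)"
  have SF: "S n \<in> \<F>" for n using S(1) by (simp add: bounded_by_def)
  have H: "?H \<in> \<F>" using S SF by (intro closure_chain)
  have SH: "S n \<subseteq> ?H" for n by (rule order_trans[OF UN_upper[OF UNIV_I] closure_subset])
  have lim: "(\<lambda>n. P (S n) x) \<longlonglongrightarrow> P ?H x" if x: "x \<in> E" for x
  proof (rule LIMSEQ_I)
    fix e :: real assume e: "e > 0"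
    define \<delta> where "\<delta> = e / (\<bar>r\<bar> + 2)"
    have \<delta>: "\<delta> > 0" using e by (simp add: \<delta>_def add_nonneg_pos)
    obtain u N where u: "u \<in> S N" "dist u (P ?H x) < \<delta>"
      using P_in[OF H x] \<delta> unfolding closure_approachable by blast
    have uE: "u \<in> E" and HE: "P ?H x \<in> E" using u(1) subset[OF SF] subset[OF H] P_in[OF H x] by blast+
    have "norm (P (S n) x - P ?H x) < e" if n: "n \<ge> N" for n
    proof -
      have "S N \<subseteq> S n" using S(2) n by (rule lift_Suc_mono_le)
      then have "P (S n) u = u" using u(1) by (intro P_id[OF SF]) blast
      then have eq: "P (S n) x - P ?H x = P (S n) (P ?H x - u) + (u - P ?H x)"
        using P_linear(3)[OF SF HE uE] compatible[OF SF H SH x, of n] by simp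
      have "norm (P (S n) x - P ?H x) \<le> norm (P (S n) (P ?H x - u)) + norm (u - P ?H x)"
        unfolding eq by (rule norm_triangle_ineq)
      also have "norm (P (S n) (P ?H x - u)) \<le> r * norm (P ?H x - u)"
        using S(1) subspace_diff[OF subspace HE uE] by (simp add: bounded_by_def)
      also have "r * norm (P ?H x - u) \<le> \<bar>r\<bar> * \<delta>"
        using u(2) by (intro mult_mono) (auto simp: dist_norm norm_minus_commute)
      also have "\<bar>r\<bar> * \<delta> + norm (u - P ?H x) < \<bar>r\<bar> * \<delta> + 2 * \<delta>"
        using u(2) \<delta> by (simp add: dist_norm)
      also have "\<dots> = (\<bar>r\<bar> + 2) * \<delta>" by (simp add: algebra_simps)
      also have "\<dots> = e"
      proof -
        have "\<bar>r\<bar> + 2 \<noteq> 0" using abs_ge_zero[of r] by linarith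
        then show ?thesis by (simp add: \<delta>_def)
      qed
      finally show ?thesis by simp
    qed
    then show "\<exists>N. \<forall>n\<ge>N. norm (P (S n) x - P ?H x) < e" by blast
  qed
  then show "x \<in> E \<Longrightarrow> (\<lambda>n. P (S n) x) \<longlonglongrightarrow> P ?H x" .
  have "norm (P ?H x) \<le> r * norm x" if "x \<in> E" for x
    using S(1) that
    by (intro tendsto_upperbound[OF tendsto_norm[OF lim[OF that]]]) (simp_all add: bounded_by_def)
  then show "bounded_by r ?H" using H by (simp add: bounded_by_def)
qed

end

section \<open>Projectional skeletons of C(K)\<close>

lemma val_tendsto: "(u \<longlonglongrightarrow> f) \<Longrightarrow> (\<lambda>n. val (u n) p) \<longlonglongrightarrow> val f p"
  by (rule bounded_linear.tendsto[OF bounded_linear_eval_bcontfun])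

locale K_skeleton = projectional_skeleton "CK \<A>" \<F> P
  for \<A> :: "'a set set" and \<F> P +
  fixes r :: real
  assumes ad: "almost_disjoint_countable \<A>"
    and cofinal: "F \<in> \<F> \<Longrightarrow> \<exists>G. bounded_by r G \<and> F \<subseteq> G"
begin

text \<open>In other words, for y in Y the functional taking f to
  \<open>val (P F f) (Point y) - val f (Point y)\<close> vanishes on all point functions. This is
  what makes it nonzero on only countably many of the functions
  \<open>set_function A\<close>.\<close>

definition reproduces :: "('a kpoint discrete \<Rightarrow>\<^sub>C real) set \<Rightarrow> 'a set \<Rightarrow> bool" where
  "reproduces F Y \<longleftrightarrow> bounded_by r F \<and> countable Y \<and> Y \<subseteq> \<Union>\<A> \<and>
     (\<forall>y\<in>Y. \<forall>z\<in>\<Union>\<A>. val (P F (point_function z)) (Point y) = val (point_function z) (Point y))"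

lemma bounded_linear_on_val_P:
  assumes "F \<in> \<F>"
  shows "bounded_linear_on (CK \<A>) UNIV (\<lambda>f. val (P F f) p)"
proof -
  obtain C where C: "\<forall>f\<in>CK \<A>. norm (P F f) \<le> C * norm f"
    using projection[OF assms] unfolding projection_on_def bounded_linear_on_def by auto
  then show ?thesis
    unfolding bounded_linear_on_def using P_linear[OF assms]
    by (auto intro!: exI[of _ C] intro: order_trans[OF val_le_norm])
qed

lemma bounded_linear_on_val_P_diff:
  assumes "F \<in> \<F>"
  shows "bounded_linear_on (CK \<A>) UNIV (\<lambda>f. val (P F f) p - val f p)"
proof -
  obtain C where C: "\<forall>f\<in>CK \<A>. norm (val (P F f) p) \<le> C * norm f"
    using bounded_linear_on_val_P[OF assms, of p] unfolding bounded_linear_on_def by auto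
  have "norm (val (P F f) p - val f p) \<le> (C + 1) * norm f" if "f \<in> CK \<A>" for f
    using bspec[OF C that] val_le_norm[of f p] by (simp add: algebra_simps)
  then show ?thesis
    using bounded_linear_on_val_P[OF assms, of p] unfolding bounded_linear_on_def
    by (auto intro!: exI[of _ "C + 1"] simp: algebra_simps)
qed

text \<open>A chain whose successor steps absorb the points where the projections move a point
  function; in the limit no such point is left.\<close>

lemma ex_reproduces:
  assumes G: "countable \<G>" "\<G> \<subseteq> \<F>" and Y0: "countable Y0" "Y0 \<subseteq> \<Union>\<A>"
  shows "\<exists>F Y. reproduces F Y \<and> (\<forall>G\<in>\<G>. G \<subseteq> F) \<and> Y0 \<subseteq> Y"
proof -
  \<comment> \<open>For z outside Y the correct value at points of Y is 0, so nonzero values are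
    collected, and these are countably many by the l1 bound. Points that have been absorbed are
    harmless because their functions lie in the space and are fixed.\<close>
  define moved where "moved F Y = {z\<in>\<Union>\<A>. \<exists>y\<in>Y. val (P F (point_function z)) (Point y) \<noteq> 0}" for F Y
  define valid where "valid FY \<longleftrightarrow> bounded_by r (fst FY) \<and> countable (snd FY) \<and> snd FY \<subseteq> \<Union>\<A> \<and>
      point_function ` snd FY \<subseteq> fst FY" for FY
  have extend: "\<exists>F. bounded_by r F \<and> (\<forall>G\<in>\<H>. G \<subseteq> F) \<and> point_function ` Y \<subseteq> F"
    if "countable \<H>" "\<H> \<subseteq> \<F>" "countable Y" "Y \<subseteq> \<Union>\<A>" for \<H> Y
    using that point_function_in[OF ad] by (intro bounded_upper_bound cofinal) auto
  let ?start = "\<lambda>S. valid S \<and> (\<forall>G\<in>\<G>. G \<subseteq> fst S) \<and> Y0 \<subseteq> snd S"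
  let ?step = "\<lambda>S T. fst S \<subseteq> fst T \<and> snd S \<subseteq> snd T \<and> moved (fst S) (snd S) \<subseteq> snd T"
  have "\<exists>S. \<forall>n. ?start (S n) \<and> ?step (S n) (S (Suc n))"
  proof (rule dependent_nat_choice)
    obtain F where "bounded_by r F \<and> (\<forall>G\<in>\<G>. G \<subseteq> F) \<and> point_function ` Y0 \<subseteq> F"
      using extend[OF G Y0] ..
    then show "\<exists>S. ?start S"
      using Y0 by (intro exI[of _ "(F, Y0)"]) (simp add: valid_def)
  next
    fix S n assume S: "?start S"
    define F Y where "F = fst S" and "Y = snd S"
    have FY: "bounded_by r F" "F \<in> \<F>" "countable Y" "Y \<subseteq> \<Union>\<A>"
      using S by (auto simp: valid_def F_def Y_def bounded_by_def)
    have "moved F Y = (\<Union>y\<in>Y. {z\<in>\<Union>\<A>. val (P F (point_function z)) (Point y) \<noteq> 0})"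
      by (auto simp: moved_def)
    then have "countable (moved F Y)"
      using countable_functional_nonzero_point[OF ad bounded_linear_on_val_P[OF FY(2)]] FY(3)
      by (simp add: countable_UN)
    then have Y': "countable (Y \<union> moved F Y)" "Y \<union> moved F Y \<subseteq> \<Union>\<A>"
      using FY(3,4) by (auto simp: moved_def)
    obtain F' where F': "bounded_by r F' \<and> (\<forall>G\<in>{F}. G \<subseteq> F') \<and> point_function ` (Y \<union> moved F Y) \<subseteq> F'"
      using extend[of "{F}", OF _ _ Y'] FY(2) by auto
    have "\<forall>G\<in>\<G>. G \<subseteq> F'" using S F' unfolding F_def by (meson order_trans singletonI)
    with F' show "\<exists>T. ?start T \<and> ?step S T"
      using S Y' unfolding F_def Y_def
      by (intro exI[of _ "(F', snd S \<union> moved (fst S) (snd S))"]) (simp add: valid_def le_supI1)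
  qed
  then obtain S where S: "\<forall>n. ?start (S n) \<and> ?step (S n) (S (Suc n))" ..
  define F where "F n = fst (S n)" for n
  define Y where "Y n = snd (S n)" for n
  have F: "bounded_by r (F n)" "F n \<subseteq> F (Suc n)" and Fpt: "point_function ` Y n \<subseteq> F n" for n
    using S by (auto simp: F_def Y_def valid_def)
  have Y: "countable (Y n)" "Y n \<subseteq> \<Union>\<A>" "Y n \<subseteq> Y (Suc n)" "moved (F n) (Y n) \<subseteq> Y (Suc n)" for n
    using S by (auto simp: F_def Y_def valid_def)
  have Ymono: "Y m \<subseteq> Y n" if "m \<le> n" for m n using Y(3) that by (rule lift_Suc_mono_le)
  define H where "H = closure (\<Union>n. F n)"
  have FH: "F n \<subseteq> H" for n
    unfolding H_def by (rule order_trans[OF UN_upper[OF UNIV_I] closure_subset])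
  have H: "bounded_by r H" unfolding H_def using F by (rule chain_limit(1))
  have fixed: "val (P H (point_function z)) (Point y) = val (point_function z) (Point y)"
    if y: "y \<in> Y m" and z: "z \<in> \<Union>\<A>" for m y z
  proof (cases "\<exists>n. z \<in> Y n")
    case True
    then have "point_function z \<in> H" using Fpt FH by blast
    then show ?thesis using P_id[of H] H by (simp add: bounded_by_def)
  next
    case False
    have lim: "(\<lambda>n. val (P (F n) (point_function z)) (Point y)) \<longlonglongrightarrow> val (P H (point_function z)) (Point y)"
      unfolding H_def using F point_function_in[OF ad z] by (intro val_tendsto chain_limit(2))
    have "val (P (F n) (point_function z)) (Point y) = 0" if "n \<ge> m" for n
    proof -
      have "z \<notin> moved (F n) (Y n)" using False Y(4) by blast
      then show ?thesis using z y Ymono[OF that] by (auto simp: moved_def)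
    qed
    then have "\<forall>\<^sub>F n in sequentially. val (P (F n) (point_function z)) (Point y) = 0"
      by (rule eventually_sequentiallyI)
    then have "(\<lambda>n. val (P (F n) (point_function z)) (Point y)) \<longlonglongrightarrow> 0" by (rule tendsto_eventually)
    then have "val (P H (point_function z)) (Point y) = 0" using lim LIMSEQ_unique by blast
    moreover have "y \<noteq> z" using False y by blast
    ultimately show ?thesis by simp
  qed
  have "reproduces H (\<Union>n. Y n)"
    unfolding reproduces_def
  proof (intro conjI ballI)
    show "bounded_by r H" by (rule H)
    show "countable (\<Union>n. Y n)" by (intro countable_UN[OF countableI_type] Y(1))
    show "(\<Union>n. Y n) \<subseteq> \<Union>\<A>" by (intro UN_least Y(2))
    fix y z assume "y \<in> (\<Union>n. Y n)" "z \<in> \<Union>\<A>"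
    then show "val (P H (point_function z)) (Point y) = val (point_function z) (Point y)"
      by (elim UN_E) (rule fixed)
  qed
  moreover have "\<forall>G\<in>\<G>. G \<subseteq> F 0" "Y0 \<subseteq> Y 0" using S by (simp_all add: F_def Y_def)
  then have "\<forall>G\<in>\<G>. G \<subseteq> H" "Y0 \<subseteq> (\<Union>n. Y n)" using FH[of 0] by (blast intro: subset_trans)+
  ultimately show ?thesis by blast
qed

lemma countable_moved_sets:
  assumes "reproduces F Y"
  shows "countable {A\<in>\<A>. \<exists>y\<in>Y. val (P F (set_function A)) (Point y) \<noteq> val (set_function A) (Point y)}"
proof -
  have F: "F \<in> \<F>" and Y: "countable Y" "Y \<subseteq> \<Union>\<A>"
    and rep: "\<forall>y\<in>Y. \<forall>z\<in>\<Union>\<A>. val (P F (point_function z)) (Point y) = val (point_function z) (Point y)"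
    using assms by (auto simp: reproduces_def bounded_by_def)
  have "countable {A\<in>\<A>. val (P F (set_function A)) (Point y) - val (set_function A) (Point y) \<noteq> 0}"
    if "y \<in> Y" for y
  proof (rule countable_functional_nonzero_set[OF ad bounded_linear_on_val_P_diff[OF F]])
    show "val (P F (point_function z)) (Point y) - val (point_function z) (Point y) = 0" if z: "z \<in> \<Union>\<A>" for z
      using bspec[OF bspec[OF rep \<open>y \<in> Y\<close>] z] by simp
  qed
  then have "countable (\<Union>y\<in>Y. {A\<in>\<A>. val (P F (set_function A)) (Point y) - val (set_function A) (Point y) \<noteq> 0})"
    using Y(1) by (intro countable_UN)
  then show ?thesis by (rule countable_subset[rotated]) auto
qed

text \<open>Evaluations are continuous, so a countable dense set of functions separates whatever F
  separates, and each function separates only countably many limits from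
  \<open>Infinity\<close>.\<close>

lemma countable_separated_limits:
  assumes "F \<in> \<F>"
  shows "countable {A\<in>\<A>. \<exists>f\<in>F. val f (Limit A) \<noteq> val f Infinity}"
proof -
  obtain D where D: "countable D" "D \<subseteq> F" "F \<subseteq> closure D"
    using separable[OF assms] unfolding separable_space_def
    by (auto simp: closure_of_subtopology Int_absorb1)
  have "countable (\<Union>f\<in>D. {A\<in>\<A>. val f (Limit A) \<noteq> val f Infinity})"
    using D(1,2) subset[OF assms]
    by (intro countable_UN countable_limits_ne_infinity[OF ad] C_spaceD(1)) auto
  moreover have "{A\<in>\<A>. \<exists>f\<in>F. val f (Limit A) \<noteq> val f Infinity} \<subseteq>
      (\<Union>f\<in>D. {A\<in>\<A>. val f (Limit A) \<noteq> val f Infinity})"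
  proof
    fix A assume "A \<in> {A\<in>\<A>. \<exists>f\<in>F. val f (Limit A) \<noteq> val f Infinity}"
    then obtain f where A: "A \<in> \<A>" "f \<in> F" "val f (Limit A) \<noteq> val f Infinity" by blast
    have "f \<in> closure D" using D(3) A(2) by (rule subsetD)
    then obtain d where "(\<forall>n. d n \<in> D) \<and> d \<longlonglongrightarrow> f" unfolding closure_sequential ..
    then have d: "d n \<in> D" "d \<longlonglongrightarrow> f" for n by simp_all
    have "\<exists>n. val (d n) (Limit A) \<noteq> val (d n) Infinity"
    proof (rule ccontr)
      assume "\<not> ?thesis"
      then have "(\<lambda>n. val (d n) (Limit A)) = (\<lambda>n. val (d n) Infinity)" by auto
      then show False
        using LIMSEQ_unique[OF val_tendsto[OF d(2), of "Limit A"]] val_tendsto[OF d(2), of Infinity] A(3) by simp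
    qed
    then show "A \<in> (\<Union>f\<in>D. {A\<in>\<A>. val f (Limit A) \<noteq> val f Infinity})" using A(1) d(1) by blast
  qed
  ultimately show ?thesis by (rule countable_subset[rotated])
qed

theorem essentially_disjoint: "essentially_disjoint \<A>"
proof -
  \<comment> \<open>The choice is made by recursion over finite sets because the space for s must
    contain those for its proper subsets. This monotonicity turns the spaces along an enumeration of
    S into a chain.\<close>
  let ?R = "\<lambda>f s FY. finite s \<longrightarrow> reproduces (fst FY) (snd FY) \<and> \<Union>(s \<inter> \<A>) \<subseteq> snd FY \<and>
      (\<forall>t. t \<subset> s \<longrightarrow> fst (f t) \<subseteq> fst FY)"
  have "\<exists>f. \<forall>s. ?R f s (f s)"
  proof (rule dependent_wf_choice[OF wf_finite_psubset])
    show "?R f s FY = ?R g s FY" if "\<And>t. (t, s) \<in> finite_psubset \<Longrightarrow> f t = g t"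
      for f g :: "'a set set \<Rightarrow> ('a kpoint discrete \<Rightarrow>\<^sub>C real) set \<times> 'a set" and s FY
    proof (cases "finite s")
      case True
      then have "f t = g t" if "t \<subset> s" for t
        using that by (intro \<open>\<And>t. (t, s) \<in> finite_psubset \<Longrightarrow> f t = g t\<close>) simp
      then show ?thesis by simp
    qed simp
  next
    fix s and f :: "'a set set \<Rightarrow> ('a kpoint discrete \<Rightarrow>\<^sub>C real) set \<times> 'a set"
    assume IH: "\<And>t. (t, s) \<in> finite_psubset \<Longrightarrow> ?R f t (f t)"
    show "\<exists>FY. ?R f s FY"
    proof (cases "finite s")
      case True
      have IH': "reproduces (fst (f t)) (snd (f t))" if "t \<subset> s" for t
        using IH[of t] True that finite_subset[of t s] by auto
      have "finite {t. t \<subset> s}" using True by (rule rev_finite_subset[OF finite_Pow_iff[THEN iffD2]]) auto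
      then have G: "countable ((\<lambda>t. fst (f t)) ` {t. t \<subset> s})" "(\<lambda>t. fst (f t)) ` {t. t \<subset> s} \<subseteq> \<F>"
        using IH' by (auto simp: countable_finite reproduces_def bounded_by_def)
      have "countable (\<Union>A\<in>s \<inter> \<A>. A)"
        using True almost_disjoint_countableD(1)[OF ad] by (intro countable_UN) (simp_all add: countable_finite)
      then have Y: "countable (\<Union>(s \<inter> \<A>))" "\<Union>(s \<inter> \<A>) \<subseteq> \<Union>\<A>" by auto
      from ex_reproduces[OF G Y] obtain F Y where
        FY: "reproduces F Y \<and> (\<forall>G\<in>(\<lambda>t. fst (f t)) ` {t. t \<subset> s}. G \<subseteq> F) \<and> \<Union>(s \<inter> \<A>) \<subseteq> Y"
        by (elim exE)
      then show ?thesis by (intro exI[of _ "(F, Y)"]) simp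
    qed simp
  qed
  then obtain f where f: "\<forall>s. ?R f s (f s)" ..
  define G where "G s = fst (f s)" for s
  define Y where "Y s = snd (f s)" for s
  have rep: "reproduces (G s) (Y s)" and sY: "\<Union>(s \<inter> \<A>) \<subseteq> Y s" if "finite s" for s
    using f that by (simp_all add: G_def Y_def)
  have GF: "G s \<in> \<F>" "bounded_by r (G s)" if "finite s" for s
    using rep[OF that] by (simp_all add: reproduces_def bounded_by_def)
  have G_mono: "G t \<subseteq> G s" if "finite s" "t \<subseteq> s" for s t
    using f that by (cases "t = s") (auto simp: G_def)
  define \<phi> where "\<phi> s = {A\<in>\<A>. \<exists>y\<in>Y s. val (P (G s) (set_function A)) (Point y) \<noteq> val (set_function A) (Point y)} \<union>
      {A\<in>\<A>. \<exists>f\<in>G s. val f (Limit A) \<noteq> val f Infinity}" for s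
  show ?thesis
  proof (rule essentially_disjoint_if_closed_good[OF ad])
    show "countable (\<phi> s)" if "finite s" for s
      unfolding \<phi>_def using rep[OF that] GF(1)[OF that]
      by (intro countable_Un countable_moved_sets countable_separated_limits)
    show "\<phi> s \<subseteq> \<A>" for s by (auto simp: \<phi>_def)
    fix S A assume S: "countable S" "infinite S" "S \<subseteq> \<A>" "closed_under \<phi> S" and A: "A \<in> \<A> - S"
    then have A\<A>: "A \<in> \<A>" "A \<notin> S" by simp_all
    have notin: "A \<notin> \<phi> s" if "finite s" "s \<subseteq> S" for s
      using S(4)[unfolded closed_under_def, rule_format, of s] that A\<A>(2) by blast
    define a where "a = from_nat_into S"
    have a: "range a = S" unfolding a_def using S(1,2) by (intro range_from_nat_into) auto
    define s where "s n = a ` {..n}" for n :: nat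
    have s: "finite (s n)" "s n \<subseteq> S" "s n \<subseteq> s (Suc n)" for n using a by (auto simp: s_def)
    define H where "H = closure (\<Union>n. G (s n))"
    have chain: "bounded_by r (G (s n))" "G (s n) \<subseteq> G (s (Suc n))" for n
      using GF(2)[OF s(1)] G_mono[OF s(1) s(3)] by simp_all
    have H: "H \<in> \<F>" unfolding H_def using chain_limit(1)[of r "\<lambda>n. G (s n)"] chain by (simp add: bounded_by_def)
    define f where "f = P H (set_function A)"
    have fH: "f \<in> H" unfolding f_def by (intro P_in[OF H] set_function_in[OF ad] A\<A>(1))
    have cont: "continuous_on_K \<A> (val f)"
      using fH subset[OF H] by (intro C_spaceD(1)) blast
    \<comment> \<open>Once the member around y has been enumerated, y belongs to
      \<open>Y (s n)\<close>; as A is not in \<open>\<phi> (s n)\<close>, the projection of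
      \<open>set_function A\<close> is correct at y from then on.\<close>
    have f_S: "val f (Point y) = of_bool (y \<in> A)" if y: "y \<in> \<Union>S" for y
    proof -
      let ?v = "\<lambda>n. val (P (G (s n)) (set_function A)) (Point y)"
      obtain k where k: "y \<in> a k" using y a by blast
      have "?v n = of_bool (y \<in> A)" if "n \<ge> k" for n
      proof -
        have "a k \<in> s n \<inter> \<A>" using that s(2)[of n] S(3) by (auto simp: s_def)
        then have "y \<in> Y (s n)" using sY[OF s(1), of n] k by blast
        then have "?v n = val (set_function A) (Point y)"
          using notin[OF s(1,2), of n] A\<A>(1) unfolding \<phi>_def by blast
        then show ?thesis by auto
      qed
      then have "\<forall>\<^sub>F n in sequentially. ?v n = of_bool (y \<in> A)"
        by (rule eventually_sequentiallyI)
      then have "?v \<longlonglongrightarrow> of_bool (y \<in> A)"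
        by (rule tendsto_eventually)
      moreover have "?v \<longlonglongrightarrow> val f (Point y)"
        unfolding f_def H_def using chain
        by (intro val_tendsto chain_limit(2) set_function_in[OF ad] A\<A>(1))
      ultimately show ?thesis using LIMSEQ_unique by blast
    qed
    have f_A: "val f (Limit A) = val f Infinity"
    proof -
      obtain d where "(\<forall>n. d n \<in> (\<Union>n. G (s n))) \<and> d \<longlonglongrightarrow> f"
        using fH unfolding H_def closure_sequential ..
      then have d: "d n \<in> (\<Union>n. G (s n))" "d \<longlonglongrightarrow> f" for n by simp_all
      have "val (d n) (Limit A) = val (d n) Infinity" for n
      proof -
        obtain m where "d n \<in> G (s m)" using d(1)[of n] by blast
        then show ?thesis using notin[OF s(1,2), of m] A\<A>(1) unfolding \<phi>_def by blast
      qed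
      then show ?thesis
        using LIMSEQ_unique[OF val_tendsto[OF d(2), of "Limit A"]] val_tendsto[OF d(2), of Infinity] by simp
    qed
    \<comment> \<open>Along B the function f vanishes off the finite set
      \<open>B \<inter> A\<close>, so its limit there is 0.\<close>
    have f_B: "val f (Limit B) = 0" if B: "B \<in> S" for B
    proof (rule ccontr)
      assume ne: "val f (Limit B) \<noteq> 0"
      have "finite {x\<in>B. \<bar>val f (Limit B)\<bar> \<le> \<bar>val f (Point x) - val f (Limit B)\<bar>}"
        using cont B S(3) ne unfolding continuous_map_K_space_iff[OF ad] by auto
      moreover have "finite (B \<inter> A)"
        using B S(3) A\<A> by (intro almost_disjoint_countableD(3)[OF ad]) auto
      moreover have "B \<subseteq> {x\<in>B. \<bar>val f (Limit B)\<bar> \<le> \<bar>val f (Point x) - val f (Limit B)\<bar>} \<union> (B \<inter> A)"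
      proof
        fix x assume x: "x \<in> B"
        then have "val f (Point x) = of_bool (x \<in> A)" using B by (intro f_S) blast
        then show "x \<in> {x\<in>B. \<bar>val f (Limit B)\<bar> \<le> \<bar>val f (Point x) - val f (Limit B)\<bar>} \<union> (B \<inter> A)"
          using x by auto
      qed
      ultimately have "finite B" by (meson finite_Un finite_subset)
      moreover have "infinite B" using B S(3) by (intro almost_disjoint_countableD(2)[OF ad]) blast
      ultimately show False by blast
    qed
    \<comment> \<open>The infinitely many limits of members of S, where f is 0, accumulate at
      \<open>Infinity\<close>; this uses that S is infinite.\<close>
    have "val f Infinity = 0"
    proof (rule ccontr)
      assume "val f Infinity \<noteq> 0"
      then have "finite {B\<in>\<A>. \<bar>val f Infinity\<bar> \<le> \<bar>val f (Limit B) - val f Infinity\<bar>}"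
        by (intro finite_limits_far_from_infinity[OF ad cont]) simp
      moreover have "S \<subseteq> {B\<in>\<A>. \<bar>val f Infinity\<bar> \<le> \<bar>val f (Limit B) - val f Infinity\<bar>}"
        using f_B S(3) by auto
      ultimately show False using S(2) finite_subset by blast
    qed
    then have "val f (Limit A) = 0" using f_A by simp
    have "finite {x\<in>A. 1 \<le> \<bar>val f (Point x) - val f (Limit A)\<bar>}"
      using cont[unfolded continuous_map_K_space_iff[OF ad], THEN conjunct1, rule_format, OF A\<A>(1) zero_less_one] .
    moreover have "A \<inter> \<Union>S \<subseteq> {x\<in>A. 1 \<le> \<bar>val f (Point x) - val f (Limit A)\<bar>}"
    proof
      fix x assume "x \<in> A \<inter> \<Union>S"
      then have "x \<in> A" "val f (Point x) = 1" using f_S[of x] by simp_all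
      then show "x \<in> {x\<in>A. 1 \<le> \<bar>val f (Point x) - val f (Limit A)\<bar>}" using \<open>val f (Limit A) = 0\<close> by simp
    qed
    ultimately show "finite (A \<inter> \<Union>S)" by (meson finite_subset)
  qed
qed

end

theorem essentially_disjoint_if_projectional_skeleton:
  assumes ad: "almost_disjoint_countable \<A>" and sk: "has_projectional_skeleton (CK \<A>)"
  shows "essentially_disjoint \<A>"
proof -
  let ?E = "CK \<A>"
  obtain \<F> and P where sk':
      "\<forall>F\<in>\<F>. complemented_in ?E F \<and> separable_space (top_of_set F)" "?E = \<Union>\<F>"
      "\<forall>F\<in>\<F>. \<forall>G\<in>\<F>. \<exists>H\<in>\<F>. F \<subseteq> H \<and> G \<subseteq> H"
      "\<forall>S :: nat \<Rightarrow> _ set. (\<forall>n. S n \<in> \<F>) \<and> (\<forall>n. S n \<subseteq> S (Suc n)) \<longrightarrow> closure (\<Union>n. S n) \<in> \<F>"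
      "\<forall>F\<in>\<F>. projection_on ?E (P F) \<and> P F ` ?E = F"
      "\<forall>F\<in>\<F>. \<forall>G\<in>\<F>. F \<subseteq> G \<longrightarrow> (\<forall>x\<in>?E. P F (P G x) = P F x \<and> P G (P F x) = P F x)"
    using sk unfolding has_projectional_skeleton_def by (elim exE conjE)
  interpret projectional_skeleton ?E \<F> P
  proof
    show "subspace ?E" by (rule subspace_C_space)
    show "?E = \<Union>\<F>" by (rule sk'(2))
    show "separable_space (top_of_set F)" "projection_on ?E (P F)" "P F ` ?E = F" if "F \<in> \<F>" for F
      using bspec[OF sk'(1) that] bspec[OF sk'(5) that] by blast+
    show "\<exists>H\<in>\<F>. F \<subseteq> H \<and> G \<subseteq> H" if "F \<in> \<F>" "G \<in> \<F>" for F G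
      using bspec[OF bspec[OF sk'(3) that(1)] that(2)] .
    show "closure (\<Union>n. S n) \<in> \<F>" if "\<And>n. S n \<in> \<F>" "\<And>n. S n \<subseteq> S (Suc n)" for S :: "nat \<Rightarrow> _ set"
      using sk'(4) that by blast
    show "P F (P G x) = P F x" if "F \<in> \<F>" "G \<in> \<F>" "F \<subseteq> G" "x \<in> ?E" for F G x
      using bspec[OF bspec[OF sk'(6) that(1)] that(2)] that(3,4) by blast
  qed
  obtain r where "\<forall>F\<in>\<F>. \<exists>G. bounded_by r G \<and> F \<subseteq> G" using cofinal_bounded ..
  then interpret K_skeleton \<A> \<F> P r by unfold_locales (use ad in simp_all)
  show ?thesis by (rule essentially_disjoint)
qed

section \<open>Consequences of disjointness modulo finite sets\<close>

text \<open>An l1 bound C leaves room for at most C / e values of size e. This smallness of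
  functionals on unit functions is behind the weak continuity of the embedding of K.\<close>

lemma finite_functional_unit_large:
  fixes \<phi> :: "('i discrete \<Rightarrow>\<^sub>C real) \<Rightarrow> real"
  assumes \<phi>: "bounded_linear \<phi>" and e: "e > 0"
  shows "finite {i. e \<le> \<bar>\<phi> (unit_function i)\<bar>}"
proof -
  obtain B where "\<forall>f. norm (\<phi> f) \<le> norm f * B" using bounded_linear.bounded[OF \<phi>] ..
  then have "bounded_linear_on UNIV UNIV \<phi>"
    unfolding bounded_linear_on_def using linear_simps[OF \<phi>] by (auto intro!: exI[of _ B] simp: mult.commute)
  from functional_unit_sums_bounded[OF this subspace_UNIV, of UNIV] obtain C where
    C: "\<forall>F. finite F \<longrightarrow> (\<Sum>i\<in>F. \<bar>\<phi> (unit_function i)\<bar>) \<le> C" by auto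
  show ?thesis
  proof (rule ccontr)
    assume "infinite {i. e \<le> \<bar>\<phi> (unit_function i)\<bar>}"
    then obtain F where F: "finite F" "card F = Suc (nat \<lceil>C / e\<rceil>)" "F \<subseteq> {i. e \<le> \<bar>\<phi> (unit_function i)\<bar>}"
      using infinite_arbitrarily_large by blast
    have "real (card F) * e \<le> (\<Sum>i\<in>F. \<bar>\<phi> (unit_function i)\<bar>)"
      using F(3) by (intro sum_bounded_below) auto
    then have "real (card F) * e \<le> C" using C F(1) by fastforce
    then have "real (card F) \<le> C / e" using e by (simp add: pos_le_divide_eq)
    then show False unfolding F(2) by linarith
  qed
qed

text \<open>The points of the space of a disjoint family are represented by the characteristic
  functions of the sets \<open>{x, c x}\<close>, \<open>{A}\<close> and \<open>{}\<close>.\<close>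

theorem eberlein_if_essentially_disjoint:
  fixes \<A> :: "'a set set"
  assumes ad: "almost_disjoint_countable \<A>" and ed: "essentially_disjoint \<A>"
  shows "eberlein_compact (K_space \<A>)"
proof -
  let ?X = "K_space \<A>"
  obtain c where c: "\<And>x. x \<in> \<Union>\<A> \<Longrightarrow> c x \<in> \<A> \<and> x \<in> c x"
    "\<And>A. A \<in> \<A> \<Longrightarrow> finite {x\<in>A. c x \<noteq> A}"
    using essentially_disjoint_selector[OF ed] by blast
  define u :: "'a kpoint \<Rightarrow> ('a kpoint \<times> 'a kpoint) discrete \<Rightarrow>\<^sub>C real"
    where "u p = unit_function (p, p)" for p
  define h where "h p = (case p of Point x \<Rightarrow> u (Point x) + u (Limit (c x)) | Limit A \<Rightarrow> u (Limit A) | Infinity \<Rightarrow> 0)" for p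
  have cont_functional: "continuous_map ?X euclideanreal (\<lambda>p. \<phi> (h p))" if \<phi>: "bounded_linear \<phi>" for \<phi>
  proof -
    interpret bounded_linear \<phi> by (rule \<phi>)
    have fin: "finite {p \<in> K_points \<A>. e \<le> \<bar>\<phi> (u p)\<bar>}" if "e > 0" for e
    proof (rule finite_imageD)
      show "finite ((\<lambda>p. (p, p)) ` {p \<in> K_points \<A>. e \<le> \<bar>\<phi> (u p)\<bar>})"
        by (rule finite_subset[OF _ finite_functional_unit_large[OF \<phi> that]]) (auto simp: u_def)
    qed (simp add: inj_on_def)
    \<comment> \<open>Composed with h, the functional is the cumulation of its values on unit
      functions, so its continuity is a case of the criterion for null functions. The value at
      \<open>Infinity\<close> must be 0, since it enters every sum and \<open>h Infinity\<close> is
      0.\<close>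
    define g where "g p = (if p = Infinity then 0 else \<phi> (u p))" for p
    have "\<phi> (h p) = cumulation c g p" for p
      by (cases p) (simp_all add: h_def cumulation_def g_def add zero)
    moreover have "finite {p \<in> K_points \<A>. e \<le> \<bar>g p\<bar>}" if "e > 0" for e
      by (rule finite_subset[OF _ fin[OF that]]) (use that in \<open>auto simp: g_def\<close>)
    then have "continuous_map ?X euclideanreal (cumulation c g)"
      by (intro continuous_map_cumulation[OF ad c])
    ultimately show ?thesis by simp
  qed
  have cont: "continuous_map ?X weak_topology h"
    unfolding weak_topology_def
  proof (rule continuous_on_generated_topo)
    fix V assume "V \<in> {\<phi> -` U | (\<phi> :: (('a kpoint \<times> 'a kpoint) discrete \<Rightarrow>\<^sub>C real) \<Rightarrow> real) U.
        bounded_linear \<phi> \<and> open U}"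
    then obtain \<phi> :: "(('a kpoint \<times> 'a kpoint) discrete \<Rightarrow>\<^sub>C real) \<Rightarrow> real" and U
      where V: "bounded_linear \<phi>" "open U" "V = \<phi> -` U" by auto
    have "openin ?X {p \<in> topspace ?X. \<phi> (h p) \<in> U}"
      by (rule openin_continuous_map_preimage[OF cont_functional[OF V(1)]]) (simp add: V(2))
    moreover have "{p \<in> topspace ?X. \<phi> (h p) \<in> U} = h -` V \<inter> topspace ?X"
      unfolding V(3) by auto
    ultimately show "openin ?X (h -` V \<inter> topspace ?X)" by simp
  next
    have "UNIV = (\<lambda>f::('a kpoint \<times> 'a kpoint) discrete \<Rightarrow>\<^sub>C real. 0::real) -` UNIV" by simp
    then show "h ` topspace ?X \<subseteq> \<Union>{\<phi> -` U | (\<phi> :: (('a kpoint \<times> 'a kpoint) discrete \<Rightarrow>\<^sub>C real) \<Rightarrow> real) U.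
        bounded_linear \<phi> \<and> open U}"
      using bounded_linear_zero open_UNIV by blast
  qed
  have inj: "inj_on h (topspace ?X)"
  proof (rule inj_onI)
    fix p q assume "h p = h q"
    then have eq: "val (h p) (s, s) = val (h q) (s, s)" for s by simp
    have v: "val (h p) (s, s) = (case p of Point x \<Rightarrow> of_bool (s = Point x) + of_bool (s = Limit (c x))
        | Limit A \<Rightarrow> of_bool (s = Limit A) | Infinity \<Rightarrow> 0)" for p s
      by (cases p) (simp_all add: h_def u_def)
    show "p = q"
      using eq[of p] eq[of q] unfolding v by (cases p; cases q) (auto split: if_splits)
  qed
  have W: "compactin weak_topology (h ` topspace ?X)"
    using image_compactin[OF _ cont] compact_space_K_space compact_space_def by blast
  have "homeomorphic_map ?X (subtopology weak_topology (h ` topspace ?X)) h"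
  proof (rule continuous_imp_homeomorphic_map)
    show "continuous_map ?X (subtopology weak_topology (h ` topspace ?X)) h"
      using cont by (auto simp: continuous_map_in_subtopology)
    show "Hausdorff_space (subtopology weak_topology (h ` topspace ?X))"
      by (rule Hausdorff_space_subtopology[OF Hausdorff_weak_topology_bcontfun])
  qed (use inj compact_space_K_space in auto)
  then show ?thesis
    unfolding eberlein_compact_def eberlein_in_def
    using W compact_space_K_space homeomorphic_map_imp_homeomorphic_space by blast
qed

section \<open>Transfer of the unit vector basis from the space of null functions\<close>

lemma has_sum_unit_functions:
  assumes f: "f \<in> c0_space \<Gamma>"
  shows "((\<lambda>i. val f i *\<^sub>R unit_function i) has_sum f) \<Gamma>"
  unfolding has_sum_iff_eps
proof (intro allI impI)
  fix e :: real assume e: "e > 0"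
  have zero: "val f i = 0" if "i \<notin> \<Gamma>" for i using f that by (simp add: c0_space_def)
  define F0 where "F0 = {i. e / 2 \<le> \<bar>val f i\<bar>}"
  have "e / 2 > 0" using e by simp
  then have F0: "finite F0" using f unfolding F0_def c0_space_def by blast
  have F0\<Gamma>: "F0 \<subseteq> \<Gamma>" using zero e by (force simp: F0_def)
  have "norm ((\<Sum>i\<in>F. val f i *\<^sub>R unit_function i) - f) < e" if F: "finite F" "F0 \<subseteq> F" "F \<subseteq> \<Gamma>" for F
  proof -
    have "norm ((\<Sum>i\<in>F. val f i *\<^sub>R unit_function i) - f) \<le> e / 2"
    proof (rule norm_le_val)
      fix j
      have "\<bar>val f j\<bar> \<le> e / 2" if "j \<notin> F"
      proof -
        have "j \<notin> F0" using F(2) that by blast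
        then show ?thesis by (simp add: F0_def)
      qed
      then show "\<bar>val ((\<Sum>i\<in>F. val f i *\<^sub>R unit_function i) - f) j\<bar> \<le> e / 2"
        using e by (cases "j \<in> F") (simp_all add: val_sum_unit_functions[OF F(1)])
    qed
    then show ?thesis using e by simp
  qed
  then show "\<exists>F0. finite F0 \<and> F0 \<subseteq> \<Gamma> \<and> (\<forall>F. finite F \<and> F0 \<subseteq> F \<and> F \<subseteq> \<Gamma> \<longrightarrow>
      norm ((\<Sum>i\<in>F. val f i *\<^sub>R unit_function i) - f) < e)"
    using F0 F0\<Gamma> by blast
qed

lemma subspace_c0_space: "subspace (c0_space \<Gamma>)"
proof (rule subspaceI)
  show "0 \<in> c0_space \<Gamma>" by (simp add: c0_space_def not_le)
next
  fix f g assume fg: "f \<in> c0_space \<Gamma>" "g \<in> c0_space \<Gamma>"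
  have "finite {i. e \<le> \<bar>val (f + g) i\<bar>}" if "e > 0" for e
  proof (rule finite_subset)
    show "{i. e \<le> \<bar>val (f + g) i\<bar>} \<subseteq> {i. e / 2 \<le> \<bar>val f i\<bar>} \<union> {i. e / 2 \<le> \<bar>val g i\<bar>}" by auto
    have "e / 2 > 0" using that by simp
    then show "finite ({i. e / 2 \<le> \<bar>val f i\<bar>} \<union> {i. e / 2 \<le> \<bar>val g i\<bar>})"
      using fg unfolding c0_space_def by blast
  qed
  then show "f + g \<in> c0_space \<Gamma>" using fg by (auto simp: c0_space_def)
next
  fix r f assume f: "f \<in> c0_space \<Gamma>"
  have "finite {i. e \<le> \<bar>val (r *\<^sub>R f) i\<bar>}" if e: "e > 0" for e
  proof (cases "r = 0")
    case False
    then have "{i. e \<le> \<bar>val (r *\<^sub>R f) i\<bar>} = {i. e / \<bar>r\<bar> \<le> \<bar>val f i\<bar>}"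
      by (auto simp: abs_mult field_simps)
    moreover have "e / \<bar>r\<bar> > 0" using e False by simp
    ultimately show ?thesis using f by (simp add: c0_space_def)
  qed (use e in simp)
  then show "r *\<^sub>R f \<in> c0_space \<Gamma>" using f by (simp add: c0_space_def)
qed

lemma unit_function_in: "i \<in> \<Gamma> \<Longrightarrow> unit_function i \<in> c0_space \<Gamma>"
  by (auto simp: c0_space_def intro: finite_subset[of _ "{i}"])

lemma bounded_linear_on_has_sum:
  assumes T: "bounded_linear_on E G T" and E: "subspace E" and f: "\<And>i. i \<in> I \<Longrightarrow> f i \<in> E"
    and x: "x \<in> E" and sum: "((\<lambda>i. a i *\<^sub>R f i) has_sum x) I"
  shows "((\<lambda>i. a i *\<^sub>R T (f i)) has_sum T x) I"
proof -
  obtain C where C: "\<forall>x\<in>E. norm (T x) \<le> C * norm x" using T unfolding bounded_linear_on_def by auto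
  let ?s = "\<lambda>F. \<Sum>i\<in>F. a i *\<^sub>R f i" and ?t = "\<lambda>F. \<Sum>i\<in>F. a i *\<^sub>R T (f i)"
  have le: "norm (?t F - T x) \<le> C * norm (?s F - x)" if F: "finite F" "F \<subseteq> I" for F
  proof -
    have s: "?s F \<in> E" using F(2) f E by (intro subspace_sum subspace_scale) auto
    have t: "T (?s F) = ?t F" using F(2) f by (intro bounded_linear_on_sum[OF T E _ F(1)]) auto
    have sx: "?s F - x \<in> E" using E s x by (rule subspace_diff)
    then have "T ((?s F - x) + x) = T (?s F - x) + T x" using T x unfolding bounded_linear_on_def by blast
    then have "?t F - T x = T (?s F - x)" using t by simp
    then show ?thesis using bspec[OF C sx] by simp
  qed
  have "((\<lambda>F. ?s F - x) \<longlongrightarrow> 0) (finite_subsets_at_top I)"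
    using sum unfolding has_sum_def by (rule LIM_zero)
  then have "((\<lambda>F. C * norm (?s F - x)) \<longlongrightarrow> 0) (finite_subsets_at_top I)"
    by (intro tendsto_mult_right_zero tendsto_norm_zero)
  then have "((\<lambda>F. ?t F - T x) \<longlongrightarrow> 0) (finite_subsets_at_top I)"
    by (rule Lim_null_comparison[rotated]) (intro eventually_finite_subsets_at_top_weakI le)
  then show ?thesis unfolding has_sum_def by (rule LIM_zero_cancel)
qed

theorem unconditional_basis_if_isomorphic_c0:
  fixes E :: "'v::real_normed_vector set" and \<Gamma> :: "'i set"
  assumes iso: "isomorphic_banach E (c0_space \<Gamma>)" and E: "subspace E"
  shows "has_unconditional_basis E"
proof -
  let ?c0 = "c0_space \<Gamma>"
  obtain T S where T: "bounded_linear_on E ?c0 T" and S: "bounded_linear_on ?c0 E S"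
    and ST: "\<forall>x\<in>E. S (T x) = x" and TS: "\<forall>y\<in>?c0. T (S y) = y"
    using iso unfolding isomorphic_banach_def by (elim exE conjE)
  have T_in: "T x \<in> ?c0" if "x \<in> E" for x using T that unfolding bounded_linear_on_def by blast
  define e where "e i = S (unit_function i)" for i
  have e: "e i \<in> E" "T (e i) = unit_function i" if "i \<in> \<Gamma>" for i
    using S TS unit_function_in[OF that] unfolding bounded_linear_on_def e_def by blast+
  have inj: "inj_on e \<Gamma>"
  proof (rule inj_onI)
    fix i j assume "i \<in> \<Gamma>" "j \<in> \<Gamma>" "e i = e j"
    then have "unit_function i = unit_function j" using e(2) by metis
    then have "val (unit_function i) i = val (unit_function j) i" by simp
    then show "i = j" by (simp split: if_splits)
  qed
  have expansion: "((\<lambda>i. val (T x) i *\<^sub>R e i) has_sum x) \<Gamma>" if x: "x \<in> E" for x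
    using bounded_linear_on_has_sum[OF S subspace_c0_space unit_function_in T_in[OF x]
        has_sum_unit_functions[OF T_in[OF x]]] ST x by (simp add: e_def)
  have unique: "a i = val (T x) i"
    if x: "x \<in> E" and a: "((\<lambda>i. a i *\<^sub>R e i) has_sum x) \<Gamma>" and i: "i \<in> \<Gamma>" for a x i
  proof -
    \<comment> \<open>Applying T and then evaluating at i leaves only the term with index i, which
      determines the coefficient.\<close>
    have "((\<lambda>j. a j *\<^sub>R T (e j)) has_sum T x) \<Gamma>"
      by (rule bounded_linear_on_has_sum[OF T E e(1) x a])
    then have "((\<lambda>j. val (a j *\<^sub>R T (e j)) i) has_sum val (T x) i) \<Gamma>"
      by (rule has_sum_bounded_linear[OF bounded_linear_eval_bcontfun])
    moreover have "((\<lambda>j. val (a j *\<^sub>R T (e j)) i) has_sum a i) \<Gamma>"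
      by (rule has_sum_finite_neutralI[of "{i}"]) (use i e(2) in auto)
    ultimately show ?thesis using has_sum_unique by blast
  qed
  \<comment> \<open>\<open>has_unconditional_basis\<close> asks for an index set of vectors, so the
    basis is reindexed by itself.\<close>
  define n where "n = inv_into \<Gamma> e"
  have n: "n (e i) = i" if "i \<in> \<Gamma>" for i using inj that by (simp add: n_def)
  have reindex: "((\<lambda>v. a v *\<^sub>R v) has_sum x) (e ` \<Gamma>) \<longleftrightarrow> ((\<lambda>i. a (e i) *\<^sub>R e i) has_sum x) \<Gamma>" for a x
    using has_sum_reindex[OF inj, of "\<lambda>v. a v *\<^sub>R v" x] by (simp add: comp_def)
  have "unconditional_basis E (e ` \<Gamma>) id"
    unfolding unconditional_basis_def
  proof (intro conjI ballI)
    show "id ` e ` \<Gamma> \<subseteq> E" using e(1) by auto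
    fix x assume x: "x \<in> E"
    define a where "a v = (if v \<in> e ` \<Gamma> then val (T x) (n v) else 0)" for v
    show "\<exists>!a. (\<forall>v. v \<notin> e ` \<Gamma> \<longrightarrow> a v = 0) \<and> ((\<lambda>v. a v *\<^sub>R id v) has_sum x) (e ` \<Gamma>)"
    proof (rule ex1I[of _ a])
      have "((\<lambda>i. a (e i) *\<^sub>R e i) has_sum x) \<Gamma> \<longleftrightarrow> ((\<lambda>i. val (T x) i *\<^sub>R e i) has_sum x) \<Gamma>"
        by (rule has_sum_cong) (simp add: a_def n)
      then show "(\<forall>v. v \<notin> e ` \<Gamma> \<longrightarrow> a v = 0) \<and> ((\<lambda>v. a v *\<^sub>R id v) has_sum x) (e ` \<Gamma>)"
        using expansion[OF x] by (simp add: reindex a_def)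
    next
      fix b assume b: "(\<forall>v. v \<notin> e ` \<Gamma> \<longrightarrow> b v = 0) \<and> ((\<lambda>v. b v *\<^sub>R id v) has_sum x) (e ` \<Gamma>)"
      then have "((\<lambda>i. b (e i) *\<^sub>R e i) has_sum x) \<Gamma>" by (simp add: reindex)
      then have "b (e i) = val (T x) i" if "i \<in> \<Gamma>" for i
        using unique[OF x, of "\<lambda>i. b (e i)"] that by simp
      then show "b = a" using b n by (auto simp: a_def fun_eq_iff)
    qed
  qed
  then show ?thesis unfolding has_unconditional_basis_def by blast
qed

theorem theorem1p3:
  fixes \<A> :: "'a set set"
  assumes "almost_disjoint_countable \<A>" and "\<A> \<noteq> {}"
  shows "(disjointifiable \<A> \<longleftrightarrow> eberlein_compact (K_space \<A>)) \<and>
         (disjointifiable \<A> \<longleftrightarrow>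
            isomorphic_banach (C_space (K_space \<A>)) (c0_space (\<A> <+> (UNIV :: nat set)))) \<and>
         (disjointifiable \<A> \<longleftrightarrow> has_unconditional_basis (C_space (K_space \<A>))) \<and>
         (disjointifiable \<A> \<longleftrightarrow> has_projectional_skeleton (C_space (K_space \<A>)))"
proof -
  note ad = assms(1)
  let ?E = "C_space (K_space \<A>)"
  have 1: "disjointifiable \<A> \<longleftrightarrow> essentially_disjoint \<A>"
    using essentially_disjoint_if_disjointifiable[OF ad] disjointifiable_if_essentially_disjoint[OF ad] ..
  have 2: "essentially_disjoint \<A> \<longleftrightarrow> eberlein_compact (K_space \<A>)"
    using eberlein_if_essentially_disjoint[OF ad] essentially_disjoint_if_eberlein[OF ad] ..
  obtain \<beta> where \<beta>: "bij_betw \<beta> (K_points \<A>) (\<A> <+> (UNIV :: nat set))"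
    using K_points_bij[OF assms] ..
  have 3: "isomorphic_banach ?E (c0_space (\<A> <+> (UNIV :: nat set)))" if "essentially_disjoint \<A>"
    using ad that \<beta> by (rule isomorphic_c0_if_essentially_disjoint)
  have 4: "has_unconditional_basis ?E" if "isomorphic_banach ?E (c0_space (\<A> <+> (UNIV :: nat set)))"
    using that subspace_C_space by (rule unconditional_basis_if_isomorphic_c0)
  have 5: "has_projectional_skeleton ?E" if basis: "has_unconditional_basis ?E"
  proof -
    obtain I :: "('a kpoint discrete \<Rightarrow>\<^sub>C real) set" and e where "unconditional_basis ?E I e"
      using basis unfolding has_unconditional_basis_def by (elim exE)
    then interpret unconditional_basis_of ?E I e
      by unfold_locales (rule closed_C_space[OF ad], rule subspace_C_space)
    show ?thesis by (rule has_projectional_skeleton)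
  qed
  have 6: "essentially_disjoint \<A>" if "has_projectional_skeleton ?E"
    using ad that by (rule essentially_disjoint_if_projectional_skeleton)
  \<comment> \<open>The facts 3 to 6 form a cycle through c0, bases and skeletons back to
    \<open>essentially_disjoint\<close>, while 1 and 2 are equivalences with it.\<close>
  show ?thesis unfolding 1 using 2 3 4 5 6 by argo
qed

end
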